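(* Let $V=V_1\oplus V_2$ be a decomposition of a finite-dimensional vector space over a field $F$. The product of elements $a_1\otimes b_1\in\mathrm{St}^2(V_1)$ and $a_2\otimes b_2\in\mathrm{St}^2(V_2)$ (induced by the shuffle product on the bar complex of the Steinberg module) is the element $$m(a_1\otimes b_1,\,a_2\otimes b_2)=m(a_1,a_2)\otimes m(b_1,b_2)\in\mathrm{St}^2(V).$$
   Context: **Steinberg module.** For a $d$-dimensional vector space $V$ over $F$, $\mathrm{St}(V)=\widetilde H_{d-2}(\mathcal T_V,\mathbb Q)$ ($\mathcal T_V$ the Tits building), with $\mathrm{St}(V)=\mathbb Q$ if $d\le 1$. It is spanned by apartments $[v_1,\dots,v_d]$ ($v_1,\dots,v_d$ a basis of $V$), where $[v_1,\dots,v_d]$ is the class of the cycle $$\sum_{\sigma\in\mathfrak S_d}(-1)^\sigma\bigl(0\subsetneq\langle v_{\sigma(1)}\rangle\subsetneq\langle v_{\sigma(1)},v_{\sigma(2)}\rangle\subsetneq\dots\subsetneq V\bigr)$$ in $C_{d-2}(\mathcal T_V)$, the free $\mathbb Q$-vector space on complete flags; thus $\mathrm{St}(V)\subseteq C_{d-2}(\mathcal T_V)$. For $V=V_1\oplus V_2$ let $m:\mathrm{St}(V_1)\otimes\mathrm{St}(V_2)\to\mathrm{St}(V)$, $[v_1,\dots,v_{d_1}]\otimes[v_{d_1+1},\dots,v_{d_1+d_2}]\mapsto[v_1,\dots,v_{d_1+d_2}]$. Put $\mathrm{St}^2(V)=\mathrm{St}(V)\otimes_{\mathbb Q}\mathrm{St}(V)$.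 **Bar complex.** $\mathrm B_m\mathrm{St}(V)=\bigoplus_{V=V_1\oplus\dots\oplus V_m,\,V_i\ne0}\mathrm{St}(V_1)\otimes\dots\otimes\mathrm{St}(V_m)$, spanned by elements $[a_1|\cdots|a_m]$, $a_i\in \mathrm{St}(V_i)$, with $\partial[a_1|\cdots|a_m]=\sum_{j=1}^{m-1}(-1)^{j-1}[a_1|\cdots|a_ja_{j+1}|\cdots|a_m]$. For $d=\dim V$, $\mathrm B_d\mathrm{St}(V)$ has a basis $[v_1|\cdots|v_d]$ indexed by ordered decompositions $V=\langle v_1\rangle\oplus\dots\oplus\langle v_d\rangle$ into lines. The linear map $\beta_d:\mathrm B_d\mathrm{St}(V)\to C_{d-2}(\mathcal T_V)\otimes\mathrm{St}(V)$, $[v_1|\cdots|v_d]\mapsto(0\subsetneq\langle v_1\rangle\subsetneq\dots\subsetneq\langle v_1,\dots,v_d\rangle)\otimes[v_1,\dots,v_d]$, is an isomorphism, which identifies $\ker(\partial:\mathrm B_d\mathrm{St}(V)\to\mathrm B_{d-1}\mathrm{St}(V))$ with the subspace $\mathrm{St}(V)\otimes\mathrm{St}(V)$. Let $s:\mathrm{St}^2(V)\to\ker\partial\subseteq\mathrm B_d\mathrm{St}(V)$ be the restriction of $\beta_d^{-1}$. **Product on $\mathrm{St}^2$.** The product $m:\mathrm{St}^2(V_1)\otimes\mathrm{St}^2(V_2)\to\mathrm{St}^2(V_1\oplus V_2)$ is defined, through the identifications $s$, as the one induced by the shuffle product $$[v_1|\cdots|v_{d_1}]\cdot[v_{d_1+1}|\cdots|v_{d_1+d_2}]=\sum_{\sigma}[v_{\sigma(1)}|\cdots|v_{\sigma(d_1+d_2)}],$$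 $\sigma$ running over $(d_1,d_2)$-shuffles, i.e. $\sigma\in\mathfrak S_{d_1+d_2}$ with $\sigma^{-1}(1)<\dots<\sigma^{-1}(d_1)$ and $\sigma^{-1}(d_1+1)<\dots<\sigma^{-1}(d_1+d_2)$. *)

theory Defs
  imports Complex_Main "HOL-Library.Poly_Mapping" "HOL-Combinatorics.Permutations"
begin

section \<open>Free rational vector spaces and their tensor products\<close>

text \<open>
  The free \<open>\<rat>\<close>-vector space on a type \<open>'k\<close> is the type of finitely supported functions
  \<open>'k \<Rightarrow>\<^sub>0 rat\<close>; the basis vector of \<open>k\<close> is \<open>Poly_Mapping.single k 1\<close>.
\<close>

definition qscale :: "rat \<Rightarrow> ('k \<Rightarrow>\<^sub>0 rat) \<Rightarrow> ('k \<Rightarrow>\<^sub>0 rat)" where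
  "qscale q x = Poly_Mapping.map ((*) q) x"

lemma lookup_qscale: "Poly_Mapping.lookup (qscale q x) k = q * Poly_Mapping.lookup x k"
  by (simp add: qscale_def Poly_Mapping.map.rep_eq when_def)

global_interpretation rat_space: vector_space "qscale :: rat \<Rightarrow> ('k \<Rightarrow>\<^sub>0 rat) \<Rightarrow> ('k \<Rightarrow>\<^sub>0 rat)"
  by unfold_locales
    (auto intro!: poly_mapping_eqI simp: lookup_qscale lookup_add algebra_simps)

abbreviation qlinear :: "(('k \<Rightarrow>\<^sub>0 rat) \<Rightarrow> ('l \<Rightarrow>\<^sub>0 rat)) \<Rightarrow> bool" where
  "qlinear \<equiv> Vector_Spaces.linear qscale qscale"

text \<open>
  The tensor product of the free spaces on \<open>'k\<close> and \<open>'l\<close> is the free space on \<open>'k \<times> 'l\<close>.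
  Over a field, the tensor product of subspaces \<open>A\<close>, \<open>B\<close> embeds into it as the span of the
  pure tensors of elements of \<open>A\<close> and \<open>B\<close>. In the same way, an \<open>m\<close>-fold tensor product
  lives in the free space on lists (of length \<open>m\<close>).
\<close>

definition tensor :: "('k \<Rightarrow>\<^sub>0 rat) \<Rightarrow> ('l \<Rightarrow>\<^sub>0 rat) \<Rightarrow> ('k \<times> 'l \<Rightarrow>\<^sub>0 rat)"  (infixr "\<otimes>\<^sub>Q" 70) where
  "x \<otimes>\<^sub>Q y = (\<Sum>k\<in>Poly_Mapping.keys x. \<Sum>l\<in>Poly_Mapping.keys y.
     Poly_Mapping.single (k, l) (Poly_Mapping.lookup x k * Poly_Mapping.lookup y l))"

primrec tensor_list :: "('k \<Rightarrow>\<^sub>0 rat) list \<Rightarrow> ('k list \<Rightarrow>\<^sub>0 rat)" where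
  "tensor_list [] = Poly_Mapping.single [] 1"
| "tensor_list (x # xs) = (\<Sum>k\<in>Poly_Mapping.keys x. \<Sum>ks\<in>Poly_Mapping.keys (tensor_list xs).
     Poly_Mapping.single (k # ks) (Poly_Mapping.lookup x k * Poly_Mapping.lookup (tensor_list xs) ks))"

type_synonym 'v flag = "'v set list"
type_synonym 'v chain = "'v flag \<Rightarrow>\<^sub>0 rat"
type_synonym 'v bar_chain = "'v flag list \<Rightarrow>\<^sub>0 rat"
type_synonym 'v chain2 = "'v flag \<times> 'v flag \<Rightarrow>\<^sub>0 rat"

locale steinberg = vector_space scale
  for scale :: "'f::field \<Rightarrow> 'v::ab_group_add \<Rightarrow> 'v"
begin

section \<open>Bases and direct sums\<close>

text \<open>All vector spaces are finite-dimensional subspaces of the ambient space \<open>'v\<close>.\<close>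

definition fin_dim :: "'v set \<Rightarrow> bool" where
  "fin_dim V \<longleftrightarrow> (\<exists>B. finite B \<and> span B = V)"

definition ordered_basis :: "'v set \<Rightarrow> 'v list \<Rightarrow> bool" where
  "ordered_basis V vs \<longleftrightarrow> distinct vs \<and> independent (set vs) \<and> span (set vs) = V"

text \<open>
  Internal direct sum \<open>V = V\<^sub>1 \<oplus> \<dots> \<oplus> V\<^sub>m\<close>: every \<open>v \<in> V\<close> is \<open>x\<^sub>1 + \<dots> + x\<^sub>m\<close> for exactly one
  tuple with \<open>x\<^sub>i \<in> V\<^sub>i\<close>.
\<close>

definition direct_sum :: "'v set \<Rightarrow> 'v set list \<Rightarrow> bool" where
  "direct_sum V Vs \<longleftrightarrow> (\<forall>W\<in>set Vs. subspace W) \<and> bij_betw sum_list (listset Vs) V"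


section \<open>The Tits building and the Steinberg module\<close>

text \<open>
  Flags are written with both end points, \<open>[0, W\<^sub>1, \<dots>, W\<^sub>k, V]\<close>. For \<open>V \<noteq> 0\<close> such a flag is the
  \<open>(k - 1)\<close>-simplex \<open>W\<^sub>1 \<subset> \<dots> \<subset> W\<^sub>k\<close> of the Tits building (the empty simplex if \<open>k = 0\<close>);
  for \<open>V = 0\<close> the only flag is \<open>[0]\<close>. Complete flags have length \<open>dim V + 1\<close>.
\<close>

definition is_flag :: "'v set \<Rightarrow> 'v flag \<Rightarrow> bool" where
  "is_flag V Ws \<longleftrightarrow> Ws \<noteq> [] \<and> hd Ws = {0} \<and> last Ws = V \<and>
     (\<forall>W\<in>set Ws. subspace W) \<and> sorted_wrt (\<subset>) Ws"

definition complete_flags :: "'v set \<Rightarrow> 'v flag set" where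
  "complete_flags V = {Ws. is_flag V Ws \<and> length Ws = Suc (dim V)}"

definition top_chains :: "'v set \<Rightarrow> 'v chain set" where
  "top_chains V = {c. Poly_Mapping.keys c \<subseteq> complete_flags V}"

text \<open>
  The boundary of the augmented simplicial chain complex: it omits one of the proper subspaces
  \<open>W\<^sub>1, \<dots>, W\<^sub>k\<close>, never an end point.
\<close>

definition building_boundary :: "'v chain \<Rightarrow> 'v chain" where
  "building_boundary c = (\<Sum>Ws\<in>Poly_Mapping.keys c. \<Sum>i\<in>{1..<length Ws - 1}.
     Poly_Mapping.single (take i Ws @ drop (Suc i) Ws)
       ((-1) ^ (i - 1) * Poly_Mapping.lookup c Ws))"

text \<open>
  The building has no simplices of dimension above \<open>dim V - 2\<close>, so its top reduced homology is
  the space of top-dimensional cycles. For \<open>dim V \<le> 1\<close> there is one complete flag, with zero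
  boundary, and the definition gives the one-dimensional space \<open>\<rat>\<close>.
\<close>

definition St :: "'v set \<Rightarrow> 'v chain set" where
  "St V = {c \<in> top_chains V. building_boundary c = 0}"

definition flag_of :: "'v list \<Rightarrow> 'v flag" where
  "flag_of vs = map (\<lambda>i. span (set (take i vs))) [0..<Suc (length vs)]"

definition apartment :: "'v list \<Rightarrow> 'v chain" where
  "apartment vs = (\<Sum>\<sigma> | \<sigma> permutes {..<length vs}.
     Poly_Mapping.single (flag_of (permute_list \<sigma> vs)) (of_int (sign \<sigma>)))"

text \<open>
  The product \<open>St(V\<^sub>1) \<otimes> St(V\<^sub>2) \<rightarrow> St(V\<^sub>1 \<oplus> V\<^sub>2)\<close>. Here and below, a linear map on a subspace is
  represented by some linear map on the ambient free space with the prescribed values on a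
  spanning set of the subspace; only its values on the subspace matter.
\<close>

definition St_mult :: "'v set \<Rightarrow> 'v set \<Rightarrow> 'v chain2 \<Rightarrow> 'v chain" where
  "St_mult V1 V2 = (SOME \<mu>. qlinear \<mu> \<and>
     (\<forall>vs ws. ordered_basis V1 vs \<and> ordered_basis V2 ws \<longrightarrow>
        \<mu> (apartment vs \<otimes>\<^sub>Q apartment ws) = apartment (vs @ ws)))"

definition St2 :: "'v set \<Rightarrow> 'v chain2 set" where
  "St2 V = rat_space.span {a \<otimes>\<^sub>Q b | a b. a \<in> St V \<and> b \<in> St V}"


section \<open>The bar complex\<close>

definition bar_symbols :: "nat \<Rightarrow> 'v set \<Rightarrow> ('v set list \<times> 'v chain list) set" where
  "bar_symbols m V = {(Vs, as). length Vs = m \<and> direct_sum V Vs \<and> {0} \<notin> set Vs \<and>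
     list_all2 (\<lambda>a W. a \<in> St W) as Vs}"

text \<open>
  A key of \<open>[a\<^sub>1|\<dots>|a\<^sub>m]\<close> is a list of flags of \<open>V\<^sub>1, \<dots>, V\<^sub>m\<close>, whose last members are
  \<open>V\<^sub>1, \<dots>, V\<^sub>m\<close>. So elements belonging to different decompositions have disjoint supports, and the
  span below is the direct sum over all decompositions.
\<close>

definition bar :: "nat \<Rightarrow> 'v set \<Rightarrow> 'v bar_chain set" where
  "bar m V = rat_space.span {tensor_list as | Vs as. (Vs, as) \<in> bar_symbols m V}"

definition bar_boundary :: "nat \<Rightarrow> 'v set \<Rightarrow> 'v bar_chain \<Rightarrow> 'v bar_chain" where
  "bar_boundary m V = (SOME D. qlinear D \<and>
     (\<forall>(Vs, as) \<in> bar_symbols m V. D (tensor_list as) =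
        (\<Sum>j<m - 1. qscale ((-1) ^ j) (tensor_list
           (take j as @ St_mult (Vs ! j) (Vs ! Suc j) (as ! j \<otimes>\<^sub>Q as ! Suc j)
              # drop (Suc (Suc j)) as)))))"

definition bar_cycles :: "'v set \<Rightarrow> 'v bar_chain set" where
  "bar_cycles V = {x \<in> bar (dim V) V. bar_boundary (dim V) V x = 0}"

text \<open>The symbol \<open>[v\<^sub>1|\<dots>|v\<^sub>d]\<close>, where the entry \<open>v\<^sub>i\<close> is the generator \<open>[v\<^sub>i]\<close> of \<open>St(\<langle>v\<^sub>i\<rangle>)\<close>.\<close>

definition bar_basis :: "'v list \<Rightarrow> 'v bar_chain" where
  "bar_basis vs = tensor_list (map (\<lambda>v. apartment [v]) vs)"

definition beta :: "'v set \<Rightarrow> 'v bar_chain \<Rightarrow> 'v chain2" where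
  "beta V = (SOME \<beta>. qlinear \<beta> \<and>
     (\<forall>vs. ordered_basis V vs \<longrightarrow>
        \<beta> (bar_basis vs) = Poly_Mapping.single (flag_of vs) 1 \<otimes>\<^sub>Q apartment vs))"

definition s :: "'v set \<Rightarrow> 'v chain2 \<Rightarrow> 'v bar_chain" where
  "s V = inv_into (bar_cycles V) (beta V)"


section \<open>The shuffle product\<close>

definition shuffle_perms :: "nat \<Rightarrow> nat \<Rightarrow> (nat \<Rightarrow> nat) set" where
  "shuffle_perms p q = {\<sigma>. \<sigma> permutes {..<p + q} \<and>
     strict_mono_on {..<p} (inv \<sigma>) \<and> strict_mono_on {p..<p + q} (inv \<sigma>)}"

definition bar_shuffle :: "'v set \<Rightarrow> 'v set \<Rightarrow> ('v flag list \<times> 'v flag list \<Rightarrow>\<^sub>0 rat) \<Rightarrow> 'v bar_chain" where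
  "bar_shuffle V1 V2 = (SOME \<mu>. qlinear \<mu> \<and>
     (\<forall>vs ws. ordered_basis V1 vs \<and> ordered_basis V2 ws \<longrightarrow>
        \<mu> (bar_basis vs \<otimes>\<^sub>Q bar_basis ws) =
          (\<Sum>\<sigma>\<in>shuffle_perms (length vs) (length ws). bar_basis (permute_list \<sigma> (vs @ ws)))))"

text \<open>The shuffle product transported along \<open>s\<close>, for \<open>V = V\<^sub>1 \<oplus> V\<^sub>2\<close>.\<close>

definition St2_mult :: "'v set \<Rightarrow> 'v set \<Rightarrow> 'v set \<Rightarrow> 'v chain2 \<Rightarrow> 'v chain2 \<Rightarrow> 'v chain2" where
  "St2_mult V V1 V2 x y = inv_into (St2 V) (s V) (bar_shuffle V1 V2 (s V1 x \<otimes>\<^sub>Q s V2 y))"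

end

end

theory Submission
  imports Defs "HOL-Library.Infinite_Set"
begin

text \<open>
  The signed shuffle of two flags is a linear map \<open>\<mu>\<close> on all top chains that takes \<open>[v] \<otimes> [w]\<close> to
  \<open>[v, w]\<close>, because every permutation of a juxtaposition is uniquely a pair of permutations of the
  two blocks followed by a shuffle. Since a permutation \<open>\<sigma>\<close> multiplies an apartment by its sign,
  \<open>\<beta>\<close> turns the unsigned shuffle of bar symbols into \<open>\<mu> \<otimes> \<mu>\<close>. It remains to see that everything in
  the statement is determined by its values on apartments and that \<open>s\<close> inverts \<open>\<beta>\<close>:

  \<^item> St is spanned by the apartments through any given flag \<open>\<langle>u\<rangle> \<subset> \<dots>\<close> (Solomon--Tits): subtracting
    suitable apartments \<open>[w, u]\<close>, with \<open>w\<close> a basis of a hyperplane missing \<open>u\<close>, leaves a cycle on flags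
    whose hyperplanes all contain \<open>u\<close>, and there is none except \<open>0\<close>.
  \<^item> \<open>\<beta>\<close> is injective: \<open>[v]\<close> is the only apartment through the flag of \<open>v\<close> containing the opposite
    flag.
  \<^item> Every \<open>a \<otimes> b\<close> is \<open>\<beta>\<close> of a bar cycle: the \<open>j\<close>-th face of \<open>\<beta>\<^sup>-\<^sup>1(F \<otimes> b)\<close> depends only on the panel
    of \<open>F\<close> at \<open>j\<close>, and the coefficients of the cycle \<open>a\<close> sum to \<open>0\<close> over each panel.
\<close>

section \<open>Linear maps on free spaces\<close>

text \<open>\<open>St_mult\<close>, \<open>bar_boundary\<close>, \<open>beta\<close> and
  \<open>bar_shuffle\<close> are chosen by \<open>SOME\<close>, so nothing is known of them until
  some linear map with the prescribed values is exhibited. For the last three this is mainly a check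
  that the values depend on lines rather than on vectors. For \<open>St_mult\<close> it is a real
  obstacle, as apartments satisfy many linear relations; a map given on flags has no relations to
  respect, which is why the product is first built as \<open>shuffle_mult\<close>. The shuffle of
  bar symbols carries no signs. Under \<open>beta\<close> each shuffle reorders the apartment in the
  right factor and so produces its sign; the tensor product lets the sign pass to the left factor,
  where the signed shuffle of flags requires it. The prescribed flag in Solomon--Tits is essential:
  F \<otimes> b is seen to be a value of \<open>beta\<close> by writing b with apartments through F
  itself. That the shuffle of the two cycles is again a cycle is read off at the end: it has the
  same image under \<open>beta\<close> as the cycle \<open>s V z\<close>, where z is the expected
  product, and \<open>beta\<close> is injective on all of \<open>bar (dim V) V\<close>.\<close>

abbreviation coeff :: "('k \<Rightarrow>\<^sub>0 rat) \<Rightarrow> 'k \<Rightarrow> rat" where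
  "coeff \<equiv> Poly_Mapping.lookup"

abbreviation supp :: "('k \<Rightarrow>\<^sub>0 rat) \<Rightarrow> 'k set" where
  "supp \<equiv> Poly_Mapping.keys"

abbreviation bvec :: "'k \<Rightarrow> ('k \<Rightarrow>\<^sub>0 rat)" where
  "bvec k \<equiv> Poly_Mapping.single k 1"

lemma coeff_sum: "coeff (sum f A) k = (\<Sum>i\<in>A. coeff (f i) k)"
  by (induction A rule: infinite_finite_induct) (auto simp: lookup_add)

lemma coeff_bvec: "coeff (bvec k) l = (if k = l then 1 else 0)"
  by (simp add: lookup_single when_def)

lemma qscale_single: "qscale q (Poly_Mapping.single k r) = Poly_Mapping.single k (q * r)"
  by (rule poly_mapping_eqI) (simp add: lookup_qscale lookup_single when_def)

lemma sum_coeff_bvec: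
  assumes "finite A" "supp x \<subseteq> A"
  shows "x = (\<Sum>k\<in>A. qscale (coeff x k) (bvec k))"
proof (rule poly_mapping_eqI)
  fix l
  have "(\<Sum>k\<in>A. coeff x k * (if k = l then 1 else 0)) = coeff x l"
    using assms by (auto simp: if_distrib sum.delta in_keys_iff cong: if_cong)
  then show "coeff x l = coeff (\<Sum>k\<in>A. qscale (coeff x k) (bvec k)) l"
    by (simp add: coeff_sum lookup_qscale coeff_bvec)
qed

lemma qlinear_iff:
  "qlinear f \<longleftrightarrow> (\<forall>x y. f (x + y) = f x + f y) \<and> (\<forall>c x. f (qscale c x) = qscale c (f x))"
  unfolding Vector_Spaces.linear_iff by (simp add: rat_space.vector_space_axioms)

lemma qlinearI:
  assumes "\<And>x y. f (x + y) = f x + f y" "\<And>c x. f (qscale c x) = qscale c (f x)"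
  shows "qlinear f"
  using assms by (simp add: qlinear_iff)

lemma qlinear_add: "qlinear f \<Longrightarrow> f (x + y) = f x + f y"
  and qlinear_scale: "qlinear f \<Longrightarrow> f (qscale c x) = qscale c (f x)"
  by (simp_all add: qlinear_iff)

lemma qlinear_zero: "qlinear f \<Longrightarrow> f 0 = 0"
  using qlinear_add[of f 0 0] by simp

lemma qlinear_neg: "qlinear f \<Longrightarrow> f (- x) = - f x"
  using qlinear_add[of f x "- x"] qlinear_zero[of f] by (simp add: eq_neg_iff_add_eq_0 add.commute)

lemma qlinear_diff: "qlinear f \<Longrightarrow> f (x - y) = f x - f y"
  using qlinear_add[of f x "- y"] qlinear_neg[of f y] by simp

lemma qlinear_sum: "qlinear f \<Longrightarrow> f (sum g A) = (\<Sum>i\<in>A. f (g i))"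
  by (induction A rule: infinite_finite_induct) (auto simp: qlinear_zero qlinear_add)

lemmas qlin_simps = qlinear_add qlinear_scale qlinear_zero qlinear_neg qlinear_diff qlinear_sum

lemma qlinear_compose: "qlinear f \<Longrightarrow> qlinear g \<Longrightarrow> qlinear (\<lambda>x. f (g x))"
  by (simp add: qlinear_iff)

lemma qlinear_smult: "qlinear f \<Longrightarrow> qlinear (\<lambda>x. qscale c (f x))"
  by (simp add: qlinear_iff rat_space.scale_right_distrib mult.commute)

lemma qlinear_sumI: "(\<And>i. i \<in> A \<Longrightarrow> qlinear (f i)) \<Longrightarrow> qlinear (\<lambda>x. \<Sum>i\<in>A. f i x)"
  by (auto intro!: qlinearI sum.cong simp: qlin_simps sum.distrib rat_space.scale_sum_right)

lemma qlinear_eq_on_span: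
  assumes "qlinear f" "qlinear g" "\<And>x. x \<in> S \<Longrightarrow> f x = g x" "x \<in> rat_space.span S"
  shows "f x = g x"
  using assms(4)
  by (induction rule: rat_space.span_induct_alt) (use assms(1-3) in \<open>auto simp: qlin_simps\<close>)

lemma span_bvec: "(x :: 'k \<Rightarrow>\<^sub>0 rat) \<in> rat_space.span (bvec ` supp x)"
proof -
  have "(\<Sum>k\<in>supp x. qscale (coeff x k) (bvec k)) \<in> rat_space.span (bvec ` supp x)"
    by (intro rat_space.span_sum rat_space.span_scale rat_space.span_base) auto
  then show ?thesis using sum_coeff_bvec[of "supp x" x] by simp
qed

lemma qlinear_eqI:
  assumes "qlinear f" "qlinear g" "\<And>k. f (bvec k) = g (bvec k)"
  shows "f x = g x"
  using qlinear_eq_on_span[OF assms(1,2) _ span_bvec] assms(3) by auto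

section \<open>Linear maps prescribed on basis vectors\<close>

definition lin_ext :: "('k \<Rightarrow> ('l \<Rightarrow>\<^sub>0 rat)) \<Rightarrow> ('k \<Rightarrow>\<^sub>0 rat) \<Rightarrow> ('l \<Rightarrow>\<^sub>0 rat)" where
  "lin_ext f x = (\<Sum>k\<in>supp x. qscale (coeff x k) (f k))"

lemma lin_ext_superset:
  assumes "finite A" "supp x \<subseteq> A"
  shows "lin_ext f x = (\<Sum>k\<in>A. qscale (coeff x k) (f k))"
  unfolding lin_ext_def using assms
  by (intro sum.mono_neutral_left) (auto simp: in_keys_iff)

lemma qlinear_lin_ext: "qlinear (lin_ext f)"
proof (rule qlinearI)
  fix x y :: "'a \<Rightarrow>\<^sub>0 rat"
  have "finite (supp x \<union> supp y)" "supp (x + y) \<subseteq> supp x \<union> supp y"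
    by (auto simp: keys_add)
  then show "lin_ext f (x + y) = lin_ext f x + lin_ext f y"
    by (simp add: lin_ext_superset[of "supp x \<union> supp y"] lookup_add sum.distrib
        rat_space.scale_left_distrib del: finite_Un)
next
  fix c and x :: "'a \<Rightarrow>\<^sub>0 rat"
  have "supp (qscale c x) \<subseteq> supp x"
    by (auto simp: in_keys_iff lookup_qscale)
  then show "lin_ext f (qscale c x) = qscale c (lin_ext f x)"
    by (simp add: lin_ext_superset[of "supp x"] lookup_qscale rat_space.scale_sum_right)
qed

lemma lin_ext_single: "lin_ext f (Poly_Mapping.single k r) = qscale r (f k)"
  by (simp add: lin_ext_superset[of "{k}"])

lemma lin_ext_bvec [simp]: "lin_ext f (bvec k) = f k"
  by (simp add: lin_ext_single)

text \<open>Well-definedness test for maps prescribed with redundant indices: bar symbols are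
  indexed by ordered bases, while the basis vector depends only on the lines. The witness extends
  linearly after picking one index for each key.\<close>

lemma ex_qlinear_on_bvec:
  assumes "\<And>i j. i \<in> I \<Longrightarrow> j \<in> I \<Longrightarrow> k i = k j \<Longrightarrow> f i = f j"
  shows "\<exists>\<mu>. qlinear \<mu> \<and> (\<forall>i\<in>I. \<mu> (bvec (k i)) = f i)"
proof (intro exI conjI ballI)
  fix i assume i: "i \<in> I"
  have "inv_into I k (k i) \<in> I" "k (inv_into I k (k i)) = k i"
    using i by (auto intro: inv_into_into f_inv_into_f)
  then show "lin_ext (\<lambda>l. f (inv_into I k l)) (bvec (k i)) = f i"
    using assms[of "inv_into I k (k i)" i] i by simp
qed (rule qlinear_lin_ext)

section \<open>Tensor products\<close>

lemma coeff_tensor: "coeff (x \<otimes>\<^sub>Q y) (k, l) = coeff x k * coeff y l"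
proof -
  have "coeff (x \<otimes>\<^sub>Q y) (k, l) = (\<Sum>k'\<in>supp x. \<Sum>l'\<in>supp y.
      if k' = k \<and> l' = l then coeff x k' * coeff y l' else 0)"
    by (simp add: tensor_def coeff_sum lookup_single when_def)
  also have "\<dots> = (\<Sum>k'\<in>supp x. if k' = k then \<Sum>l'\<in>supp y.
      if l' = l then coeff x k' * coeff y l' else 0 else 0)"
    by (intro sum.cong) auto
  finally show ?thesis by (simp add: in_keys_iff)
qed

lemma tensor_add_left: "(x + y) \<otimes>\<^sub>Q z = x \<otimes>\<^sub>Q z + y \<otimes>\<^sub>Q z"
  and tensor_add_right: "w \<otimes>\<^sub>Q (u + v) = w \<otimes>\<^sub>Q u + w \<otimes>\<^sub>Q v"
  and tensor_scale_left: "qscale c x \<otimes>\<^sub>Q z = qscale c (x \<otimes>\<^sub>Q z)"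
  and tensor_scale_right: "w \<otimes>\<^sub>Q qscale c u = qscale c (w \<otimes>\<^sub>Q u)"
  by (auto intro!: poly_mapping_eqI simp: coeff_tensor lookup_add lookup_qscale algebra_simps)

lemma qlinear_tensor_left: "qlinear (\<lambda>x. x \<otimes>\<^sub>Q y)"
  and qlinear_tensor_right: "qlinear (\<lambda>v. u \<otimes>\<^sub>Q v)"
  by (simp_all add: qlinear_iff tensor_add_left tensor_add_right tensor_scale_left tensor_scale_right)

lemma tensor_single: "Poly_Mapping.single k q \<otimes>\<^sub>Q Poly_Mapping.single l r = Poly_Mapping.single (k, l) (q * r)"
proof (rule poly_mapping_eqI)
  fix p show "coeff (Poly_Mapping.single k q \<otimes>\<^sub>Q Poly_Mapping.single l r) p =
      coeff (Poly_Mapping.single (k, l) (q * r)) p"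
    by (cases p) (auto simp: coeff_tensor lookup_single when_def)
qed

lemma coeff_tensor_list:
  "coeff (tensor_list xs) ks = (if length ks = length xs then prod_list (map2 coeff xs ks) else 0)"
proof (induction xs arbitrary: ks)
  case Nil
  then show ?case by (auto simp: coeff_bvec)
next
  case (Cons x xs)
  have *: "coeff (tensor_list (x # xs)) ks = (\<Sum>k'\<in>supp x. \<Sum>l'\<in>supp (tensor_list xs).
      if k' # l' = ks then coeff x k' * coeff (tensor_list xs) l' else 0)"
    by (simp add: coeff_sum lookup_single when_def)
  show ?case
  proof (cases ks)
    case Nil
    then show ?thesis unfolding * by simp
  next
    case (Cons k l)
    have "coeff (tensor_list (x # xs)) ks = (\<Sum>k'\<in>supp x. if k' = k then
        \<Sum>l'\<in>supp (tensor_list xs). if l' = l then coeff x k' * coeff (tensor_list xs) l' else 0 else 0)"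
      unfolding * unfolding Cons by (intro sum.cong) auto
    also have "\<dots> = coeff x k * coeff (tensor_list xs) l"
      by (simp add: in_keys_iff)
    finally show ?thesis using Cons Cons.IH by simp
  qed
qed

lemma tensor_list_bvec: "tensor_list (map bvec ks) = bvec ks"
proof (rule poly_mapping_eqI)
  fix l
  have "length l = length ks \<Longrightarrow> prod_list (map2 coeff (map bvec ks) l) = (if ks = l then 1 else 0)"
    by (induction l ks rule: list_induct2) (auto simp: coeff_bvec)
  then show "coeff (tensor_list (map bvec ks)) l = coeff (bvec ks) l"
    by (auto simp: coeff_tensor_list coeff_bvec)
qed

lemma tensor_list_map2_qscale:
  assumes "length qs = length xs"
  shows "tensor_list (map2 qscale qs xs) = qscale (prod_list qs) (tensor_list xs)"
proof (rule poly_mapping_eqI)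
  fix l
  have "length l = length xs \<Longrightarrow> length qs = length xs \<Longrightarrow>
      prod_list (map2 coeff (map2 qscale qs xs) l) = prod_list qs * prod_list (map2 coeff xs l)"
    by (induction l xs arbitrary: qs rule: list_induct2)
      (auto simp: lookup_qscale length_Suc_conv)
  then show "coeff (tensor_list (map2 qscale qs xs)) l = coeff (qscale (prod_list qs) (tensor_list xs)) l"
    using assms by (simp add: coeff_tensor_list lookup_qscale)
qed

text \<open>Multilinearity, one slot at a time: the coefficient at \<open>l\<close> is the
  coefficient of \<open>x\<close> at one entry of \<open>l\<close> times a factor free of
  \<open>x\<close>.\<close>

lemma qlinear_tensor_list: "qlinear (\<lambda>x. tensor_list (xs @ x # ys))"
proof -
  have "prod_list (map2 coeff (xs @ x # ys) l) = coeff x (l ! length xs) *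
      (prod_list (map2 coeff xs (take (length xs) l)) * prod_list (map2 coeff ys (drop (Suc (length xs)) l)))"
    if "length l = Suc (length xs + length ys)" for x l
  proof -
    have "l = take (length xs) l @ l ! length xs # drop (Suc (length xs)) l"
      using that by (intro id_take_nth_drop) simp
    then have "map2 coeff (xs @ x # ys) l = map2 coeff (xs @ x # ys) (take (length xs) l @ l ! length xs # drop (Suc (length xs)) l)"
      by simp
    also have "\<dots> = map2 coeff xs (take (length xs) l) @ coeff x (l ! length xs) # map2 coeff ys (drop (Suc (length xs)) l)"
      using that by simp
    finally show ?thesis by (simp add: mult_ac)
  qed
  then show ?thesis
    by (auto intro!: qlinearI poly_mapping_eqI
        simp: coeff_tensor_list lookup_add lookup_qscale algebra_simps)
qed

section \<open>Shuffles and permutations\<close>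

lemma ex_sorting_permutation:
  fixes f :: "nat \<Rightarrow> nat"
  assumes "finite A" "inj_on f A"
  shows "\<exists>\<pi>. \<pi> permutes A \<and> strict_mono_on A (f \<circ> \<pi>)"
proof -
  have card: "card (f ` A) = card A" using assms by (simp add: card_image)
  obtain h where h: "bij_betw h {..<card A} A" "strict_mono_on {..<card A} h"
    using ex_bij_betw_strict_mono_card[OF assms(1)] by metis
  obtain g where g: "bij_betw g {..<card A} (f ` A)" "strict_mono_on {..<card A} g"
    using ex_bij_betw_strict_mono_card[of "f ` A"] assms(1) card by (metis finite_imageI)
  define \<pi> where "\<pi> x = (if x \<in> A then inv_into A f (g (inv_into {..<card A} h x)) else x)" for x
  have "bij_betw (inv_into {..<card A} h) A {..<card A}"
    using h by (simp add: bij_betw_inv_into)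
  moreover have "bij_betw (inv_into A f) (f ` A) A"
    using assms by (simp add: bij_betw_inv_into inj_on_imp_bij_betw)
  ultimately have "bij_betw (inv_into A f \<circ> (g \<circ> inv_into {..<card A} h)) A A"
    using g by (meson bij_betw_trans)
  then have "bij_betw \<pi> A A"
    by (rule bij_betw_cong[THEN iffD1, rotated]) (simp add: \<pi>_def)
  then have "\<pi> permutes A" by (rule bij_imp_permutes) (simp add: \<pi>_def)
  moreover have "strict_mono_on A (f \<circ> \<pi>)"
  proof (rule strict_mono_onI)
    fix x y assume xy: "x \<in> A" "y \<in> A" "x < y"
    obtain i j where ij: "i < card A" "x = h i" "j < card A" "y = h j"
      using bij_betw_imp_surj_on[OF h(1)] xy by (metis imageE lessThan_iff)
    have "i < j"
    proof (rule ccontr)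
      assume "\<not> i < j"
      then have "j = i \<or> j < i" by auto
      then show False using strict_mono_onD[OF h(2), of j i] ij xy by auto
    qed
    moreover have inj: "inj_on h {..<card A}" using h by (simp add: bij_betw_def)
    moreover have "g i \<in> f ` A" "g j \<in> f ` A" using g ij by (auto simp: bij_betw_def)
    ultimately show "(f \<circ> \<pi>) x < (f \<circ> \<pi>) y"
      using ij xy g(2) by (auto simp: \<pi>_def f_inv_into_f inv_into_f_f intro: strict_mono_onD)
  qed
  ultimately show ?thesis by blast
qed

text \<open>Two sorting permutations differ by a permutation \<tau> of \<open>A\<close> that is
  itself strictly increasing, and only the identity is.\<close>

lemma sorting_permutation_unique:
  fixes f :: "nat \<Rightarrow> nat"
  assumes "\<pi> permutes A" "strict_mono_on A (f \<circ> \<pi>)" "\<rho> permutes A" "strict_mono_on A (f \<circ> \<rho>)"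
  shows "\<pi> = \<rho>"
proof -
  define \<tau> where "\<tau> = inv \<pi> \<circ> \<rho>"
  have \<tau>: "\<tau> permutes A" unfolding \<tau>_def by (simp add: assms permutes_compose permutes_inv)
  have \<rho>: "\<pi> (\<tau> x) = \<rho> x" for x
    using assms by (simp add: \<tau>_def permutes_inverses)
  have mono: "\<tau> x < \<tau> y" if "x \<in> A" "y \<in> A" "x < y" for x y
  proof (rule ccontr)
    assume "\<not> \<tau> x < \<tau> y"
    moreover have in_A: "\<tau> x \<in> A" "\<tau> y \<in> A" using \<tau> that by (simp_all add: permutes_in_image)
    ultimately have "(f \<circ> \<pi>) (\<tau> y) \<le> (f \<circ> \<pi>) (\<tau> x)"
      using strict_mono_onD[OF assms(2), of "\<tau> y" "\<tau> x"] by (cases "\<tau> x = \<tau> y") auto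
    then show False using strict_mono_onD[OF assms(4) that] by (simp add: \<rho>)
  qed
  \<comment> \<open>If \<tau> x < x, monotonicity gives \<tau> (\<tau> x) < \<tau> x, against the
    induction hypothesis at \<tau> x.\<close>
  have "x \<le> \<tau> x" if "x \<in> A" for x
    using that
  proof (induction x rule: less_induct)
    case (less x)
    show ?case
    proof (rule ccontr)
      assume "\<not> x \<le> \<tau> x"
      moreover have "\<tau> x \<in> A" using \<tau> less by (simp add: permutes_in_image)
      ultimately show False using mono[of "\<tau> x" x] less by (meson not_le)
    qed
  qed
  then have "\<tau> = id" using permutes_natset_ge[OF \<tau>] by blast
  then show ?thesis using \<rho> by auto
qed

lemma downward_closed_eq_lessThan:
  fixes S :: "nat set"
  assumes "finite S" "\<And>x y. x \<in> S \<Longrightarrow> y < x \<Longrightarrow> y \<in> S"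
  shows "S = {..<card S}"
proof -
  have "{..<x} \<subseteq> S - {x}" if "x \<in> S" for x using assms that by auto
  then have "x < card S" if "x \<in> S" for x
    using card_mono[of "S - {x}" "{..<x}"] that assms(1) card_Suc_Diff1[of S x] by force
  then have "S \<subseteq> {..<card S}" by auto
  then show ?thesis by (simp add: card_subset_eq)
qed

section \<open>Shuffles as coset representatives for the permutations of two blocks\<close>

context steinberg
begin

text \<open>The factors of \<rho> are forced: inv \<sigma> = inv \<rho> \<circ> \<pi> \<circ> \<tau>
  has to increase on each block, so \<pi> is the unique permutation sorting inv \<rho> on the first
  block, \<tau> the one sorting it on the second, and \<sigma> is what remains.\<close>

lemma bij_betw_block_shuffle:
  "bij_betw (\<lambda>(\<pi> :: nat \<Rightarrow> nat, \<tau>, \<sigma>). \<pi> \<circ> \<tau> \<circ> \<sigma>)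
     ({\<pi>. \<pi> permutes {..<p}} \<times> {\<tau>. \<tau> permutes {p..<p + q}} \<times> shuffle_perms p q)
     {\<rho>. \<rho> permutes {..<p + q}}"
proof -
  have ext: "\<pi> permutes {..<p + q}" "\<tau> permutes {..<p + q}"
    if "\<pi> permutes {..<p}" "\<tau> permutes {p..<p + q}" for \<pi> \<tau> :: "nat \<Rightarrow> nat"
    using that by (auto elim!: permutes_subset)
  have inv_simps: "inv (\<pi> \<circ> \<tau> \<circ> \<sigma>) \<circ> \<pi> \<circ> \<tau> = inv \<sigma>"
    if "\<pi> permutes {..<p + q}" "\<tau> permutes {..<p + q}" "\<sigma> permutes {..<p + q}" for \<pi> \<tau> \<sigma> :: "nat \<Rightarrow> nat"
    using that by (simp add: o_inv_distrib permutes_bij bij_comp o_assoc[symmetric]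
        fun_eq_iff permutes_inverses)
  \<comment> \<open>\<tau> is the identity on the first block and \<pi> on the second, so each block
    is sorted by its own permutation only.\<close>
  have mono: "strict_mono_on {..<p} (inv \<rho> \<circ> \<pi>) \<longleftrightarrow> strict_mono_on {..<p} (inv \<rho> \<circ> \<pi> \<circ> \<tau>)"
    "strict_mono_on {p..<p + q} (inv \<rho> \<circ> \<tau>) \<longleftrightarrow> strict_mono_on {p..<p + q} (inv \<rho> \<circ> \<pi> \<circ> \<tau>)"
    if "\<pi> permutes {..<p}" "\<tau> permutes {p..<p + q}" for \<pi> \<tau> \<rho> :: "nat \<Rightarrow> nat"
  proof -
    have "\<tau> x = x" if "x < p" for x
      using \<open>\<tau> permutes _\<close> that by (auto intro: permutes_not_in)
    moreover have "\<pi> (\<tau> x) = \<tau> x" if "p \<le> x" "x < p + q" for x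
    proof -
      have "\<tau> x \<in> {p..<p + q}" using \<open>\<tau> permutes _\<close> that by (simp add: permutes_in_image del: atLeastLessThan_iff) simp
      then show ?thesis using \<open>\<pi> permutes _\<close> by (auto intro: permutes_not_in)
    qed
    ultimately show "strict_mono_on {..<p} (inv \<rho> \<circ> \<pi>) \<longleftrightarrow> strict_mono_on {..<p} (inv \<rho> \<circ> \<pi> \<circ> \<tau>)"
      "strict_mono_on {p..<p + q} (inv \<rho> \<circ> \<tau>) \<longleftrightarrow> strict_mono_on {p..<p + q} (inv \<rho> \<circ> \<pi> \<circ> \<tau>)"
      by (auto simp: strict_mono_on_def)
  qed
  show ?thesis
  proof (rule bij_betw_imageI)
    show "inj_on (\<lambda>(\<pi>, \<tau>, \<sigma>). \<pi> \<circ> \<tau> \<circ> \<sigma>)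
        ({\<pi>. \<pi> permutes {..<p}} \<times> {\<tau>. \<tau> permutes {p..<p + q}} \<times> shuffle_perms p q)"
    proof -
      have *: "\<pi> = \<pi>' \<and> \<tau> = \<tau>' \<and> \<sigma> = \<sigma>'"
      if 1: "\<pi> permutes {..<p}" "\<tau> permutes {p..<p + q}" "\<sigma> \<in> shuffle_perms p q"
        and 2: "\<pi>' permutes {..<p}" "\<tau>' permutes {p..<p + q}" "\<sigma>' \<in> shuffle_perms p q"
        and eq: "\<pi> \<circ> \<tau> \<circ> \<sigma> = \<pi>' \<circ> \<tau>' \<circ> \<sigma>'"
      for \<pi> \<tau> \<sigma> \<pi>' \<tau>' \<sigma>' :: "nat \<Rightarrow> nat"
      proof -
      define \<rho> where "\<rho> = \<pi> \<circ> \<tau> \<circ> \<sigma>"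
      have s: "inv \<sigma> = inv \<rho> \<circ> \<pi> \<circ> \<tau>" "inv \<sigma>' = inv \<rho> \<circ> \<pi>' \<circ> \<tau>'"
        using inv_simps[of \<pi> \<tau> \<sigma>] inv_simps[of \<pi>' \<tau>' \<sigma>'] 1 2 ext
        unfolding \<rho>_def eq[symmetric] by (auto simp: shuffle_perms_def)
      have "\<pi> = \<pi>'" "\<tau> = \<tau>'"
        using 1 2 mono[of \<pi> \<tau> \<rho>] mono[of \<pi>' \<tau>' \<rho>]
        unfolding shuffle_perms_def mem_Collect_eq s
        by (metis sorting_permutation_unique)+
      moreover from this have "inv \<sigma> = inv \<sigma>'" using s by simp
      then have "\<sigma> = \<sigma>'" using 1 2 by (auto simp: shuffle_perms_def) (metis permutes_inv_inv)
      ultimately show ?thesis by simp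
      qed
      show ?thesis
      proof (rule inj_onI)
        fix x y :: "(nat \<Rightarrow> nat) \<times> (nat \<Rightarrow> nat) \<times> (nat \<Rightarrow> nat)"
        obtain \<pi> \<tau> \<sigma> \<pi>' \<tau>' \<sigma>' where xy: "x = (\<pi>, \<tau>, \<sigma>)" "y = (\<pi>', \<tau>', \<sigma>')"
          by (cases x, cases y)
        assume "x \<in> {\<pi>. \<pi> permutes {..<p}} \<times> {\<tau>. \<tau> permutes {p..<p + q}} \<times> shuffle_perms p q"
          "y \<in> {\<pi>. \<pi> permutes {..<p}} \<times> {\<tau>. \<tau> permutes {p..<p + q}} \<times> shuffle_perms p q"
          "(case x of (\<pi>, \<tau>, \<sigma>) \<Rightarrow> \<pi> \<circ> \<tau> \<circ> \<sigma>) = (case y of (\<pi>, \<tau>, \<sigma>) \<Rightarrow> \<pi> \<circ> \<tau> \<circ> \<sigma>)"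
        then show "x = y"
          unfolding xy mem_Times_iff fst_conv snd_conv mem_Collect_eq prod.case prod.inject
          by (elim conjE) (rule *)
      qed
    qed
    show "(\<lambda>(\<pi>, \<tau>, \<sigma>). \<pi> \<circ> \<tau> \<circ> \<sigma>) `
        ({\<pi>. \<pi> permutes {..<p}} \<times> {\<tau>. \<tau> permutes {p..<p + q}} \<times> shuffle_perms p q) =
        {\<rho>. \<rho> permutes {..<p + q}}" (is "?f ` ?A = ?B")
    proof
      show "?f ` ?A \<subseteq> ?B"
        using ext by (auto simp: shuffle_perms_def intro!: permutes_compose)
      show "?B \<subseteq> ?f ` ?A"
      proof
        fix \<rho> assume "\<rho> \<in> ?B"
        then have \<rho>: "\<rho> permutes {..<p + q}" by simp
        have inj: "inj_on (inv \<rho>) A" for A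
          using permutes_inj[OF permutes_inv[OF \<rho>]] by (rule inj_on_subset) simp
        obtain \<pi> where \<pi>: "\<pi> permutes {..<p}" "strict_mono_on {..<p} (inv \<rho> \<circ> \<pi>)"
          using ex_sorting_permutation[OF _ inj] by blast
        obtain \<tau> where \<tau>: "\<tau> permutes {p..<p + q}" "strict_mono_on {p..<p + q} (inv \<rho> \<circ> \<tau>)"
          using ex_sorting_permutation[OF _ inj] by blast
        define \<sigma> where "\<sigma> = inv (\<pi> \<circ> \<tau>) \<circ> \<rho>"
        have pt: "\<pi> \<circ> \<tau> permutes {..<p + q}" using ext[OF \<pi>(1) \<tau>(1)] by (simp add: permutes_compose)
        have \<sigma>: "\<sigma> permutes {..<p + q}" unfolding \<sigma>_def using pt \<rho> by (simp add: permutes_compose permutes_inv)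
        have "inv \<sigma> = inv \<rho> \<circ> \<pi> \<circ> \<tau>"
          unfolding \<sigma>_def using pt \<rho> permutes_bij permutes_inv
          by (metis comp_assoc o_inv_distrib permutes_inv_inv)
        then have "\<sigma> \<in> shuffle_perms p q"
          using \<sigma> \<pi> \<tau> mono[of \<pi> \<tau> \<rho>] by (simp add: shuffle_perms_def)
        moreover have "\<pi> \<circ> \<tau> \<circ> \<sigma> = \<rho>"
          unfolding \<sigma>_def using pt by (simp only: o_assoc permutes_inv_o(1) id_comp)
        ultimately show "\<rho> \<in> ?f ` ?A" using \<pi> \<tau> by (force intro!: image_eqI[of _ _ "(\<pi>, \<tau>, \<sigma>)"])
      qed
    qed
  qed
qed

text \<open>Since inv \<sigma> increases on the first block, an entry of that block placed before
  position \<open>k\<close> has all smaller entries of the block before it: the entries used so far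
  form an initial segment.\<close>

lemma shuffle_image_left:
  assumes "\<sigma> \<in> shuffle_perms p q" "k \<le> p + q"
  shows "\<sigma> ` {t. t < k \<and> \<sigma> t < p} = {..<card {t. t < k \<and> \<sigma> t < p}}"
proof -
  have \<sigma>: "\<sigma> permutes {..<p + q}" "strict_mono_on {..<p} (inv \<sigma>)"
    using assms by (auto simp: shuffle_perms_def)
  have "card (\<sigma> ` {t. t < k \<and> \<sigma> t < p}) = card {t. t < k \<and> \<sigma> t < p}"
    by (intro card_image inj_on_subset[OF permutes_inj[OF \<sigma>(1)]]) simp
  moreover have "\<sigma> ` {t. t < k \<and> \<sigma> t < p} = {..<card (\<sigma> ` {t. t < k \<and> \<sigma> t < p})}"
  proof (rule downward_closed_eq_lessThan)
    fix x y assume "x \<in> \<sigma> ` {t. t < k \<and> \<sigma> t < p}" "y < x"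
    then obtain t where t: "x = \<sigma> t" "t < k" "\<sigma> t < p" "y < \<sigma> t" by auto
    then have "inv \<sigma> y < inv \<sigma> (\<sigma> t)" using strict_mono_onD[OF \<sigma>(2)] by simp
    then have "inv \<sigma> y < k" using t \<sigma>(1) by (simp add: permutes_inverses)
    then show "y \<in> \<sigma> ` {t. t < k \<and> \<sigma> t < p}"
      using t \<sigma>(1) by (intro image_eqI[of _ _ "inv \<sigma> y"]) (auto simp: permutes_inverses)
  qed auto
  ultimately show ?thesis by simp
qed

lemma shuffle_image_right:
  assumes "\<sigma> \<in> shuffle_perms p q" "k \<le> p + q"
  shows "(\<lambda>t. \<sigma> t - p) ` {t. t < k \<and> \<not> \<sigma> t < p} = {..<card {t. t < k \<and> \<not> \<sigma> t < p}}"
proof -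
  have \<sigma>: "\<sigma> permutes {..<p + q}" "strict_mono_on {p..<p + q} (inv \<sigma>)"
    using assms by (auto simp: shuffle_perms_def)
  have "card ((\<lambda>t. \<sigma> t - p) ` {t. t < k \<and> \<not> \<sigma> t < p}) = card {t. t < k \<and> \<not> \<sigma> t < p}"
  proof (intro card_image inj_onI)
    fix x y assume "x \<in> {t. t < k \<and> \<not> \<sigma> t < p}" "y \<in> {t. t < k \<and> \<not> \<sigma> t < p}" "\<sigma> x - p = \<sigma> y - p"
    then have "\<sigma> x = \<sigma> y" by (simp add: not_less eq_diff_iff)
    then show "x = y" using permutes_inj[OF \<sigma>(1)] by (simp add: inj_eq)
  qed
  moreover have "(\<lambda>t. \<sigma> t - p) ` {t. t < k \<and> \<not> \<sigma> t < p} = {..<card ((\<lambda>t. \<sigma> t - p) ` {t. t < k \<and> \<not> \<sigma> t < p})}"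
  proof (rule downward_closed_eq_lessThan)
    fix x y assume "x \<in> (\<lambda>t. \<sigma> t - p) ` {t. t < k \<and> \<not> \<sigma> t < p}" "y < x"
    then obtain t where t: "x = \<sigma> t - p" "t < k" "\<not> \<sigma> t < p" "y < \<sigma> t - p" by auto
    have "t \<in> {..<p + q}" using t assms(2) by simp
    then have "\<sigma> t < p + q" using permutes_in_image[OF \<sigma>(1)] by blast
    then have "inv \<sigma> (p + y) < inv \<sigma> (\<sigma> t)" using strict_mono_onD[OF \<sigma>(2), of "p + y" "\<sigma> t"] t by simp
    then have "inv \<sigma> (p + y) < k" using t \<sigma>(1) by (simp add: permutes_inverses)
    then show "y \<in> (\<lambda>t. \<sigma> t - p) ` {t. t < k \<and> \<not> \<sigma> t < p}"
      using t \<sigma>(1) by (intro image_eqI[of _ _ "inv \<sigma> (p + y)"]) (auto simp: permutes_inverses)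
  qed auto
  ultimately show ?thesis by simp
qed

text \<open>Up to any position a shuffle has consumed an initial segment of each list. Hence the
  flag of a shuffled basis can be computed from the two flags alone, which is what makes
  \<open>flag_shuffle\<close> possible.\<close>

lemma set_take_shuffle:
  assumes "\<sigma> \<in> shuffle_perms (length xs) (length ys)" "k \<le> length xs + length ys"
  shows "set (take k (permute_list \<sigma> (xs @ ys))) =
    set (take (card {t. t < k \<and> \<sigma> t < length xs}) xs) \<union>
    set (take (card {t. t < k \<and> \<not> \<sigma> t < length xs}) ys)"
proof -
  let ?A = "{t. t < k \<and> \<sigma> t < length xs}" and ?B = "{t. t < k \<and> \<not> \<sigma> t < length xs}"
  have \<sigma>: "\<sigma> permutes {..<length (xs @ ys)}"
    using assms by (simp add: shuffle_perms_def)
  have "card ?B \<le> length ys"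
  proof -
    have "{..<card ?B} \<subseteq> {..<length ys}"
      unfolding shuffle_image_right[OF assms, symmetric]
    proof (rule image_subsetI)
      fix t assume t: "t \<in> ?B"
      then have "\<sigma> t \<in> {..<length (xs @ ys)}" using permutes_in_image[OF \<sigma>, of t] assms(2) by simp
      then show "\<sigma> t - length xs \<in> {..<length ys}" using t by auto
    qed
    then show ?thesis by simp
  qed
  moreover have "card ?A \<le> length xs"
  proof -
    have "{..<card ?A} \<subseteq> {..<length xs}"
      unfolding shuffle_image_left[OF assms, symmetric] by auto
    then show ?thesis by simp
  qed
  moreover have "set (take k (permute_list \<sigma> (xs @ ys))) = (\<lambda>t. (xs @ ys) ! \<sigma> t) ` {..<k}"
  proof -
    have "set (take k (permute_list \<sigma> (xs @ ys))) = (!) (permute_list \<sigma> (xs @ ys)) ` {0..<k}"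
      using assms by (simp add: nth_image)
    also have "\<dots> = (\<lambda>t. (xs @ ys) ! \<sigma> t) ` {..<k}"
      using assms permute_list_nth[OF \<sigma>] by (intro image_cong) auto
    finally show ?thesis .
  qed
  moreover have "{..<k} = ?A \<union> ?B" by auto
  moreover have "(\<lambda>t. (xs @ ys) ! \<sigma> t) ` ?A = (!) xs ` (\<sigma> ` ?A)"
    unfolding image_image by (intro image_cong) (auto simp: nth_append)
  moreover have "(\<lambda>t. (xs @ ys) ! \<sigma> t) ` ?B = (!) ys ` ((\<lambda>t. \<sigma> t - length xs) ` ?B)"
    unfolding image_image by (intro image_cong) (auto simp: nth_append)
  ultimately show ?thesis
    unfolding shuffle_image_left[OF assms] shuffle_image_right[OF assms]
    by (simp add: image_Un nth_image lessThan_atLeast0 del: Collect_conj_eq)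
qed

end

section \<open>Permuting the two blocks of a juxtaposition\<close>

lemma bij_betw_map_permutation_shift:
  fixes p q :: nat
  shows   "bij_betw (map_permutation {..<q} ((+) p)) {\<tau>. \<tau> permutes {..<q}} {\<tau>. \<tau> permutes {p..<p + q}}"
proof -
  have b: "bij_betw ((+) p) {..<q} {p..<p + q}"
    by (rule bij_betw_byWitness[where f' = "\<lambda>i. i - p"]) auto
  have b': "bij_betw (\<lambda>i. i - p) {p..<p + q} {..<q}"
    by (rule bij_betw_byWitness[where f' = "(+) p"]) auto
  show ?thesis
  proof (rule bij_betw_byWitness[where f' = "map_permutation {p..<p + q} (\<lambda>i. i - p)"])
    show "\<forall>\<tau>\<in>{\<tau>. \<tau> permutes {..<q}}. map_permutation {p..<p + q} (\<lambda>i. i - p) (map_permutation {..<q} ((+) p) \<tau>) = \<tau>"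
      using map_permutation_compose_inv[OF b] by auto
    show "\<forall>\<tau>\<in>{\<tau>. \<tau> permutes {p..<p + q}}. map_permutation {..<q} ((+) p) (map_permutation {p..<p + q} (\<lambda>i. i - p) \<tau>) = \<tau>"
      using map_permutation_compose_inv[OF b'] by auto
  qed (use map_permutation_permutes[OF b] map_permutation_permutes[OF b'] in auto)
qed

lemma permute_list_append_blocks:
  assumes "\<pi> permutes {..<length xs}" "\<tau> permutes {..<length ys}"
  shows "permute_list \<pi> xs @ permute_list \<tau> ys =
    permute_list (\<pi> \<circ> map_permutation {..<length ys} ((+) (length xs)) \<tau>) (xs @ ys)"
proof -
  let ?p = "length xs" and ?q = "length ys"
  let ?t = "map_permutation {..<?q} ((+) ?p) \<tau>"
  have t: "?t permutes {?p..<?p + ?q}"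
    using bij_betw_map_permutation_shift[of ?q ?p] assms by (auto simp: bij_betw_def)
  have perm: "\<pi> \<circ> ?t permutes {..<length (xs @ ys)}"
    using t assms by (auto intro!: permutes_compose elim!: permutes_subset)
  show ?thesis
  proof (rule nth_equalityI)
    fix i assume i: "i < length (permute_list \<pi> xs @ permute_list \<tau> ys)"
    show "(permute_list \<pi> xs @ permute_list \<tau> ys) ! i = permute_list (\<pi> \<circ> ?t) (xs @ ys) ! i"
    proof (cases "i < ?p")
      case True
      then have "?t i = i" using permutes_not_in[OF t] by simp
      moreover have "\<pi> i < ?p" using permutes_in_image[OF assms(1), of i] True by simp
      ultimately show ?thesis using True i assms perm
        by (simp add: nth_append permute_list_nth)
    next
      case False
      then have j: "i - ?p < ?q" using i by auto
      then have "?t (?p + (i - ?p)) = ?p + \<tau> (i - ?p)"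
        by (intro map_permutation_apply) auto
      then have "?t i = ?p + \<tau> (i - ?p)" using False by simp
      moreover have "\<pi> (?p + \<tau> (i - ?p)) = ?p + \<tau> (i - ?p)"
        using assms(1) by (intro permutes_not_in) auto
      ultimately show ?thesis using False i j assms perm
        by (simp add: nth_append permute_list_nth)
    qed
  qed simp
qed

context steinberg
begin

section \<open>Apartments and the shuffle of flags\<close>

lemma length_flag_of [simp]: "length (flag_of vs) = Suc (length vs)"
  by (simp add: flag_of_def)

lemma flag_of_nth: "i \<le> length vs \<Longrightarrow> flag_of vs ! i = span (set (take i vs))"
  by (simp add: flag_of_def del: upt_Suc)

lemma flag_of_eq_iff:
  assumes "length vs = length ws"
  shows "flag_of vs = flag_of ws \<longleftrightarrow> (\<forall>i\<le>length vs. span (set (take i vs)) = span (set (take i ws)))"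
  using assms by (auto simp: list_eq_iff_nth_eq flag_of_nth less_Suc_eq_le)

lemma flag_of_Nil [simp]: "flag_of [] = [{0}]"
  by (simp add: flag_of_def)

lemma flag_of_singleton: "flag_of [v] = [{0}, span {v}]"
  by (simp add: flag_of_def)

lemma flag_of_lines:
  assumes "map (\<lambda>v. span {v}) vs = map (\<lambda>v. span {v}) ws"
  shows "flag_of vs = flag_of ws"
proof -
  have len: "length vs = length ws" using assms map_eq_imp_length_eq by blast
  have sub: "span (set (take i xs)) \<subseteq> span (set (take i ys))"
    if "map (\<lambda>v. span {v}) xs = map (\<lambda>v. span {v}) ys" "length xs = length ys" for i xs ys
  proof (rule span_minimal)
    show "set (take i xs) \<subseteq> span (set (take i ys))"
    proof
      fix x assume "x \<in> set (take i xs)"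
      then obtain k where k: "k < i" "k < length xs" "x = xs ! k"
        by (auto simp: in_set_conv_nth)
      have "span {xs ! k} = span {ys ! k}"
        using that k by (metis nth_map)
      moreover have "ys ! k \<in> set (take i ys)"
        using k that by (auto simp: in_set_conv_nth)
      ultimately show "x \<in> span (set (take i ys))"
        using k span_mono[of "{ys ! k}" "set (take i ys)"] span_base[of x "{x}"] by auto
    qed
  qed simp
  show ?thesis
    unfolding flag_of_eq_iff[OF len] using sub assms len by (metis subset_antisym)
qed

lemma apartment_alt:
  "apartment vs = (\<Sum>\<sigma> | \<sigma> permutes {..<length vs}.
     qscale (of_int (sign \<sigma>)) (bvec (flag_of (permute_list \<sigma> vs))))"
  by (simp add: apartment_def qscale_single)

lemma apartment_Nil: "apartment [] = bvec [{0}]"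
  by (simp add: apartment_alt)

lemma apartment_singleton: "apartment [v] = bvec [{0}, span {v}]"
proof -
  have "{\<sigma>. \<sigma> permutes {..<length [v]}} = {id :: nat \<Rightarrow> nat}"
    using permutes_sing by (auto simp: lessThan_Suc)
  then show ?thesis by (simp add: apartment_alt flag_of_singleton)
qed

lemma apartment_lines:
  assumes "map (\<lambda>v. span {v}) vs = map (\<lambda>v. span {v}) ws"
  shows "apartment vs = apartment ws"
proof -
  have len: "length vs = length ws" using assms map_eq_imp_length_eq by blast
  show ?thesis
    unfolding apartment_alt len
  proof (intro sum.cong refl)
    fix \<sigma> assume \<sigma>: "\<sigma> \<in> {\<sigma>. \<sigma> permutes {..<length ws}}"
    have "flag_of (permute_list \<sigma> vs) = flag_of (permute_list \<sigma> ws)"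
      using \<sigma> len assms by (intro flag_of_lines) (simp flip: permute_list_map)
    then show "qscale (of_int (sign \<sigma>)) (bvec (flag_of (permute_list \<sigma> vs))) =
        qscale (of_int (sign \<sigma>)) (bvec (flag_of (permute_list \<sigma> ws)))" by simp
  qed
qed

text \<open>The sum is reindexed by \<pi> \<circ> \<sigma>; sign \<sigma> is sign \<pi> times the
  sign of \<pi> \<circ> \<sigma>, because sign \<pi> squares to 1.\<close>

lemma apartment_permute:
  assumes "\<pi> permutes {..<length vs}"
  shows "apartment (permute_list \<pi> vs) = qscale (of_int (sign \<pi>)) (apartment vs)"
proof -
  let ?S = "{\<sigma>. \<sigma> permutes {..<length vs}}"
  have perm: "permutation \<sigma>" if "\<sigma> permutes {..<length vs}" for \<sigma>
    using that permutation_permutes by blast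
  have "apartment (permute_list \<pi> vs) =
      (\<Sum>\<sigma>\<in>?S. qscale (of_int (sign \<sigma>)) (bvec (flag_of (permute_list (\<pi> \<circ> \<sigma>) vs))))"
    unfolding apartment_alt using assms by (simp add: permute_list_compose)
  also have "\<dots> = (\<Sum>\<sigma>\<in>?S. qscale (of_int (sign \<pi>)) (qscale (of_int (sign (\<pi> \<circ> \<sigma>)))
      (bvec (flag_of (permute_list (\<pi> \<circ> \<sigma>) vs)))))"
    using assms perm by (intro sum.cong refl) (simp add: sign_compose flip: of_int_mult mult.assoc)
  also have "\<dots> = (\<Sum>\<sigma>\<in>?S. qscale (of_int (sign \<pi>)) (qscale (of_int (sign \<sigma>))
      (bvec (flag_of (permute_list \<sigma> vs)))))"
    using assms
    by (intro sum.reindex_bij_witness[of _ "\<lambda>\<sigma>. inv \<pi> \<circ> \<sigma>" "\<lambda>\<sigma>. \<pi> \<circ> \<sigma>"])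
      (auto simp: permutes_compose permutes_inv o_assoc permutes_inv_o)
  finally show ?thesis by (simp add: apartment_alt rat_space.scale_sum_right)
qed

text \<open>The flag of \<open>permute_list \<sigma> (vs @ ws)\<close>, read off from those of \<open>vs\<close> and \<open>ws\<close>.\<close>

definition flag_shuffle :: "(nat \<Rightarrow> nat) \<Rightarrow> 'v flag \<Rightarrow> 'v flag \<Rightarrow> 'v flag" where
  "flag_shuffle \<sigma> F G = map (\<lambda>k.
     span (F ! card {t. t < k \<and> \<sigma> t < length F - 1} \<union> G ! card {t. t < k \<and> \<not> \<sigma> t < length F - 1}))
     [0..<length F + length G - 1]"

text \<open>The Eilenberg--Zilber shuffle: a pair of flags goes to the signed sum of the staircase
  flags with members W + W', where W and W' run monotonically through the two flags. It lives on all
  pairs of flags, not only on cycles. The \<open>- 1\<close> turns the length of a complete flag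
  into the dimension.\<close>

definition shuffle_mult :: "'v chain2 \<Rightarrow> 'v chain" where
  "shuffle_mult = lin_ext (\<lambda>(F, G). \<Sum>\<sigma>\<in>shuffle_perms (length F - 1) (length G - 1).
     qscale (of_int (sign \<sigma>)) (bvec (flag_shuffle \<sigma> F G)))"

lemma qlinear_shuffle_mult: "qlinear shuffle_mult"
  unfolding shuffle_mult_def by (rule qlinear_lin_ext)

lemma flag_of_shuffle:
  assumes "\<sigma> \<in> shuffle_perms (length vs) (length ws)"
  shows "flag_of (permute_list \<sigma> (vs @ ws)) = flag_shuffle \<sigma> (flag_of vs) (flag_of ws)"
proof (rule nth_equalityI)
  fix k assume "k < length (flag_of (permute_list \<sigma> (vs @ ws)))"
  then have k: "k \<le> length vs + length ws" by simp
  let ?a = "card {t. t < k \<and> \<sigma> t < length vs}" and ?b = "card {t. t < k \<and> \<not> \<sigma> t < length vs}"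
  have \<sigma>: "\<sigma> permutes {..<length vs + length ws}" using assms by (simp add: shuffle_perms_def)
  have a: "?a \<le> length vs"
  proof -
    have "{..<?a} \<subseteq> {..<length vs}"
      unfolding shuffle_image_left[OF assms k, symmetric] by auto
    then show ?thesis by simp
  qed
  have b: "?b \<le> length ws"
  proof -
    have "{..<?b} \<subseteq> {..<length ws}"
      unfolding shuffle_image_right[OF assms k, symmetric]
    proof (rule image_subsetI)
      fix t assume t: "t \<in> {t. t < k \<and> \<not> \<sigma> t < length vs}"
      then have "\<sigma> t \<in> {..<length vs + length ws}" using permutes_in_image[OF \<sigma>, of t] k by simp
      then show "\<sigma> t - length vs \<in> {..<length ws}" using t by auto
    qed
    then show ?thesis by simp
  qed
  have "span (span X \<union> span Y) = span (X \<union> Y)" for X Y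
    by (rule subset_antisym[OF span_minimal span_mono])
      (auto intro: span_base span_mono[THEN subsetD])
  then show "flag_of (permute_list \<sigma> (vs @ ws)) ! k = flag_shuffle \<sigma> (flag_of vs) (flag_of ws) ! k"
    using k a b by (simp add: flag_of_nth flag_shuffle_def set_take_shuffle[OF assms k] del: upt_Suc)
qed (simp add: flag_shuffle_def)

lemma shuffle_mult_flags:
  "shuffle_mult (bvec (flag_of vs) \<otimes>\<^sub>Q bvec (flag_of ws)) =
    (\<Sum>\<sigma>\<in>shuffle_perms (length vs) (length ws).
      qscale (of_int (sign \<sigma>)) (bvec (flag_of (permute_list \<sigma> (vs @ ws)))))"
  by (simp add: shuffle_mult_def tensor_single flag_of_shuffle)

theorem shuffle_mult_apartment:
  "shuffle_mult (apartment vs \<otimes>\<^sub>Q apartment ws) = apartment (vs @ ws)"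
proof -
  let ?p = "length vs" and ?q = "length ws"
  let ?sg = "\<lambda>\<pi> :: nat \<Rightarrow> nat. rat_of_int (sign \<pi>)"
  let ?P = "{\<pi>. \<pi> permutes {..<?p}}" and ?Q = "{\<tau>. \<tau> permutes {..<?q}}"
    and ?Q' = "{\<tau>. \<tau> permutes {?p..<?p + ?q}}"
  let ?sh = "map_permutation {..<?q} ((+) ?p)"
  define G where "G \<rho> = qscale (?sg \<rho>) (bvec (flag_of (permute_list \<rho> (vs @ ws))))" for \<rho>
  have summand: "qscale (?sg \<pi>) (qscale (?sg \<tau>) (shuffle_mult (bvec (flag_of (permute_list \<pi> vs)) \<otimes>\<^sub>Q
        bvec (flag_of (permute_list \<tau> ws))))) = (\<Sum>\<sigma>\<in>shuffle_perms ?p ?q. G (\<pi> \<circ> ?sh \<tau> \<circ> \<sigma>))"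
    if "\<pi> \<in> ?P" "\<tau> \<in> ?Q" for \<pi> \<tau>
  proof -
    have sh: "?sh \<tau> permutes {?p..<?p + ?q}"
      using bij_betw_map_permutation_shift[of ?q ?p] that by (auto simp: bij_betw_def)
    have perm: "\<pi> permutes {..<?p + ?q}" "?sh \<tau> permutes {..<?p + ?q}"
      using that sh by (auto elim!: permutes_subset)
    have permutation: "permutation \<rho>" if "\<rho> permutes {..<?p + ?q}" for \<rho>
      using that permutation_permutes by blast
    have sign: "sign (?sh \<tau>) = sign \<tau>"
      using that by (intro sign_map_permutation) auto
    have "G (\<pi> \<circ> ?sh \<tau> \<circ> \<sigma>) = qscale (?sg \<pi>) (qscale (?sg \<tau>) (qscale (?sg \<sigma>)
        (bvec (flag_of (permute_list \<sigma> (permute_list \<pi> vs @ permute_list \<tau> ws))))))"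
      if "\<sigma> \<in> shuffle_perms ?p ?q" for \<sigma>
    proof -
      have \<sigma>: "\<sigma> permutes {..<?p + ?q}" using that by (simp add: shuffle_perms_def)
      have "sign (\<pi> \<circ> ?sh \<tau> \<circ> \<sigma>) = sign \<pi> * sign \<tau> * sign \<sigma>"
        using perm \<sigma> permutation by (simp add: sign_compose sign permutes_compose)
      moreover have "permute_list (\<pi> \<circ> ?sh \<tau> \<circ> \<sigma>) (vs @ ws) =
          permute_list \<sigma> (permute_list \<pi> vs @ permute_list \<tau> ws)"
        using \<sigma> \<open>\<pi> \<in> ?P\<close> \<open>\<tau> \<in> ?Q\<close>
        by (subst permute_list_compose) (simp_all add: permute_list_append_blocks)
      ultimately show ?thesis by (simp add: G_def mult.assoc)
    qed
    then show ?thesis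
      using that by (simp add: shuffle_mult_flags rat_space.scale_sum_right)
  qed
  have "shuffle_mult (apartment vs \<otimes>\<^sub>Q apartment ws) = (\<Sum>\<pi>\<in>?P. \<Sum>\<tau>\<in>?Q. qscale (?sg \<pi>) (qscale (?sg \<tau>)
      (shuffle_mult (bvec (flag_of (permute_list \<pi> vs)) \<otimes>\<^sub>Q bvec (flag_of (permute_list \<tau> ws))))))"
    unfolding apartment_alt
    by (simp only: qlin_simps[OF qlinear_shuffle_mult] qlin_simps[OF qlinear_tensor_left]
        qlin_simps[OF qlinear_tensor_right] rat_space.scale_sum_right)
      (subst sum.swap, simp add: mult.commute)
  also have "\<dots> = (\<Sum>\<pi>\<in>?P. \<Sum>\<tau>\<in>?Q. \<Sum>\<sigma>\<in>shuffle_perms ?p ?q. G (\<pi> \<circ> ?sh \<tau> \<circ> \<sigma>))"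
    using summand by (intro sum.cong refl) simp
  also have "\<dots> = (\<Sum>\<pi>\<in>?P. \<Sum>\<tau>\<in>?Q'. \<Sum>\<sigma>\<in>shuffle_perms ?p ?q. G (\<pi> \<circ> \<tau> \<circ> \<sigma>))"
    by (intro sum.cong refl sum.reindex_bij_betw[OF bij_betw_map_permutation_shift])
  also have "\<dots> = (\<Sum>(\<pi>, \<tau>, \<sigma>)\<in>?P \<times> ?Q' \<times> shuffle_perms ?p ?q. G (\<pi> \<circ> \<tau> \<circ> \<sigma>))"
    by (simp add: sum.cartesian_product)
  also have "\<dots> = (\<Sum>\<rho> | \<rho> permutes {..<?p + ?q}. G \<rho>)"
    using sum.reindex_bij_betw[OF bij_betw_block_shuffle, of G ?p ?q] by (simp add: case_prod_unfold)
  also have "\<dots> = apartment (vs @ ws)"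
    by (simp add: G_def apartment_alt)
  finally show ?thesis .
qed

text \<open>\<open>shuffle_mult\<close> witnesses the choice. The chosen map is thereby pinned down
  on tensors of apartments, hence on their span.\<close>

lemma St_mult_spec:
  "qlinear (St_mult V1 V2) \<and> (\<forall>vs ws. ordered_basis V1 vs \<and> ordered_basis V2 ws \<longrightarrow>
     St_mult V1 V2 (apartment vs \<otimes>\<^sub>Q apartment ws) = apartment (vs @ ws))"
  unfolding St_mult_def
  by (rule someI[of _ shuffle_mult]) (use qlinear_shuffle_mult shuffle_mult_apartment in blast)

lemmas qlinear_St_mult = St_mult_spec[THEN conjunct1]

lemma St_mult_apartment:
  "ordered_basis V1 vs \<Longrightarrow> ordered_basis V2 ws \<Longrightarrow>
    St_mult V1 V2 (apartment vs \<otimes>\<^sub>Q apartment ws) = apartment (vs @ ws)"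
  using St_mult_spec by blast

lemma apartment_pair: "apartment [v, w] = bvec [{0}, span {v}, span {v, w}] - bvec [{0}, span {w}, span {v, w}]"
proof -
  have "{\<sigma>. \<sigma> permutes {..<length [v, w]}} = {\<sigma>. \<sigma> permutes {0, Suc 0}}"
    by (simp add: numeral_2_eq_2 lessThan_Suc insert_commute)
  also have "\<dots> = {id, Transposition.transpose 0 (Suc 0)}"
    by (auto simp: permutes_doubleton_iff permutes_id permutes_swap_id)
  finally have S: "{\<sigma>. \<sigma> permutes {..<length [v, w]}} = {id, Transposition.transpose 0 (Suc 0)}" .
  have "(id :: nat \<Rightarrow> nat) \<noteq> Transposition.transpose 0 (Suc 0)"
    by (metis id_apply transpose_apply_first nat.distinct(1))
  then show ?thesis unfolding apartment_alt S
    by (simp add: flag_of_def permute_list_def sign_swap_id insert_commute[of w v])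
qed

text \<open>Displays the apartment as a linear function of its middle block, so that a relation
  between apartments of a plane carries over to the whole space.\<close>

lemma apartment_append:
  "apartment (us @ xs @ ts) = shuffle_mult (apartment us \<otimes>\<^sub>Q shuffle_mult (apartment xs \<otimes>\<^sub>Q apartment ts))"
  by (simp add: shuffle_mult_apartment)


section \<open>Bases adapted to flags\<close>

lemma ordered_basis_length: "ordered_basis V vs \<Longrightarrow> length vs = dim V"
  unfolding ordered_basis_def by (metis dim_span_eq_card_independent distinct_card)

lemma ordered_basis_span: "ordered_basis V vs \<Longrightarrow> span (set vs) = V"
  by (simp add: ordered_basis_def)

lemma ordered_basis_subspace: "ordered_basis V vs \<Longrightarrow> subspace V"
  by (metis ordered_basis_span subspace_span)

lemma ordered_basis_subset: "ordered_basis V vs \<Longrightarrow> set vs \<subseteq> V"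
  by (metis ordered_basis_span span_superset)

lemma ordered_basis_singleton: "v \<noteq> 0 \<Longrightarrow> ordered_basis (span {v}) [v]"
  by (simp add: ordered_basis_def independent_insert)

lemma independent_span_set_le:
  assumes "ordered_basis V vs" "set ws \<subseteq> V" "distinct ws" "independent (set ws)"
  shows "length ws \<le> length vs"
  using independent_span_bound[of "set vs" "set ws"] assms
  by (simp add: ordered_basis_def distinct_card)

lemma ordered_basis_of_independent:
  assumes V: "ordered_basis V vs" and ws: "set ws \<subseteq> V" "length ws = length vs"
    "distinct ws" "independent (set ws)"
  shows "ordered_basis V ws"
proof -
  have "V \<subseteq> span (set ws)"
  proof (rule ccontr)
    assume "\<not> V \<subseteq> span (set ws)"
    then obtain x where x: "x \<in> V" "x \<notin> span (set ws)" by blast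
    then have "x \<notin> set ws" using span_base by blast
    then have "length (x # ws) \<le> length vs"
      using x ws independent_insertI[of x "set ws"] by (intro independent_span_set_le[OF V]) auto
    then show False using ws by simp
  qed
  moreover have "span (set ws) \<subseteq> V"
    using ws ordered_basis_subspace[OF V] by (simp add: span_minimal)
  ultimately show ?thesis using ws by (simp add: ordered_basis_def)
qed

lemma ordered_basis_of_spanning:
  assumes V: "ordered_basis V vs" and ws: "span (set ws) = V" "length ws = length vs"
  shows "ordered_basis V ws"
proof -
  obtain B where B: "B \<subseteq> set ws" "independent B" "set ws \<subseteq> span B"
    using maximal_independent_subset by blast
  then have "span B = V"
    using ws by (metis span_mono span_span subset_antisym)
  then have "card B = length ws"
    using B ws ordered_basis_length[OF V] dim_span_eq_card_independent by metis
  moreover have "card B \<le> card (set ws)" using B by (simp add: card_mono)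
  ultimately have "card (set ws) = length ws" "card B = card (set ws)"
    using card_length[of ws] by auto
  moreover from this have "B = set ws" using B by (simp add: card_subset_eq)
  ultimately have "card (set ws) = length ws" "B = set ws" by auto
  then show ?thesis using B ws by (simp add: ordered_basis_def card_distinct)
qed

lemma independent_iff_notin_span_take:
  "distinct vs \<and> independent (set vs) \<longleftrightarrow> (\<forall>k<length vs. vs ! k \<notin> span (set (take k vs)))"
proof (induction vs rule: rev_induct)
  case (snoc v vs)
  have "(\<forall>k<length (vs @ [v]). (vs @ [v]) ! k \<notin> span (set (take k (vs @ [v])))) \<longleftrightarrow>
      (\<forall>k<length vs. vs ! k \<notin> span (set (take k vs))) \<and> v \<notin> span (set vs)"
    by (auto simp: less_Suc_eq nth_append)
  moreover have "distinct (vs @ [v]) \<and> independent (set (vs @ [v])) \<longleftrightarrow>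
      (distinct vs \<and> independent (set vs)) \<and> v \<notin> span (set vs)"
    using span_base[of v "set vs"] by (auto simp: independent_insert split: if_splits)
  ultimately show ?case using snoc by simp
qed (simp add: independent_empty)

lemma ordered_basis_permute:
  assumes "ordered_basis V vs" "\<sigma> permutes {..<length vs}"
  shows "ordered_basis V (permute_list \<sigma> vs)"
  using assms by (simp add: ordered_basis_def)

lemma flag_of_complete:
  assumes "ordered_basis V vs"
  shows "flag_of vs \<in> complete_flags V"
proof -
  have notin: "vs ! k \<notin> span (set (take k vs))" if "k < length vs" for k
    using assms that independent_iff_notin_span_take by (auto simp: ordered_basis_def)
  have "sorted_wrt (\<subset>) (flag_of vs)"
    unfolding sorted_wrt_iff_nth_less
  proof (intro allI impI)
    fix i j assume ij: "i < j" "j < length (flag_of vs)"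
    have "span (set (take i vs)) \<subseteq> span (set (take j vs))"
      using ij by (intro span_mono set_take_subset_set_take) simp
    moreover have "vs ! i \<in> span (set (take j vs))"
      using ij by (intro span_base) (auto simp: in_set_conv_nth)
    ultimately show "flag_of vs ! i \<subset> flag_of vs ! j"
      using ij notin[of i] by (auto simp: flag_of_nth)
  qed
  moreover have "hd (flag_of vs) = {0}" by (simp add: flag_of_def upt_conv_Cons del: upt_Suc)
  moreover have "last (flag_of vs) = V" using assms by (simp add: flag_of_def ordered_basis_def)
  moreover have "\<forall>W\<in>set (flag_of vs). subspace W" by (auto simp: flag_of_def)
  moreover have "flag_of vs \<noteq> []" by (simp add: flag_of_def)
  ultimately show ?thesis
    using ordered_basis_length[OF assms] by (simp add: complete_flags_def is_flag_def)
qed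

lemma dim_flag_of_nth:
  assumes "ordered_basis V vs" "i \<le> length vs"
  shows "dim (flag_of vs ! i) = i"
proof -
  have "independent (set (take i vs))"
    using assms by (meson independent_mono ordered_basis_def set_take_subset)
  moreover have "card (set (take i vs)) = i"
    using assms by (simp add: ordered_basis_def distinct_card)
  ultimately show ?thesis
    using assms by (simp add: flag_of_nth dim_eq_card_independent)
qed

text \<open>A vector is picked from each difference of consecutive members. Independence is
  immediate; that the picks span every member follows by counting, because the flag has as many
  steps as the dimension allows.\<close>

lemma complete_flag_basis:
  assumes V: "ordered_basis V es" and F: "F \<in> complete_flags V"
  obtains vs where "ordered_basis V vs" "flag_of vs = F"
proof -
  define d where "d = length es"
  have len: "length F = Suc d"
    using F ordered_basis_length[OF V] by (simp add: complete_flags_def d_def)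
  have less: "F ! i \<subset> F ! j" if "i < j" "j \<le> d" for i j
    using F that len by (auto simp: complete_flags_def is_flag_def sorted_wrt_iff_nth_less)
  then have le: "F ! i \<subseteq> F ! j" if "i \<le> j" "j \<le> d" for i j
    using that less[of i j] by (metis le_neq_implies_less psubset_imp_subset subset_refl)
  have sub: "subspace (F ! i)" if "i \<le> d" for i
    using F that len by (simp add: complete_flags_def is_flag_def)
  have top: "F ! d = V"
  proof -
    have "F \<noteq> []" "last F = V" using F by (simp_all add: complete_flags_def is_flag_def)
    then show ?thesis using len last_conv_nth[of F] by simp
  qed
  define v where "v i = (SOME x. x \<in> F ! Suc i - F ! i)" for i
  have v: "v i \<in> F ! Suc i - F ! i" if "i < d" for i
  proof -
    have "F ! i \<subset> F ! Suc i" using less[of i "Suc i"] that by simp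
    then have "\<exists>x. x \<in> F ! Suc i - F ! i" by blast
    then show ?thesis unfolding v_def by (rule someI_ex)
  qed
  define vs where "vs = map v [0..<d]"
  have take_sub: "set (take k vs) \<subseteq> F ! k" if kd: "k \<le> d" for k
  proof
    fix x assume "x \<in> set (take k vs)"
    then obtain i where i: "i < k" "x = v i" using kd by (auto simp: vs_def take_map)
    then show "x \<in> F ! k" using v[of i] le[of "Suc i" k] kd by auto
  qed
  have notin: "vs ! k \<notin> F ! k" if "k < d" for k
    using v that by (simp add: vs_def)
  have ind: "distinct vs \<and> independent (set vs)"
    unfolding independent_iff_notin_span_take
  proof (intro allI impI)
    fix k assume "k < length vs"
    then have "k < d" by (simp add: vs_def)
    then show "vs ! k \<notin> span (set (take k vs))"
      using notin[of k] span_minimal[OF take_sub sub, of k] by auto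
  qed
  have basis: "ordered_basis V vs"
    using ind take_sub[of d] top by (intro ordered_basis_of_independent[OF V]) (auto simp: vs_def d_def)
  have "span (set (take k vs)) = F ! k" if k: "k \<le> d" for k
  proof (rule ccontr)
    assume "span (set (take k vs)) \<noteq> F ! k"
    then obtain w where w: "w \<in> F ! k" "w \<notin> span (set (take k vs))"
      using span_minimal[OF take_sub sub] k by blast
    \<comment> \<open>A vector of \<open>F ! k\<close> missed by the first \<open>k\<close> picks is
      inserted at place \<open>k\<close>; the result is independent and one longer than a basis of
      \<open>V\<close>.\<close>
    let ?ws = "take k vs @ w # drop k vs"
    have lvs: "length vs = d" by (simp add: vs_def)
    have "?ws ! j \<notin> span (set (take j ?ws))" if j: "j < length ?ws" for j
    proof (cases j k rule: linorder_cases)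
      case less
      then show ?thesis
        using ind k by (simp add: independent_iff_notin_span_take nth_append lvs min_def)
    next
      case equal
      then show ?thesis using w k by (simp add: nth_append lvs)
    next
      \<comment> \<open>Past the insertion, all earlier vectors including \<open>w\<close> lie in
        \<open>F ! i\<close>, which \<open>vs ! i\<close> avoids.\<close>
      case greater
      then obtain i where i: "j = Suc i" "k \<le> i" "i < d" using j k by (cases j) (auto simp: lvs)
      have "set (take i vs) = set (take k vs) \<union> set (take (i - k) (drop k vs))"
        using i take_add[of k "i - k" vs] by (simp flip: set_append)
      then have "set (take j ?ws) = insert w (set (take i vs))"
        using i k by (auto simp: lvs min_def Suc_diff_le)
      also have "\<dots> \<subseteq> F ! i" using w le[of k i] take_sub[of i] i by auto
      finally have "span (set (take j ?ws)) \<subseteq> F ! i" using sub i by (simp add: span_minimal)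
      moreover have "?ws ! j = vs ! i" using i k by (simp add: nth_append lvs Suc_diff_le)
      ultimately show ?thesis using notin i by auto
    qed
    then have "distinct ?ws \<and> independent (set ?ws)"
      unfolding independent_iff_notin_span_take by blast
    moreover have "set ?ws \<subseteq> V"
      using w le[of k d] k top ordered_basis_subset[OF basis] set_take_subset[of k vs] set_drop_subset[of k vs]
      by auto
    ultimately have "length ?ws \<le> length es" by (intro independent_span_set_le[OF V]) auto
    then show False using k by (simp add: lvs d_def)
  qed
  then have "flag_of vs = F"
    using len by (intro nth_equalityI) (auto simp: flag_of_nth vs_def)
  then show ?thesis using that basis by blast
qed

section \<open>Direct sums\<close>

lemma fin_dim_subspace_basis:
  assumes "fin_dim V" "subspace W" "W \<subseteq> V"
  obtains vs where "ordered_basis W vs"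
proof -
  obtain A where A: "finite A" "span A = V" using assms by (auto simp: fin_dim_def)
  obtain B where B: "B \<subseteq> W" "independent B" "W \<subseteq> span B"
    using maximal_independent_subset by blast
  have "finite B" using independent_span_bound[OF A(1) B(2)] A B assms by auto
  then obtain vs where "set vs = B" "distinct vs" using finite_distinct_list by blast
  then show ?thesis
    using that[of vs] B assms span_subspace by (auto simp: ordered_basis_def)
qed

lemma listset_iff: "xs \<in> listset As \<longleftrightarrow> list_all2 (\<in>) xs As"
  by (induction As arbitrary: xs) (auto simp: set_Cons_def list_all2_Cons2)

lemma ordered_basis_append:
  assumes sum: "direct_sum V [V1, V2]" and vs: "ordered_basis V1 vs" and ws: "ordered_basis V2 ws"
  shows "ordered_basis V (vs @ ws)"
proof -
  have inj: "inj_on sum_list (listset [V1, V2])" and V: "sum_list ` listset [V1, V2] = V"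
    using sum by (auto simp: direct_sum_def bij_betw_def)
  have "V = {x + y | x y. x \<in> V1 \<and> y \<in> V2}"
    unfolding V[symmetric] by (force simp: set_Cons_def image_iff)
  then have span: "span (set (vs @ ws)) = V"
    using vs ws by (simp add: span_Un ordered_basis_span)
  have "distinct (vs @ ws) \<and> independent (set (vs @ ws))"
    unfolding independent_iff_notin_span_take
  proof (intro allI impI)
    fix k assume k: "k < length (vs @ ws)"
    show "(vs @ ws) ! k \<notin> span (set (take k (vs @ ws)))"
    proof (cases "k < length vs")
      case True
      then show ?thesis
        using vs independent_iff_notin_span_take[of vs] by (simp add: nth_append ordered_basis_def)
    next
      case False
      define j where "j = k - length vs"
      have j: "j < length ws" using k False by (simp add: j_def)
      show ?thesis
      proof
        assume "(vs @ ws) ! k \<in> span (set (take k (vs @ ws)))"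
        then have "ws ! j \<in> span (set vs \<union> set (take j ws))"
          using False by (simp add: nth_append j_def)
        then obtain a b where ab: "ws ! j = a + b" "a \<in> V1" "b \<in> span (set (take j ws))"
          using ordered_basis_span[OF vs] by (auto simp: span_Un)
        have sub: "subspace V1" "subspace V2" using sum by (auto simp: direct_sum_def)
        have "b \<in> V2"
          using ab(3) span_mono[of "set (take j ws)" "set ws"] set_take_subset[of j ws] ordered_basis_span[OF ws] by auto
        moreover have "ws ! j \<in> V2" using j ordered_basis_subset[OF ws] by auto
        \<comment> \<open>Both tuples decompose the same vector, so its \<open>V1\<close>-component
          \<open>a\<close> vanishes.\<close>
        ultimately have "[a, b] = [0, ws ! j]"
          using ab sub by (intro inj_onD[OF inj]) (auto simp: set_Cons_def subspace_0)
        then have "ws ! j \<in> span (set (take j ws))" using ab by simp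
        then show False
          using j ws independent_iff_notin_span_take[of ws] by (auto simp: ordered_basis_def)
      qed
    qed
  qed
  then show ?thesis using span by (simp add: ordered_basis_def)
qed

lemma span_eq_sum_lines: "sum_list ` listset (map (\<lambda>v. span {v}) vs) = span (set vs)"
proof (induction vs)
  case (Cons v vs)
  have "sum_list ` listset (map (\<lambda>v. span {v}) (v # vs)) =
      {x + y | x y. x \<in> span {v} \<and> y \<in> sum_list ` listset (map (\<lambda>v. span {v}) vs)}"
    by (force simp: set_Cons_def image_iff)
  then show ?case
    unfolding Cons using span_Un[of "{v}" "set vs"] by simp
qed simp

lemma direct_sum_lines:
  assumes "ordered_basis V vs"
  shows "direct_sum V (map (\<lambda>v. span {v}) vs)"
proof -
  have "inj_on sum_list (listset (map (\<lambda>v. span {v}) xs))" if "distinct xs" "independent (set xs)" for xs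
    using that
  proof (induction xs)
    case (Cons v xs)
    have v: "v \<notin> span (set xs)" using Cons.prems by (simp add: independent_insert)
    have IH: "inj_on sum_list (listset (map (\<lambda>v. span {v}) xs))"
      using Cons by (simp add: independent_insert split: if_splits)
    show ?case
    proof (rule inj_onI)
      fix xs' ys' assume "xs' \<in> listset (map (\<lambda>v. span {v}) (v # xs))"
        "ys' \<in> listset (map (\<lambda>v. span {v}) (v # xs))" and eq: "sum_list xs' = sum_list ys'"
      then obtain a p' b q' where
        P: "xs' = a # p'" "a \<in> span {v}" "p' \<in> listset (map (\<lambda>v. span {v}) xs)" and
        Q: "ys' = b # q'" "b \<in> span {v}" "q' \<in> listset (map (\<lambda>v. span {v}) xs)"
        by (auto simp: set_Cons_def)
      have "sum_list p' \<in> span (set xs)" "sum_list q' \<in> span (set xs)"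
        using P Q unfolding span_eq_sum_lines[symmetric] by auto
      then have in_span: "sum_list q' - sum_list p' \<in> span (set xs)" by (intro span_diff)
      moreover have diff: "a - b = sum_list q' - sum_list p'" using eq P Q by (simp add: algebra_simps)
      moreover have "a - b \<in> span {v}" using P Q by (intro span_diff)
      then obtain c where c: "a - b = scale c v" by (auto simp: span_singleton)
      moreover have "c = 0"
      proof (rule ccontr)
        assume "c \<noteq> 0"
        then have "v = scale (inverse c) (a - b)" using c by simp
        then show False using v in_span diff span_scale by metis
      qed
      ultimately have "a = b" "sum_list p' = sum_list q'" by auto
      then show "xs' = ys'" using P Q IH by (auto dest: inj_onD)
    qed
  qed simp
  then show ?thesis
    using assms span_eq_sum_lines[of vs] by (auto simp: direct_sum_def bij_betw_def ordered_basis_def)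
qed

text \<open>One nonzero vector from each of the dim V summands gives an independent list, by
  uniqueness of decompositions, hence a basis. Expanding a vector of a summand in this basis,
  uniqueness kills all components but one, so the summand is a line.\<close>

lemma direct_sum_eq_lines:
  assumes V: "ordered_basis V es" and sum: "direct_sum V Vs" "{0} \<notin> set Vs" "length Vs = dim V"
  obtains vs where "ordered_basis V vs" "Vs = map (\<lambda>v. span {v}) vs"
proof -
  have inj: "inj_on sum_list (listset Vs)" and img: "sum_list ` listset Vs = V"
    using sum by (auto simp: direct_sum_def bij_betw_def)
  have sub: "subspace W" if "W \<in> set Vs" for W using sum that by (auto simp: direct_sum_def)
  have "\<exists>x. x \<in> W \<and> x \<noteq> 0" if "W \<in> set Vs" for W
    using that sum(2) subspace_0[OF sub] by (metis empty_iff insertI1 subsetI subset_antisym singletonD insert_subset)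
  then obtain f where f: "\<And>W. W \<in> set Vs \<Longrightarrow> f W \<in> W \<and> f W \<noteq> 0" by metis
  define vs where "vs = map f Vs"
  have len: "length vs = length Vs" by (simp add: vs_def)
  have vs: "vs ! i \<in> Vs ! i" "vs ! i \<noteq> 0" if "i < length Vs" for i
    using f that by (auto simp: vs_def)
  have line_sub: "span {vs ! i} \<subseteq> Vs ! i" if "i < length Vs" for i
    using vs that sub by (intro span_minimal) auto
  have line_sub': "xs \<in> listset Vs" if "xs \<in> listset (map (\<lambda>v. span {v}) vs)" for xs
    using that subsetD[OF line_sub] by (auto simp: listset_iff list_all2_conv_all_nth len)
  have zeros: "sum_list (replicate n 0) = (0 :: 'v)" for n by (induction n) auto
  \<comment> \<open>The tuple with \<open>x\<close> at place \<open>i\<close> and 0 elsewhere: the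
    unique decomposition of a vector of the \<open>i\<close>-th summand.\<close>
  define e where "e i x = (replicate (length Vs) 0)[i := x]" for i and x :: 'v
  have e: "e i x \<in> listset Vs" if "x \<in> Vs ! i" "i < length Vs" for i x
    using that sub by (auto simp: e_def listset_iff list_all2_conv_all_nth nth_list_update subspace_0)
  have sum_e: "sum_list (e i x) = x" if "i < length Vs" for i x
    using that by (simp add: e_def upd_conv_take_nth_drop zeros)
  \<comment> \<open>An expansion in the first \<open>k\<close> lines, padded with zeros so that it
    can be compared with other decompositions along \<open>Vs\<close>.\<close>
  have span_ext: "\<exists>xs\<in>listset Vs. sum_list xs = x \<and> (\<forall>i<length Vs. xs ! i \<in> span {vs ! i}) \<and>
      (\<forall>i<length Vs. k \<le> i \<longrightarrow> xs ! i = 0)"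
    if x: "x \<in> span (set (take k vs))" for x k
  proof -
    obtain xs where xs: "xs \<in> listset (map (\<lambda>v. span {v}) (take k vs))" "sum_list xs = x"
      using x unfolding span_eq_sum_lines[of "take k vs", symmetric] by auto
    let ?ys = "xs @ replicate (length Vs - length xs) 0"
    have lx: "length xs = min k (length Vs)"
      using list_all2_lengthD[OF xs(1)[unfolded listset_iff]] len by simp
    have in_line: "?ys ! i \<in> span {vs ! i}" if "i < length Vs" for i
      using xs that lx by (auto simp: listset_iff list_all2_conv_all_nth nth_append span_zero)
    have "?ys \<in> listset (map (\<lambda>v. span {v}) vs)"
      using in_line lx len by (auto simp: listset_iff list_all2_conv_all_nth)
    then show ?thesis
      using line_sub' xs in_line lx by (intro bexI[of _ ?ys]) (auto simp: nth_append zeros)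
  qed
  have "vs ! k \<notin> span (set (take k vs))" if k: "k < length vs" for k
  proof
    assume "vs ! k \<in> span (set (take k vs))"
    then obtain xs where xs: "xs \<in> listset Vs" "sum_list xs = vs ! k" "xs ! k = 0"
      using span_ext[of "vs ! k" k] k len by auto
    then have "xs = e k (vs ! k)"
      using k len vs sum_e e by (intro inj_onD[OF inj]) auto
    then show False using xs vs k len by (simp add: e_def)
  qed
  then have "distinct vs \<and> independent (set vs)" unfolding independent_iff_notin_span_take by blast
  moreover have "set vs \<subseteq> V"
  proof
    fix v assume "v \<in> set vs"
    then obtain i where "i < length Vs" "v = vs ! i" using len by (auto simp: in_set_conv_nth)
    then have "v = sum_list (e i v)" "e i v \<in> listset Vs" using vs e sum_e by auto
    then show "v \<in> V" using img by blast
  qed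
  ultimately have basis: "ordered_basis V vs"
    using sum(3) len ordered_basis_length[OF V] by (intro ordered_basis_of_independent[OF V]) auto
  have "Vs ! i = span {vs ! i}" if i: "i < length Vs" for i
  proof
    show "Vs ! i \<subseteq> span {vs ! i}"
    proof
      fix w assume w: "w \<in> Vs ! i"
      then have "w \<in> V" using img e sum_e i by (metis imageI)
      then have "w \<in> span (set (take (length vs) vs))" using ordered_basis_span[OF basis] by simp
      then obtain xs where "xs \<in> listset Vs" "sum_list xs = w" "xs ! i \<in> span {vs ! i}"
        using span_ext i by blast
      moreover from this have "xs = e i w" using e sum_e i w by (intro inj_onD[OF inj]) auto
      ultimately show "w \<in> span {vs ! i}" using i by (simp add: e_def)
    qed
  qed (use line_sub i in simp)
  then have "Vs = map (\<lambda>v. span {v}) vs" using len by (intro nth_equalityI) auto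
  then show ?thesis using that basis by blast
qed

section \<open>The Solomon--Tits theorem\<close>

text \<open>For a complete flag and an interior position this is the panel at that position: two
  chambers are adjacent there, or equal, exactly if these lists agree.\<close>

definition omit :: "nat \<Rightarrow> 'a list \<Rightarrow> 'a list" where
  "omit i xs = take i xs @ drop (Suc i) xs"

lemma length_omit: "i < length xs \<Longrightarrow> length (omit i xs) = length xs - 1"
  by (simp add: omit_def)

lemma omit_nth: "i < length xs \<Longrightarrow> k < length xs - 1 \<Longrightarrow>
    omit i xs ! k = (if k < i then xs ! k else xs ! Suc k)"
  by (auto simp: omit_def nth_append min_def)

lemma omit_eq_nthD:
  assumes "omit t F = omit t G" "length F = length G" "t < length F" "i < length F" "i \<noteq> t"
  shows "F ! i = G ! i"
proof (cases "i < t")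
  case True
  have "omit t F ! i = omit t G ! i" using assms(1) by simp
  then show ?thesis using True assms(2-) by (simp add: omit_nth)
next
  case False
  have "omit t F ! (i - 1) = omit t G ! (i - 1)" using assms(1) by simp
  then show ?thesis using False assms(2-) by (cases i) (auto simp: omit_nth)
qed

section \<open>The boundary of the building, its cycles and the apartments among them\<close>

lemma building_boundary_lin_ext:
  "building_boundary = lin_ext (\<lambda>F. \<Sum>i\<in>{1..<length F - 1}. qscale ((-1) ^ (i - 1)) (bvec (omit i F)))"
  by (simp add: fun_eq_iff building_boundary_def lin_ext_def omit_def qscale_single
      rat_space.scale_sum_right mult.commute)

lemma qlinear_building_boundary: "qlinear building_boundary"
  unfolding building_boundary_lin_ext by (rule qlinear_lin_ext)

lemma building_boundary_bvec:
  "building_boundary (bvec F) = (\<Sum>i\<in>{1..<length F - 1}. qscale ((-1) ^ (i - 1)) (bvec (omit i F)))"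
  by (simp add: building_boundary_lin_ext)

lemma subspace_supp: "rat_space.subspace {c. supp c \<subseteq> S}"
proof (rule rat_space.subspaceI)
  fix x y assume "x \<in> {c. supp c \<subseteq> S}" "y \<in> {c. supp c \<subseteq> S}"
  then show "x + y \<in> {c. supp c \<subseteq> S}" using keys_add[of x y] by auto
qed (auto simp: in_keys_iff lookup_qscale)

lemma subspace_St: "rat_space.subspace (St V)"
proof -
  have "St V = {c. supp c \<subseteq> complete_flags V} \<inter> {c. building_boundary c = 0}"
    by (auto simp: St_def top_chains_def)
  moreover have "rat_space.subspace {c. building_boundary c = 0}"
    by (rule rat_space.subspaceI) (simp_all add: qlin_simps[OF qlinear_building_boundary])
  ultimately show ?thesis using rat_space.subspace_inter subspace_supp by metis
qed

text \<open>A panel remembers the missing dimension: for i < j the entry at place i has dimension i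
  + 1 on one side and i on the other.\<close>

lemma omit_index_unique:
  assumes "ordered_basis V vs" "ordered_basis V ws" "i \<le> length vs" "j \<le> length vs"
    "omit i (flag_of vs) = omit j (flag_of ws)"
  shows "i = j"
proof -
  have len: "length vs = length ws" using assms by (simp add: ordered_basis_length)
  have False if "i < j" "j \<le> length vs" "omit i (flag_of vs) = omit j (flag_of ws)"
    "ordered_basis V vs" "ordered_basis V ws" for i j vs ws
  proof -
    have len: "length vs = length ws" using that by (simp add: ordered_basis_length)
    have "flag_of vs ! Suc i = flag_of ws ! i"
    proof -
      have "omit i (flag_of vs) ! i = omit j (flag_of ws) ! i" using that(3) by simp
      then show ?thesis using that(1,2) len by (simp add: omit_nth)
    qed
    then show False
      using dim_flag_of_nth[OF that(4), of "Suc i"] dim_flag_of_nth[OF that(5), of i] that len by simp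
  qed
  from this[of i j vs ws] this[of j i ws vs] show ?thesis
    using assms len by (metis nat_neq_iff)
qed

text \<open>This is the coefficient of the boundary at the panel. By
  \<open>omit_index_unique\<close> only faces with index \<open>t\<close> contribute to it, all with
  the same sign, so the sign can be cancelled.\<close>

lemma St_panel_sum:
  assumes V: "ordered_basis V es" and c: "c \<in> St V" and F: "F \<in> complete_flags V"
    and t: "1 \<le> t" "t < dim V"
  shows "(\<Sum>G | G \<in> supp c \<and> omit t G = omit t F. coeff c G) = 0"
proof -
  have inner: "(\<Sum>i\<in>{1..<length G - 1}. (-1) ^ (i - 1) * (if omit i G = omit t F then 1 else 0 :: rat)) =
      (if omit t G = omit t F then (-1) ^ (t - 1) else 0)" if "G \<in> supp c" for G
  proof -
    have G: "G \<in> complete_flags V" using that c by (auto simp: St_def top_chains_def)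
    obtain vs where vs: "ordered_basis V vs" "flag_of vs = G" using complete_flag_basis[OF V G] .
    obtain ws where ws: "ordered_basis V ws" "flag_of ws = F" using complete_flag_basis[OF V F] .
    have len: "length vs = dim V" "length G = Suc (dim V)"
      using vs ordered_basis_length by auto
    have "(\<Sum>i\<in>{1..<length G - 1}. (-1) ^ (i - 1) * (if omit i G = omit t F then 1 else 0 :: rat)) =
        (\<Sum>i\<in>{1..<length G - 1}. if i = t then if omit t G = omit t F then (-1) ^ (t - 1) else 0 else 0)"
    proof (intro sum.cong refl)
      fix i assume i: "i \<in> {1..<length G - 1}"
      show "(-1) ^ (i - 1) * (if omit i G = omit t F then 1 else 0 :: rat) =
          (if i = t then if omit t G = omit t F then (-1) ^ (t - 1) else 0 else 0)"
      proof (cases "i = t")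
        case False
        then have "omit i G \<noteq> omit t F"
          using omit_index_unique[OF vs(1) ws(1), of i t] i vs ws len t by auto
        then show ?thesis using False by simp
      qed simp
    qed
    then show ?thesis using t len by simp
  qed
  have "0 = coeff (building_boundary c) (omit t F)" using c by (simp add: St_def)
  also have "\<dots> = (\<Sum>G\<in>supp c. coeff c G *
      (\<Sum>i\<in>{1..<length G - 1}. (-1) ^ (i - 1) * (if omit i G = omit t F then 1 else 0)))"
    by (simp add: building_boundary_lin_ext lin_ext_def coeff_sum lookup_qscale coeff_bvec)
  also have "\<dots> = (\<Sum>G\<in>supp c. if omit t G = omit t F then coeff c G * (-1) ^ (t - 1) else 0)"
    using inner by (intro sum.cong) auto
  also have "\<dots> = (\<Sum>G | G \<in> supp c \<and> omit t G = omit t F. coeff c G) * (-1) ^ (t - 1)"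
    unfolding sum_distrib_right by (subst sum.inter_filter) auto
  finally show ?thesis by simp
qed

text \<open>Exchanging two neighbouring vectors changes the set of the first \<open>k\<close>
  vectors only for k = i.\<close>

lemma omit_flag_of_transpose:
  assumes "1 \<le> i" "i < length xs"
  shows "omit i (flag_of (permute_list (Transposition.transpose (i - 1) i) xs)) = omit i (flag_of xs)"
proof -
  let ?t = "Transposition.transpose (i - 1) i"
  have perm: "?t permutes {..<length xs}" using assms by (intro permutes_swap_id) auto
  have "set (take k (permute_list ?t xs)) = set (take k xs)" if "k \<le> length xs" "k \<noteq> i" for k
  proof (cases "k < i")
    case True
    have "take k (permute_list ?t xs) = take k xs"
      using True assms perm by (intro nth_equalityI) (auto simp: permute_list_nth Transposition.transpose_def)
    then show ?thesis by simp
  next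
    case False
    then have "?t permutes {..<length (take k xs)}"
      using that assms by (intro permutes_swap_id) auto
    moreover have "take k (permute_list ?t xs) = permute_list ?t (take k xs)"
      using that perm by (intro nth_equalityI) (auto simp: permute_list_def Transposition.transpose_def)
    ultimately show ?thesis by simp
  qed
  then show ?thesis
    using assms by (intro nth_equalityI) (auto simp: length_omit omit_nth flag_of_nth)
qed

text \<open>For each face index \<open>i\<close>, composing with the transposition of i - 1 and i
  reverses the sign and keeps the \<open>i\<close>-th face. The sum \<open>T i\<close> of these
  faces therefore equals its own negative.\<close>

lemma building_boundary_apartment: "building_boundary (apartment vs) = 0"
proof -
  let ?S = "{\<sigma>. \<sigma> permutes {..<length vs}}"
  define T where "T i = (\<Sum>\<sigma>\<in>?S. qscale (of_int (sign \<sigma>)) (bvec (omit i (flag_of (permute_list \<sigma> vs)))))" for i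
  have "T i = 0" if i: "i \<in> {1..<length vs}" for i
  proof -
    let ?t = "Transposition.transpose (i - 1) i"
    have ne: "i - 1 \<noteq> i" using i by auto
    have perm: "?t permutes {..<length vs}" using i by (intro permutes_swap_id) auto
    have permutation: "permutation \<sigma>" if "\<sigma> \<in> ?S" for \<sigma>
      using that permutation_permutes by blast
    have "T i = (\<Sum>\<sigma>\<in>?S. qscale (of_int (sign (\<sigma> \<circ> ?t))) (bvec (omit i (flag_of (permute_list (\<sigma> \<circ> ?t) vs)))))"
      unfolding T_def using perm
      by (intro sum.reindex_bij_witness[of _ "\<lambda>\<sigma>. \<sigma> \<circ> ?t" "\<lambda>\<sigma>. \<sigma> \<circ> ?t"])
        (auto simp: permutes_compose o_assoc[symmetric] transpose_comp_involutory)
    also have "\<dots> = (\<Sum>\<sigma>\<in>?S. - qscale (of_int (sign \<sigma>)) (bvec (omit i (flag_of (permute_list \<sigma> vs)))))"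
    proof (intro sum.cong refl)
      fix \<sigma> assume \<sigma>: "\<sigma> \<in> ?S"
      have "sign (\<sigma> \<circ> ?t) = - sign \<sigma>"
        using ne permutation[OF \<sigma>] by (simp add: sign_compose permutation_swap_id sign_swap_id)
      moreover have "omit i (flag_of (permute_list (\<sigma> \<circ> ?t) vs)) = omit i (flag_of (permute_list \<sigma> vs))"
        using i perm omit_flag_of_transpose[of i "permute_list \<sigma> vs"] by (simp add: permute_list_compose)
      ultimately show "qscale (of_int (sign (\<sigma> \<circ> ?t))) (bvec (omit i (flag_of (permute_list (\<sigma> \<circ> ?t) vs)))) =
          - qscale (of_int (sign \<sigma>)) (bvec (omit i (flag_of (permute_list \<sigma> vs))))"
        by simp
    qed
    also have "\<dots> = - T i" by (simp add: T_def sum_negf)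
    finally have "T i = - T i" .
    then have "coeff (T i) F = - coeff (T i) F" for F by (metis lookup_uminus)
    then have "coeff (T i) F = 0" for F by (metis equal_neg_zero)
    then show ?thesis by (intro poly_mapping_eqI) simp
  qed
  moreover have "building_boundary (apartment vs) = (\<Sum>i\<in>{1..<length vs}. qscale ((-1) ^ (i - 1)) (T i))"
    unfolding apartment_alt T_def qlin_simps[OF qlinear_building_boundary] building_boundary_bvec
      rat_space.scale_sum_right
    by (subst sum.swap) (simp add: mult.commute)
  ultimately show ?thesis by simp
qed

lemma apartment_in_St:
  assumes "ordered_basis V vs"
  shows "apartment vs \<in> St V"
proof -
  have "apartment vs \<in> {c. supp c \<subseteq> complete_flags V}"
    unfolding apartment_alt using assms
    by (intro rat_space.subspace_sum rat_space.subspace_scale subspace_supp)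
      (auto simp: flag_of_complete ordered_basis_permute)
  then show ?thesis by (simp add: St_def top_chains_def building_boundary_apartment)
qed

text \<open>The part of a chain at the vertex \<open>H\<close> of the building: of the chambers with
  hyperplane \<open>H\<close> the end point \<open>V\<close> is dropped, leaving flags of
  \<open>H\<close> (the lower link of that vertex).\<close>

definition hyperplane_part :: "'v set \<Rightarrow> 'v chain \<Rightarrow> 'v chain" where
  "hyperplane_part H = lin_ext (\<lambda>F. if last (butlast F) = H then bvec (butlast F) else 0)"

lemma qlinear_hyperplane_part: "qlinear (hyperplane_part H)"
  unfolding hyperplane_part_def by (rule qlinear_lin_ext)

lemma last_butlast_nth: "length F = Suc (Suc n) \<Longrightarrow> last (butlast F) = F ! n"
  by (subst last_conv_nth) (auto simp: nth_butlast simp flip: length_0_conv)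

lemma butlast_complete_flag:
  assumes F: "F \<in> complete_flags V" and dims: "dim V = Suc n" "dim (last (butlast F)) = n"
  shows "butlast F \<in> complete_flags (last (butlast F))"
proof -
  have len: "length F = Suc (Suc n)" using F dims by (simp add: complete_flags_def)
  have "sorted_wrt (\<subset>) (butlast F)"
    using F by (auto simp: complete_flags_def is_flag_def butlast_conv_take sorted_wrt_take)
  moreover have "hd (butlast F) = {0}"
    using F len by (cases F) (auto simp: complete_flags_def is_flag_def)
  moreover have "\<forall>W\<in>set (butlast F). subspace W"
    using F by (auto simp: complete_flags_def is_flag_def dest: in_set_butlastD)
  moreover have "butlast F \<noteq> []" using len by (simp flip: length_0_conv)
  ultimately show ?thesis using len dims by (simp add: complete_flags_def is_flag_def)
qed

text \<open>Faces with index below \<open>n\<close> keep the hyperplane and commute with dropping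
  the end point, with the same signs. The face with index \<open>n\<close> removes the hyperplane;
  the next member then has dimension n - 1 and cannot be \<open>H\<close>.\<close>

lemma hyperplane_part_boundary:
  assumes V: "ordered_basis V es" and n: "length es = Suc n" and H: "dim H = n"
    and c: "c \<in> top_chains V"
  shows "building_boundary (hyperplane_part H c) = hyperplane_part H (building_boundary c)"
proof -
  have "building_boundary (hyperplane_part H (bvec F)) = hyperplane_part H (building_boundary (bvec F))"
    if F: "F \<in> complete_flags V" for F
  proof -
    obtain vs where vs: "ordered_basis V vs" "flag_of vs = F" using complete_flag_basis[OF V F] .
    have lvs: "length vs = Suc n" using n ordered_basis_length[OF V] ordered_basis_length[OF vs(1)] by simp
    then have len: "length F = Suc (Suc n)" using vs by auto
    have rhs: "hyperplane_part H (building_boundary (bvec F)) =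
        (\<Sum>i\<in>{1..<Suc n}. qscale ((-1) ^ (i - 1)) (hyperplane_part H (bvec (omit i F))))"
      using len by (simp add: building_boundary_lin_ext qlin_simps[OF qlinear_hyperplane_part])
    have inner: "hyperplane_part H (bvec (omit i F)) = (if F ! n = H then bvec (omit i (butlast F)) else 0)"
      if i: "i \<in> {1..<n}" for i
    proof -
      obtain m where m: "n = Suc m" using i by (cases n) auto
      have "last (butlast (omit i F)) = F ! n"
        using that len m by (subst last_butlast_nth[of _ m]) (auto simp: length_omit omit_nth)
      moreover have "butlast (omit i F) = omit i (butlast F)"
        using that len by (intro nth_equalityI) (auto simp: length_omit omit_nth nth_butlast)
      ultimately show ?thesis by (simp add: hyperplane_part_def)
    qed
    have "hyperplane_part H (bvec (omit n F)) = 0" if n1: "n \<ge> 1"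
    proof -
      obtain m where m: "n = Suc m" using n1 by (cases n) auto
      have "last (butlast (omit n F)) = F ! m"
        using len m by (subst last_butlast_nth[of _ m]) (auto simp: length_omit omit_nth)
      moreover have "dim (F ! m) = m" using dim_flag_of_nth[OF vs(1), of m] vs lvs m by simp
      ultimately show ?thesis using H m by (auto simp: hyperplane_part_def)
    qed
    then have "hyperplane_part H (building_boundary (bvec F)) =
        (\<Sum>i\<in>{1..<n}. qscale ((-1) ^ (i - 1)) (hyperplane_part H (bvec (omit i F))))"
      unfolding rhs by (cases n) (auto simp: sum.atLeastLessThan_Suc)
    also have "\<dots> = (\<Sum>i\<in>{1..<n}. qscale ((-1) ^ (i - 1)) (if F ! n = H then bvec (omit i (butlast F)) else 0))"
      using inner by (intro sum.cong) auto
    also have "\<dots> = building_boundary (hyperplane_part H (bvec F))"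
      using len by (simp add: hyperplane_part_def building_boundary_lin_ext last_butlast_nth
          qlinear_zero[OF qlinear_lin_ext])
    finally show ?thesis by simp
  qed
  moreover have "c \<in> rat_space.span (bvec ` complete_flags V)"
  proof -
    have "bvec ` supp c \<subseteq> bvec ` complete_flags V" using c unfolding top_chains_def by blast
    then show ?thesis using span_bvec[of c] rat_space.span_mono by blast
  qed
  ultimately show ?thesis
    using qlinear_eq_on_span[OF qlinear_compose[OF qlinear_building_boundary qlinear_hyperplane_part[of H]]
        qlinear_compose[OF qlinear_hyperplane_part[of H] qlinear_building_boundary], of "bvec ` complete_flags V" c]
    by blast
qed

lemma hyperplane_part_St:
  assumes V: "ordered_basis V es" and n: "length es = Suc n" and H: "dim H = n" and c: "c \<in> St V"
  shows "hyperplane_part H c \<in> St H"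
proof -
  have top: "c \<in> top_chains V" "building_boundary c = 0" using c by (auto simp: St_def)
  have "building_boundary (hyperplane_part H c) = 0"
    using hyperplane_part_boundary[OF V n H top(1)] top(2) by (simp add: qlinear_zero[OF qlinear_hyperplane_part])
  moreover have "hyperplane_part H c \<in> {c. supp c \<subseteq> complete_flags H}"
    unfolding hyperplane_part_def lin_ext_def
  proof (intro rat_space.subspace_sum rat_space.subspace_scale subspace_supp)
    fix F assume "F \<in> supp c"
    then have "F \<in> complete_flags V" using top by (auto simp: top_chains_def)
    moreover have "dim V = Suc n" using n ordered_basis_length[OF V] by simp
    ultimately show "(if last (butlast F) = H then bvec (butlast F) else 0) \<in> {c. supp c \<subseteq> complete_flags H}"
      using butlast_complete_flag[of F V n] H by auto
  qed
  ultimately show ?thesis by (simp add: St_def top_chains_def)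
qed

text \<open>No coefficients are merged, since a flag of \<open>V\<close> is recovered from its
  \<open>butlast\<close> by appending \<open>V\<close>. A chain whose part at \<open>H\<close>
  vanishes therefore has no chamber with hyperplane \<open>H\<close>.\<close>

lemma coeff_hyperplane_part:
  assumes V: "dim V = Suc n" and c: "c \<in> top_chains V" and F: "F \<in> complete_flags V"
  shows "coeff (hyperplane_part (last (butlast F)) c) (butlast F) = coeff c F"
proof -
  have "G = F" if "G \<in> complete_flags V" "butlast G = butlast F" for G
    using that F by (auto simp: complete_flags_def is_flag_def) (metis append_butlast_last_id)
  then have "coeff c G * coeff (if last (butlast G) = last (butlast F) then bvec (butlast G) else 0) (butlast F) =
      (if G = F then coeff c F else 0)" if "G \<in> supp c" for G
    using that c by (auto simp: top_chains_def coeff_bvec)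
  then have "coeff (hyperplane_part (last (butlast F)) c) (butlast F) = (\<Sum>G\<in>supp c. if G = F then coeff c F else 0)"
    unfolding hyperplane_part_def lin_ext_def coeff_sum lookup_qscale by (intro sum.cong) auto
  then show ?thesis by (simp add: in_keys_iff)
qed

lemma butlast_flag_of: "butlast (flag_of (xs @ [x])) = flag_of xs"
  by (intro nth_equalityI) (auto simp: nth_butlast flag_of_nth)

text \<open>A chamber of the apartment whose hyperplane misses \<open>u\<close> must use
  \<open>u\<close> last. So only permutations fixing the last place survive, and all their chambers
  have hyperplane \<open>span (set ws)\<close>.\<close>

lemma hyperplane_part_apartment:
  assumes u: "u \<notin> H"
  shows "hyperplane_part H (apartment (ws @ [u])) = (if span (set ws) = H then apartment ws else 0)"
proof -
  let ?n = "length ws"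
  define f where "f \<sigma> = hyperplane_part H (bvec (flag_of (permute_list \<sigma> (ws @ [u]))))" for \<sigma>
  have sub: "\<sigma> permutes {..<Suc ?n}" if "\<sigma> permutes {..<?n}" for \<sigma>
    using that by (rule permutes_subset) auto
  have zero: "f \<sigma> = 0" if \<sigma>: "\<sigma> permutes {..<Suc ?n}" "\<not> \<sigma> permutes {..<?n}" for \<sigma>
  proof -
    have "\<sigma> ?n \<noteq> ?n"
      using \<sigma> permutes_superset[OF \<sigma>(1), of "{..<?n}"] by (auto simp: less_Suc_eq)
    then have "inv \<sigma> ?n \<noteq> ?n" using \<sigma> by (metis permutes_inverses(1))
    moreover have "inv \<sigma> ?n \<in> {..<Suc ?n}"
      using permutes_in_image[OF permutes_inv[OF \<sigma>(1)], of ?n] by simp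
    ultimately have less: "inv \<sigma> ?n < ?n" by simp
    let ?xs = "permute_list \<sigma> (ws @ [u])"
    have "?xs ! inv \<sigma> ?n = u" using \<sigma> less by (simp add: permute_list_nth permutes_inverses)
    then have "u \<in> set (take ?n ?xs)" using less by (force simp: in_set_conv_nth)
    then have "u \<in> flag_of ?xs ! ?n" by (simp add: flag_of_nth span_base)
    then show ?thesis using u by (auto simp: f_def hyperplane_part_def last_butlast_nth)
  qed
  have nonzero: "f \<sigma> = (if span (set ws) = H then bvec (flag_of (permute_list \<sigma> ws)) else 0)"
    if \<sigma>: "\<sigma> permutes {..<?n}" for \<sigma>
  proof -
    have "permute_list \<sigma> (ws @ [u]) = permute_list \<sigma> ws @ [u]"
    proof (rule nth_equalityI)
      fix i assume "i < length (permute_list \<sigma> (ws @ [u]))"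
      then show "permute_list \<sigma> (ws @ [u]) ! i = (permute_list \<sigma> ws @ [u]) ! i"
        using permutes_in_image[OF \<sigma>, of i] permutes_not_in[OF \<sigma>, of i] sub[OF \<sigma>]
        by (auto simp: permute_list_nth nth_append \<sigma> less_Suc_eq)
    qed simp
    moreover have "last (flag_of (permute_list \<sigma> ws)) = span (set ws)"
      using \<sigma> by (simp add: flag_of_def)
    ultimately show ?thesis by (auto simp: f_def hyperplane_part_def butlast_flag_of)
  qed
  have "hyperplane_part H (apartment (ws @ [u])) =
      (\<Sum>\<sigma> | \<sigma> permutes {..<Suc ?n}. qscale (of_int (sign \<sigma>)) (f \<sigma>))"
    by (simp add: apartment_alt qlin_simps[OF qlinear_hyperplane_part] f_def)
  also have "\<dots> = (\<Sum>\<sigma> | \<sigma> permutes {..<?n}. qscale (of_int (sign \<sigma>)) (f \<sigma>))"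
    using sub zero by (intro sum.mono_neutral_right) (auto simp: finite_permutations)
  also have "\<dots> = (if span (set ws) = H then apartment ws else 0)"
    using nonzero by (simp add: apartment_alt)
  finally show ?thesis .
qed

lemma flag_of_Suc_eq_span_insert:
  assumes "t < length vs" "u \<in> flag_of vs ! Suc t" "u \<notin> flag_of vs ! t"
  shows "flag_of vs ! Suc t = span (insert u (flag_of vs ! t))"
proof -
  let ?S = "set (take t vs)"
  have ins: "set (take (Suc t) vs) = insert (vs ! t) ?S"
    using assms by (simp add: take_Suc_conv_app_nth)
  have u: "u \<in> span (insert (vs ! t) ?S)" "u \<notin> span ?S"
    using assms by (simp_all add: flag_of_nth ins)
  then have "vs ! t \<in> span (insert u ?S)" by (rule in_span_insert)
  then have "span (insert (vs ! t) ?S) = span (insert u ?S)"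
    using u by (intro subset_antisym span_minimal) (auto intro: span_base)
  moreover have "span (insert u ?S) = span (insert u (span ?S))"
    by (simp add: span_insert span_span)
  ultimately show ?thesis using assms by (simp add: flag_of_nth ins)
qed

text \<open>A flag of the support which reaches \<open>u\<close> as late as possible is alone in its panel at that place,
  since the other flags of the panel reach \<open>u\<close> even later.\<close>

lemma St_eq_0_if_hyperplanes_contain:
  assumes V: "ordered_basis V es" and n: "length es = Suc n" and c: "c \<in> St V"
    and u: "u \<noteq> 0" "\<And>F. F \<in> supp c \<Longrightarrow> u \<in> F ! n"
  shows "c = 0"
proof (rule ccontr)
  assume "c \<noteq> 0"
  \<comment> \<open>The first position at which the flag contains \<open>u\<close>: at most
    \<open>n\<close> by assumption, and positive because flags start at {0}.\<close>
  define t where "t F = (LEAST i. u \<in> F ! i)" for F :: "'v flag"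
  have "Max (t ` supp c) \<in> t ` supp c" using \<open>c \<noteq> 0\<close> by (intro Max_in) auto
  then obtain F where F: "F \<in> supp c" "t F = Max (t ` supp c)" by auto
  have max: "t G \<le> t F" if "G \<in> supp c" for G using F that by simp
  have complete: "G \<in> complete_flags V" if "G \<in> supp c" for G
    using that c by (auto simp: St_def top_chains_def)
  have dimV: "dim V = Suc n" using n ordered_basis_length[OF V] by simp
  have least: "u \<in> G ! t G" "t G \<le> n" "\<And>i. i < t G \<Longrightarrow> u \<notin> G ! i" if "G \<in> supp c" for G
    using u(2)[OF that] unfolding t_def by (auto intro: LeastI Least_le dest: not_less_Least)
  have start: "G ! 0 = {0}" if "G \<in> supp c" for G
    using complete[OF that] by (auto simp: complete_flags_def is_flag_def hd_conv_nth)
  define s where "s = t F - 1"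
  have "t F \<noteq> 0" using least(1)[OF F(1)] start[OF F(1)] u(1) by (metis singletonD)
  then have tF: "t F = Suc s" by (simp add: s_def)
  \<comment> \<open>The member at which \<open>u\<close> enters is determined by its predecessor, as
    the dimension grows by one.\<close>
  have step: "G ! Suc s = span (insert u (G ! s))"
    if G: "G \<in> supp c" "u \<in> G ! Suc s" "u \<notin> G ! s" for G
  proof -
    obtain vs where vs: "ordered_basis V vs" "flag_of vs = G"
      using complete_flag_basis[OF V complete[OF G(1)]] .
    then show ?thesis
      using flag_of_Suc_eq_span_insert[of s vs u] G least(2)[OF F(1)] tF dimV ordered_basis_length[OF vs(1)] by auto
  qed
  have "G = F" if G: "G \<in> supp c" "omit (Suc s) G = omit (Suc s) F" for G
  proof -
    have len: "length G = Suc (Suc n)" "length F = Suc (Suc n)"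
      using complete[OF G(1)] complete[OF F(1)] dimV by (auto simp: complete_flags_def)
    have s: "Suc s \<le> n" using least(2)[OF F(1)] tF by simp
    have eq: "G ! i = F ! i" if "i < Suc (Suc n)" "i \<noteq> Suc s" for i
      using omit_eq_nthD[OF G(2)] that len s by simp
    have notin: "u \<notin> G ! i" if "i < Suc s" for i
      using least(3)[OF F(1), of i] that eq[of i] tF s by simp
    \<comment> \<open>Below \<open>Suc s\<close> the flag \<open>G\<close> agrees with
      \<open>F\<close> and misses \<open>u\<close>; maximality of \<open>t F\<close> forbids it to
      reach \<open>u\<close> after \<open>Suc s\<close>.\<close>
    have "u \<in> G ! Suc s"
    proof (rule ccontr)
      assume "u \<notin> G ! Suc s"
      then have "u \<notin> G ! i" if "i \<le> Suc s" for i using notin that by (cases "i = Suc s") auto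
      then show False using least(1)[OF G(1)] max[OF G(1)] tF by auto
    qed
    then have "G ! Suc s = F ! Suc s"
      using step[OF G(1)] step[OF F(1)] notin[of s] eq[of s] least(1,3)[OF F(1)] tF s by auto
    then have "G ! i = F ! i" if "i < Suc (Suc n)" for i
      using eq that by (cases "i = Suc s") auto
    then show ?thesis using len by (intro nth_equalityI) auto
  qed
  then have "{G. G \<in> supp c \<and> omit (Suc s) G = omit (Suc s) F} = {F}" using F by auto
  then have "coeff c F = 0"
    using St_panel_sum[OF V c complete[OF F(1)], of "Suc s"] least(2)[OF F(1)] tF dimV by simp
  then show False using F by (simp add: in_keys_iff)
qed

section \<open>Spanning by apartments through a given flag, by induction on the dimension\<close>

lemma flag_of_Cons_cong:
  assumes "flag_of vs = flag_of ws"
  shows "flag_of (u # vs) = flag_of (u # ws)"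
proof -
  have len: "length vs = length ws" using arg_cong[OF assms, of length] by simp
  have "span (set (take i (u # vs))) = span (set (take i (u # ws)))" if "i \<le> Suc (length vs)" for i
    using that assms len by (cases i) (auto simp: flag_of_eq_iff span_insert)
  then show ?thesis using len by (simp add: flag_of_eq_iff)
qed

text \<open>V is the sum of \<open>H\<close> and the line of \<open>u\<close>, so each vector of
  \<open>es\<close> can be moved into \<open>H\<close> by subtracting a multiple of
  \<open>u\<close>. This does not affect a flag that starts with \<open>u\<close>.\<close>

lemma ex_hyperplane_basis:
  assumes V: "ordered_basis V (u # es)" and H: "ordered_basis H ws" "H \<subseteq> V"
    and len: "length ws = length es" and u: "u \<notin> H"
  obtains hs where "ordered_basis H hs" "flag_of (u # hs) = flag_of (u # es)"
proof -
  have uws: "ordered_basis V (u # ws)"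
  proof (rule ordered_basis_of_independent[OF V])
    show "set (u # ws) \<subseteq> V"
      using ordered_basis_subset[OF V] ordered_basis_subset[OF H(1)] H(2) by auto
    have "u \<notin> span (set ws)" using u ordered_basis_span[OF H(1)] by simp
    then show "distinct (u # ws)" "independent (set (u # ws))"
      using H(1) span_base[of u "set ws"] independent_insertI[of u "set ws"]
      by (auto simp: ordered_basis_def)
  qed (use len in simp)
  have "\<exists>k. e - scale k u \<in> H" if "e \<in> V" for e
    using that ordered_basis_span[OF uws] ordered_basis_span[OF H(1)] by (auto simp: span_breakdown_eq)
  then obtain k where k: "e - scale (k e) u \<in> H" if "e \<in> V" for e by metis
  define h where "h e = e - scale (k e) u" for e
  define hs where "hs = map h es"
  have span_h: "span (insert u (h ` S)) = span (insert u S)" for S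
  proof (intro subset_antisym span_minimal subspace_span)
    show "insert u (h ` S) \<subseteq> span (insert u S)"
      by (auto simp: h_def intro!: span_diff span_scale intro: span_base)
    show "insert u S \<subseteq> span (insert u (h ` S))"
    proof
      fix e assume e: "e \<in> insert u S"
      show "e \<in> span (insert u (h ` S))"
      proof (cases "e = u")
        case False
        then have "h e + scale (k e) u \<in> span (insert u (h ` S))"
          using e by (intro span_add span_scale) (auto intro: span_base)
        then show ?thesis by (simp add: h_def)
      qed (simp add: span_base)
    qed
  qed
  have flag: "flag_of (u # hs) = flag_of (u # es)"
  proof -
    have "span (set (take i (u # hs))) = span (set (take i (u # es)))" for i
      by (cases i) (simp_all add: hs_def take_map span_h)
    then show ?thesis by (subst flag_of_eq_iff) (simp_all add: hs_def)
  qed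
  have "ordered_basis V (u # hs)"
    using ordered_basis_span[OF V] by (intro ordered_basis_of_spanning[OF V]) (simp_all add: hs_def span_h)
  then have "distinct hs" "independent (set hs)"
    using independent_mono[of "insert u (set hs)" "set hs"] by (auto simp: ordered_basis_def)
  moreover have "set hs \<subseteq> H"
    using k ordered_basis_subset[OF V] by (auto simp: hs_def h_def)
  ultimately have "ordered_basis H hs"
    using len by (intro ordered_basis_of_independent[OF H(1)]) (simp_all add: hs_def)
  then show ?thesis using that flag by blast
qed

lemma apartment_mset_eq:
  assumes "mset vs = mset ws"
  obtains q where "apartment vs = qscale q (apartment ws)"
  using mset_eq_permutation[OF assms] apartment_permute by metis

theorem solomon_tits:
  assumes "ordered_basis V es" "c \<in> St V"
  shows "c \<in> rat_space.span {apartment vs | vs. ordered_basis V vs \<and> flag_of vs = flag_of es}"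
  using assms
proof (induction "length es" arbitrary: V es c)
  case 0
  then have V: "V = {0}" "es = []" by (auto simp: ordered_basis_def)
  have "F = [{0}]" if "F \<in> supp c" for F
    using that 0 ordered_basis_length[OF 0(2)]
    by (auto simp: St_def top_chains_def complete_flags_def is_flag_def length_Suc_conv V)
  then have "bvec ` supp c \<subseteq> {apartment []}" by (auto simp: apartment_Nil)
  then have "c \<in> rat_space.span {apartment []}" using span_bvec rat_space.span_mono by blast
  moreover have "{apartment []} \<subseteq> {apartment vs | vs. ordered_basis V vs \<and> flag_of vs = flag_of es}"
    using 0(2) V by auto
  ultimately show ?case using rat_space.span_mono by blast
next
  case (Suc n)
  obtain u es' where es: "es = u # es'" using Suc(2) by (cases es) auto
  have n: "length es = Suc n" "length es' = n" using Suc(2) es by auto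
  have V: "ordered_basis V (u # es')" using Suc(3) es by simp
  have dimV: "dim V = Suc n" using n ordered_basis_length[OF Suc(3)] by simp
  define A where "A = {apartment vs | vs. ordered_basis V vs \<and> flag_of vs = flag_of es}"
  have A_St: "rat_space.span A \<subseteq> St V"
    by (intro rat_space.span_minimal subspace_St) (auto simp: A_def apartment_in_St)
  have top: "F \<in> complete_flags V" if "F \<in> supp c" for F
    using that Suc(4) by (auto simp: St_def top_chains_def)
  define hyps where "hyps = {F ! n | F. F \<in> supp c \<and> u \<notin> F ! n}"
  have "finite hyps" by (simp add: hyps_def)
  \<comment> \<open>The correction for one hyperplane has no part at any other hyperplane missing
    \<open>u\<close>, so the corrections for all of \<open>hyps\<close> can be subtracted
    simultaneously.\<close>
  have "\<exists>y\<in>rat_space.span A. hyperplane_part H y = hyperplane_part H c \<and>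
      (\<forall>H'. u \<notin> H' \<longrightarrow> H' \<noteq> H \<longrightarrow> hyperplane_part H' y = 0)" if "H \<in> hyps" for H
  proof -
    obtain F where F: "F \<in> supp c" "H = F ! n" "u \<notin> H" using \<open>H \<in> hyps\<close> by (auto simp: hyps_def)
    obtain vs where vs: "ordered_basis V vs" "flag_of vs = F" using complete_flag_basis[OF V top[OF F(1)]] .
    have lvs: "length vs = Suc n" using ordered_basis_length[OF vs(1)] dimV by simp
    define ws where "ws = take n vs"
    have ws: "ordered_basis H ws" "length ws = n"
      using vs F lvs independent_mono[of "set vs" "set (take n vs)"] set_take_subset[of n vs]
      by (auto simp: ordered_basis_def ws_def flag_of_nth)
    have HV: "H \<subseteq> V"
      using ordered_basis_span[OF ws(1)] ordered_basis_span[OF vs(1)] span_mono[OF set_take_subset[of n vs]]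
      by (simp add: ws_def)
    have dimH: "dim H = n" using ws ordered_basis_length by metis
    \<comment> \<open>The induction hypothesis in \<open>H\<close> is used along the projection of
      \<open>es'\<close> from \<open>u\<close>, so that putting \<open>u\<close> in front of its
      apartments leads back to the flag of \<open>es\<close>.\<close>
    obtain hs where hs: "ordered_basis H hs" "flag_of (u # hs) = flag_of (u # es')"
      using ex_hyperplane_basis[OF V ws(1) HV _ F(3)] ws n by metis
    have lhs: "n = length hs" using hs ordered_basis_length dimH by metis
    have "\<exists>y\<in>rat_space.span A. hyperplane_part H y = z \<and>
        (\<forall>H'. u \<notin> H' \<longrightarrow> H' \<noteq> H \<longrightarrow> hyperplane_part H' y = 0)"
      if "z \<in> rat_space.span {apartment ws | ws. ordered_basis H ws \<and> flag_of ws = flag_of hs}" for z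
      using that
    proof (induction rule: rat_space.span_induct_alt)
      case base
      show ?case
        by (intro bexI[of _ 0]) (auto simp: qlin_simps[OF qlinear_hyperplane_part] rat_space.span_zero)
    next
      case (step q z z')
      obtain ws where ws: "z = apartment ws" "ordered_basis H ws" "flag_of ws = flag_of hs"
        using step by blast
      obtain y' where y': "y' \<in> rat_space.span A" "hyperplane_part H y' = z'"
        "\<And>H'. u \<notin> H' \<Longrightarrow> H' \<noteq> H \<Longrightarrow> hyperplane_part H' y' = 0" using step by blast
      have u: "u \<notin> span (set ws)" using F ordered_basis_span[OF ws(2)] by simp
      have lws: "length ws = n" using ws ordered_basis_length dimH by metis
      have "ordered_basis V (u # ws)"
      proof (rule ordered_basis_of_independent[OF V])
        show "set (u # ws) \<subseteq> V"
          using ordered_basis_subset[OF V] ordered_basis_subset[OF ws(2)] HV by auto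
        show "distinct (u # ws)" "independent (set (u # ws))"
          using ws(2) span_base[of u "set ws"] u independent_insertI[of u "set ws"]
          by (auto simp: ordered_basis_def)
      qed (use lws n in simp)
      moreover have "flag_of (u # ws) = flag_of es"
        using flag_of_Cons_cong[OF ws(3), of u] hs es by simp
      ultimately have "apartment (u # ws) \<in> rat_space.span A"
        by (intro rat_space.span_base) (auto simp: A_def)
      \<comment> \<open>With \<open>u\<close> last the part at \<open>H\<close> is known, with
        \<open>u\<close> first the apartment passes through the flag of \<open>es\<close>; the two
        differ by a scalar only.\<close>
      moreover obtain r where "apartment (ws @ [u]) = qscale r (apartment (u # ws))"
        by (rule apartment_mset_eq[of "ws @ [u]" "u # ws"]) auto
      ultimately have "apartment (ws @ [u]) \<in> rat_space.span A" by (simp add: rat_space.span_scale)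
      then show ?case
        using y' F ws u ordered_basis_span[OF ws(2)]
        by (intro bexI[of _ "qscale q (apartment (ws @ [u])) + y'"] conjI allI impI)
          (auto simp: qlin_simps[OF qlinear_hyperplane_part] hyperplane_part_apartment
            rat_space.span_add rat_space.span_scale)
    qed
    moreover have "hyperplane_part H c \<in> rat_space.span {apartment ws | ws. ordered_basis H ws \<and> flag_of ws = flag_of hs}"
      using Suc(1)[OF lhs hs(1)] hyperplane_part_St[OF Suc(3) n(1) dimH Suc(4)] by simp
    ultimately show ?thesis by blast
  qed
  then obtain y where y: "\<And>H. H \<in> hyps \<Longrightarrow> y H \<in> rat_space.span A"
    "\<And>H. H \<in> hyps \<Longrightarrow> hyperplane_part H (y H) = hyperplane_part H c"
    "\<And>H H'. H \<in> hyps \<Longrightarrow> u \<notin> H' \<Longrightarrow> H' \<noteq> H \<Longrightarrow> hyperplane_part H' (y H) = 0" by metis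
  define c' where "c' = c - (\<Sum>H\<in>hyps. y H)"
  have y_sum: "(\<Sum>H\<in>hyps. y H) \<in> rat_space.span A" using y by (intro rat_space.span_sum) auto
  then have c': "c' \<in> St V" unfolding c'_def using A_St Suc(4) subspace_St rat_space.subspace_diff by blast
  have part: "hyperplane_part H c' = 0" if H: "u \<notin> H" for H
  proof -
    have "(\<Sum>H'\<in>hyps. hyperplane_part H (y H')) = (\<Sum>H'\<in>hyps. if H' = H then hyperplane_part H c else 0)"
      using y H by (intro sum.cong) auto
    also have "\<dots> = hyperplane_part H c"
    proof (cases "H \<in> hyps")
      case False
      have "last (butlast F) \<noteq> H" if "F \<in> supp c" for F
        using top[OF that] dimV False H that last_butlast_nth[of F n] by (auto simp: hyps_def complete_flags_def)
      then have "hyperplane_part H c = 0"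
        unfolding hyperplane_part_def lin_ext_def by (intro sum.neutral) auto
      then show ?thesis by (simp cong: if_cong)
    qed (use \<open>finite hyps\<close> in simp)
    finally show ?thesis by (simp add: c'_def qlin_simps[OF qlinear_hyperplane_part])
  qed
  have "u \<in> F ! n" if "F \<in> supp c'" for F
  proof (rule ccontr)
    assume u: "u \<notin> F ! n"
    have F: "F \<in> complete_flags V" using that c' by (auto simp: St_def top_chains_def)
    then have "last (butlast F) = F ! n" using dimV by (intro last_butlast_nth) (simp add: complete_flags_def)
    then have "coeff c' F = 0"
      using coeff_hyperplane_part[OF dimV _ F, of c'] c' part[OF u] by (simp add: St_def)
    then show False using that by (simp add: in_keys_iff)
  qed
  moreover have "u \<noteq> 0" using V dependent_zero by (auto simp: ordered_basis_def)
  ultimately have "c' = 0" using St_eq_0_if_hyperplanes_contain[OF Suc(3) n(1) c'] by blast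
  then show ?case using y_sum by (simp add: c'_def A_def)
qed

section \<open>The bar complex in top degree\<close>

text \<open>The only key in the support of a top-degree symbol: a line has a single complete flag.
  It records the lines and forgets the chosen vectors.\<close>

definition bar_key :: "'v list \<Rightarrow> 'v flag list" where
  "bar_key vs = map (\<lambda>v. [{0}, span {v}]) vs"

lemma length_bar_key [simp]: "length (bar_key vs) = length vs"
  by (simp add: bar_key_def)

lemma bar_key_eq_iff: "bar_key vs = bar_key ws \<longleftrightarrow> map (\<lambda>v. span {v}) vs = map (\<lambda>v. span {v}) ws"
proof -
  have "bar_key us = map (\<lambda>W. [{0}, W]) (map (\<lambda>v. span {v}) us)" for us by (simp add: bar_key_def)
  moreover have "inj (\<lambda>W. [{0 :: 'v}, W])" by (simp add: inj_def)
  ultimately show ?thesis by (simp only: inj_map_eq_map)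
qed

lemma bar_basis_eq_bvec: "bar_basis vs = bvec (bar_key vs)"
proof -
  have "map (\<lambda>v. apartment [v]) vs = map bvec (bar_key vs)"
    by (simp add: bar_key_def apartment_singleton)
  then show ?thesis by (simp add: bar_basis_def tensor_list_bvec)
qed

lemma ordered_basis_nonzero: "ordered_basis V vs \<Longrightarrow> v \<in> set vs \<Longrightarrow> v \<noteq> 0"
  using dependent_zero by (auto simp: ordered_basis_def)

lemma St_line:
  assumes v: "v \<noteq> 0" and c: "c \<in> St (span {v})"
  obtains q where "c = qscale q (apartment [v])"
proof -
  have "apartment ws = apartment [v]" if "ordered_basis (span {v}) ws" for ws
  proof -
    have "length ws = 1"
      using ordered_basis_length[OF that] ordered_basis_length[OF ordered_basis_singleton[OF v]] by simp
    then obtain x where x: "ws = [x]" by (auto simp: length_Suc_conv)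
    then have "span {x} = span {v}" using ordered_basis_span[OF that] by simp
    then show ?thesis using x by (simp add: apartment_singleton)
  qed
  then have "{apartment ws | ws. ordered_basis (span {v}) ws \<and> flag_of ws = flag_of [v]} \<subseteq> {apartment [v]}"
    by blast
  then have "c \<in> rat_space.span {apartment [v]}"
    using solomon_tits[OF ordered_basis_singleton[OF v] c] rat_space.span_mono by blast
  then show ?thesis using that by (auto simp: rat_space.span_singleton)
qed

text \<open>A decomposition into dim V nonzero summands consists of lines, and \<open>St\<close> of
  a line is one-dimensional. The scalars are kept apart in \<open>qs\<close>, as the boundary
  formula has to be checked on arbitrary symbols.\<close>

lemma bar_symbols_top:
  assumes V: "ordered_basis V es" and sym: "(Vs, xs) \<in> bar_symbols (dim V) V"
  obtains vs qs where "ordered_basis V vs" "Vs = map (\<lambda>v. span {v}) vs" "length qs = length vs"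
    "xs = map2 qscale qs (map (\<lambda>v. apartment [v]) vs)"
proof -
  have Vs: "length Vs = dim V" "direct_sum V Vs" "{0} \<notin> set Vs" "list_all2 (\<lambda>a W. a \<in> St W) xs Vs"
    using sym by (auto simp: bar_symbols_def)
  obtain vs where vs: "ordered_basis V vs" "Vs = map (\<lambda>v. span {v}) vs"
    using direct_sum_eq_lines[OF V Vs(2,3,1)] .
  have len: "length xs = length vs" using Vs(4) vs by (auto dest: list_all2_lengthD)
  have "\<exists>q. xs ! i = qscale q (apartment [vs ! i])" if "i < length vs" for i
    using Vs(4) vs that len ordered_basis_nonzero[OF vs(1), of "vs ! i"] St_line[of "vs ! i" "xs ! i"]
    by (metis list_all2_nthD2 length_map nth_map nth_mem)
  then obtain q where q: "\<And>i. i < length vs \<Longrightarrow> xs ! i = qscale (q i) (apartment [vs ! i])" by metis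
  have "xs = map2 qscale (map q [0..<length vs]) (map (\<lambda>v. apartment [v]) vs)"
    using q len by (intro nth_equalityI) auto
  then show ?thesis using that vs by (metis length_map length_upt minus_nat.diff_0)
qed

lemma bar_symbols_lines:
  assumes "ordered_basis V vs"
  shows "(map (\<lambda>v. span {v}) vs, map (\<lambda>v. apartment [v]) vs) \<in> bar_symbols (dim V) V"
proof -
  have "span {v} \<noteq> {0}" if "v \<in> set vs" for v
    using ordered_basis_nonzero[OF assms that] span_base[of v "{v}"] by auto
  moreover have "apartment [v] \<in> St (span {v})" if "v \<in> set vs" for v
    using ordered_basis_nonzero[OF assms that] by (intro apartment_in_St ordered_basis_singleton)
  ultimately show ?thesis
    using direct_sum_lines[OF assms] ordered_basis_length[OF assms]
    by (auto simp: bar_symbols_def list_all2_conv_all_nth)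
qed

lemma bar_top_eq_span:
  assumes V: "ordered_basis V es"
  shows "bar (dim V) V = rat_space.span {bar_basis vs | vs. ordered_basis V vs}"
proof
  show "bar (dim V) V \<subseteq> rat_space.span {bar_basis vs | vs. ordered_basis V vs}"
    unfolding bar_def
  proof (intro rat_space.span_minimal rat_space.subspace_span, clarify)
    fix Vs and xs :: "'v chain list" assume sym: "(Vs, xs) \<in> bar_symbols (dim V) V"
    obtain vs qs where *: "ordered_basis V vs" "length qs = length vs"
      "xs = map2 qscale qs (map (\<lambda>v. apartment [v]) vs)"
      using bar_symbols_top[OF V sym] by metis
    then have "tensor_list xs = qscale (prod_list qs) (bar_basis vs)"
      by (simp add: tensor_list_map2_qscale bar_basis_def)
    moreover have "bar_basis vs \<in> rat_space.span {bar_basis vs | vs. ordered_basis V vs}"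
      using * by (intro rat_space.span_base) blast
    ultimately show "tensor_list xs \<in> rat_space.span {bar_basis vs | vs. ordered_basis V vs}"
      by (simp only: rat_space.span_scale)
  qed
  show "rat_space.span {bar_basis vs | vs. ordered_basis V vs} \<subseteq> bar (dim V) V"
    unfolding bar_def bar_basis_def using bar_symbols_lines by (intro rat_space.span_mono) blast
qed

text \<open>The unsigned face of [v_0|...|v_(d-1)] that multiplies the entries at \<open>j\<close>
  and \<open>Suc j\<close>, counted from 0.\<close>

definition bar_face :: "nat \<Rightarrow> 'v list \<Rightarrow> 'v bar_chain" where
  "bar_face j vs = tensor_list (map (\<lambda>v. apartment [v]) (take j vs) @ apartment [vs ! j, vs ! Suc j]
     # map (\<lambda>v. apartment [v]) (drop (Suc (Suc j)) vs))"

lemma bar_face_lines: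
  assumes "bar_key vs = bar_key ws" "Suc j < length vs"
  shows "bar_face j vs = bar_face j ws"
proof -
  have eq: "map (\<lambda>v. span {v}) vs = map (\<lambda>v. span {v}) ws" using assms bar_key_eq_iff by blast
  have len: "length vs = length ws" using assms by (metis length_bar_key)
  have nth: "span {vs ! i} = span {ws ! i}" if "i < length vs" for i
    using eq len that by (metis nth_map)
  have "map (\<lambda>v. apartment [v]) vs = map (\<lambda>v. apartment [v]) ws"
    using nth len by (auto simp: list_eq_iff_nth_eq apartment_singleton)
  moreover have "apartment [vs ! j, vs ! Suc j] = apartment [ws ! j, ws ! Suc j]"
    using nth[of j] nth[of "Suc j"] assms by (intro apartment_lines) simp
  ultimately show ?thesis unfolding bar_face_def take_map[symmetric] drop_map[symmetric] by simp
qed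

text \<open>The single faces as linear maps on chains. \<open>bar_boundary\<close> provides only
  their alternating sum, whereas cycles will be recognised face by face.\<close>

lemma ex_bar_face_map:
  "\<exists>\<phi>. qlinear \<phi> \<and> (\<forall>vs. ordered_basis V vs \<and> Suc j < length vs \<longrightarrow> \<phi> (bar_basis vs) = bar_face j vs)"
proof -
  have "\<exists>\<phi>. qlinear \<phi> \<and> (\<forall>vs\<in>{vs. ordered_basis V vs \<and> Suc j < length vs}. \<phi> (bvec (bar_key vs)) = bar_face j vs)"
    by (rule ex_qlinear_on_bvec) (auto intro: bar_face_lines)
  then show ?thesis by (simp add: bar_basis_eq_bvec)
qed

text \<open>A map with the right values on the basis symbols exists because faces depend only on the
  lines. It is right on every symbol, since the entry scalars multiply each face and the symbol
  itself by the same product.\<close>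

lemma bar_boundary_spec:
  assumes V: "ordered_basis V es"
  shows "qlinear (bar_boundary (dim V) V) \<and> (\<forall>(Vs, as) \<in> bar_symbols (dim V) V.
      bar_boundary (dim V) V (tensor_list as) =
        (\<Sum>j<dim V - 1. qscale ((-1) ^ j) (tensor_list
           (take j as @ St_mult (Vs ! j) (Vs ! Suc j) (as ! j \<otimes>\<^sub>Q as ! Suc j)
              # drop (Suc (Suc j)) as))))"
proof -
  let ?f = "\<lambda>vs. \<Sum>j<dim V - 1. qscale ((-1) ^ j) (bar_face j vs)"
  have "?f vs = ?f ws" if "ordered_basis V vs" "ordered_basis V ws" "bar_key vs = bar_key ws" for vs ws
    using that ordered_basis_length[OF that(1)]
    by (intro sum.cong refl arg_cong[of _ _ "qscale _"] bar_face_lines) auto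
  then have "\<exists>D. qlinear D \<and> (\<forall>vs\<in>{vs. ordered_basis V vs}. D (bvec (bar_key vs)) = ?f vs)"
    by (intro ex_qlinear_on_bvec) blast
  then obtain D where D: "qlinear D" "\<And>vs. ordered_basis V vs \<Longrightarrow> D (bar_basis vs) = ?f vs"
    unfolding bar_basis_eq_bvec by blast
  have "D (tensor_list xs) = (\<Sum>j<dim V - 1. qscale ((-1) ^ j) (tensor_list
           (take j xs @ St_mult (Vs ! j) (Vs ! Suc j) (xs ! j \<otimes>\<^sub>Q xs ! Suc j) # drop (Suc (Suc j)) xs)))"
    if sym: "(Vs, xs) \<in> bar_symbols (dim V) V" for Vs xs
  proof -
    obtain vs qs where vs: "ordered_basis V vs" "Vs = map (\<lambda>v. span {v}) vs" and qs: "length qs = length vs"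
      and xs: "xs = map2 qscale qs (map (\<lambda>v. apartment [v]) vs)"
      using bar_symbols_top[OF V sym] .
    have len: "length vs = dim V" using ordered_basis_length[OF vs(1)] .
    have "tensor_list (take j xs @ St_mult (Vs ! j) (Vs ! Suc j) (xs ! j \<otimes>\<^sub>Q xs ! Suc j) # drop (Suc (Suc j)) xs) =
        qscale (prod_list qs) (bar_face j vs)" if j: "j < dim V - 1" for j
    proof -
      have j': "j < length vs" "Suc j < length vs" using j len by auto
      have nz: "vs ! j \<noteq> 0" "vs ! Suc j \<noteq> 0" using ordered_basis_nonzero[OF vs(1)] j' by auto
      have "St_mult (Vs ! j) (Vs ! Suc j) (xs ! j \<otimes>\<^sub>Q xs ! Suc j) =
          qscale (qs ! j * qs ! Suc j) (apartment [vs ! j, vs ! Suc j])"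
        using j' qs vs xs St_mult_apartment[OF ordered_basis_singleton[OF nz(1)] ordered_basis_singleton[OF nz(2)]]
        by (simp add: tensor_scale_left tensor_scale_right qlin_simps[OF qlinear_St_mult])
      \<comment> \<open>The face has one slot fewer: the scalars at \<open>j\<close> and
        \<open>Suc j\<close> merge into their product, so the total product is unchanged.\<close>
      then have "take j xs @ St_mult (Vs ! j) (Vs ! Suc j) (xs ! j \<otimes>\<^sub>Q xs ! Suc j) # drop (Suc (Suc j)) xs =
          map2 qscale (take j qs @ (qs ! j * qs ! Suc j) # drop (Suc (Suc j)) qs)
            (map (\<lambda>v. apartment [v]) (take j vs) @ apartment [vs ! j, vs ! Suc j]
              # map (\<lambda>v. apartment [v]) (drop (Suc (Suc j)) vs))"
        using xs qs j' by (simp add: take_map drop_map take_zip drop_zip)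
      moreover have "prod_list qs = prod_list (take j qs @ (qs ! j * qs ! Suc j) # drop (Suc (Suc j)) qs)"
      proof -
        have "qs = take j qs @ qs ! j # qs ! Suc j # drop (Suc (Suc j)) qs"
          using j' qs by (metis Cons_nth_drop_Suc id_take_nth_drop)
        then have "prod_list qs = prod_list (take j qs @ qs ! j # qs ! Suc j # drop (Suc (Suc j)) qs)" by simp
        then show ?thesis by (simp add: mult.assoc)
      qed
      ultimately show ?thesis
        using j' qs by (simp add: bar_face_def tensor_list_map2_qscale del: zip_append zip_Cons_Cons prod_list.append)
    qed
    moreover have "tensor_list xs = qscale (prod_list qs) (bar_basis vs)"
      using xs qs by (simp add: tensor_list_map2_qscale bar_basis_def)
    ultimately show ?thesis
      using D(2)[OF vs(1)] by (simp add: qlin_simps[OF D(1)] rat_space.scale_sum_right mult.commute)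
  qed
  then have "\<exists>D. qlinear D \<and> (\<forall>(Vs, as) \<in> bar_symbols (dim V) V. D (tensor_list as) =
        (\<Sum>j<dim V - 1. qscale ((-1) ^ j) (tensor_list
           (take j as @ St_mult (Vs ! j) (Vs ! Suc j) (as ! j \<otimes>\<^sub>Q as ! Suc j)
              # drop (Suc (Suc j)) as))))" using D(1) by blast
  then show ?thesis unfolding bar_boundary_def by (rule someI_ex)
qed

lemma bar_boundary_basis:
  assumes vs: "ordered_basis V vs"
  shows "bar_boundary (dim V) V (bar_basis vs) = (\<Sum>j<dim V - 1. qscale ((-1) ^ j) (bar_face j vs))"
proof -
  have len: "length vs = dim V" using ordered_basis_length[OF vs] .
  have "tensor_list (take j xs @ St_mult (Vs ! j) (Vs ! Suc j) (xs ! j \<otimes>\<^sub>Q xs ! Suc j) # drop (Suc (Suc j)) xs) =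
      bar_face j vs" if j: "j < dim V - 1" and "Vs = map (\<lambda>v. span {v}) vs" "xs = map (\<lambda>v. apartment [v]) vs" for j Vs xs
  proof -
    have j': "j < length vs" "Suc j < length vs" using j len by auto
    have nz: "vs ! j \<noteq> 0" "vs ! Suc j \<noteq> 0" using ordered_basis_nonzero[OF vs] j' by auto
    show ?thesis
      using that j' St_mult_apartment[OF ordered_basis_singleton[OF nz(1)] ordered_basis_singleton[OF nz(2)]]
      by (simp add: bar_face_def take_map drop_map)
  qed
  then show ?thesis
    using bspec[OF bar_boundary_spec[OF vs, THEN conjunct2] bar_symbols_lines[OF vs]]
    unfolding bar_basis_def by simp
qed

section \<open>The isomorphism \<open>\<beta>\<close>\<close>

lemma beta_spec:
  "qlinear (beta V) \<and> (\<forall>vs. ordered_basis V vs \<longrightarrow>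
     beta V (bar_basis vs) = bvec (flag_of vs) \<otimes>\<^sub>Q apartment vs)"
proof -
  have "bvec (flag_of vs) \<otimes>\<^sub>Q apartment vs = bvec (flag_of ws) \<otimes>\<^sub>Q apartment ws"
    if "bar_key vs = bar_key ws" for vs ws
    using that flag_of_lines apartment_lines unfolding bar_key_eq_iff by metis
  then have "\<exists>\<beta>. qlinear \<beta> \<and> (\<forall>vs\<in>{vs. ordered_basis V vs}.
     \<beta> (bvec (bar_key vs)) = bvec (flag_of vs) \<otimes>\<^sub>Q apartment vs)"
    by (intro ex_qlinear_on_bvec) blast
  then have "\<exists>\<beta>. qlinear \<beta> \<and> (\<forall>vs. ordered_basis V vs \<longrightarrow>
     \<beta> (bar_basis vs) = Poly_Mapping.single (flag_of vs) 1 \<otimes>\<^sub>Q apartment vs)"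
    unfolding bar_basis_eq_bvec by blast
  then show ?thesis unfolding beta_def by (rule someI_ex)
qed

lemmas qlinear_beta = beta_spec[THEN conjunct1]

lemma beta_basis: "ordered_basis V vs \<Longrightarrow> beta V (bar_basis vs) = bvec (flag_of vs) \<otimes>\<^sub>Q apartment vs"
  using beta_spec by blast

section \<open>Opposite flags and the injectivity of \<open>beta\<close>\<close>

lemma span_Int_independent:
  assumes "independent C" "A \<subseteq> C" "B \<subseteq> C"
  shows "span A \<inter> span B \<subseteq> span (A \<inter> B)"
proof
  fix x assume x: "x \<in> span A \<inter> span B"
  have C: "x \<in> span C" using x span_mono[OF assms(2)] by auto
  have "representation C x = representation A x" "representation C x = representation B x"
    using x assms by (auto intro: representation_extend)
  then have "b \<in> A \<inter> B" if "representation C x b \<noteq> 0" for b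
    using that representation_ne_zero[of A x b] representation_ne_zero[of B x b] by simp
  then have "(\<Sum>b | representation C x b \<noteq> 0. scale (representation C x b) b) \<in> span (A \<inter> B)"
    by (intro span_sum span_scale span_base) auto
  then show "x \<in> span (A \<inter> B)"
    using sum_nonzero_representation_eq[OF assms(1) C] by simp
qed

definition reversal :: "nat \<Rightarrow> nat \<Rightarrow> nat" where
  "reversal d i = (if i < d then d - 1 - i else i)"

lemma reversal_permutes: "reversal d permutes {..<d}"
  by (rule bij_imp_permutes) (auto simp: reversal_def intro!: bij_betw_byWitness[where f' = "reversal d"])

lemma permute_list_reversal: "permute_list (reversal (length xs)) xs = rev xs"
  by (rule nth_equalityI) (simp_all add: permute_list_nth reversal_permutes rev_nth, simp add: reversal_def)

text \<open>The chamber of \<open>rev vs\<close> is opposite to that of \<open>vs\<close>, so among the apartments through the latter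
  it lies only in that of \<open>vs\<close>.\<close>

lemma opposite_flag_unique:
  assumes vs: "ordered_basis V vs" and ws: "ordered_basis V ws" and flag: "flag_of ws = flag_of vs"
    and \<sigma>: "\<sigma> permutes {..<length ws}" and opp: "flag_of (permute_list \<sigma> ws) = flag_of (rev vs)"
  shows "\<sigma> = reversal (length vs) \<and> bar_key ws = bar_key vs"
proof -
  define d where "d = length vs"
  have len: "length ws = d" "length vs = d"
    using vs ws by (simp_all add: d_def ordered_basis_length)
  have ind: "independent (set vs)" "distinct vs" using vs by (auto simp: ordered_basis_def)
  have lower: "span (set (take i ws)) = span (set (take i vs))" if "i \<le> d" for i
    using flag that len by (simp add: flag_of_eq_iff)
  have upper: "span (set (take i (permute_list \<sigma> ws))) = span (set (drop (d - i) vs))" if "i \<le> d" for i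
    using opp that len by (simp add: flag_of_eq_iff take_rev)
  have in_upper: "ws ! \<sigma> k \<in> span (set (drop (d - Suc k) vs))" if "k < d" for k
  proof -
    have "permute_list \<sigma> ws ! k \<in> set (take (Suc k) (permute_list \<sigma> ws))"
      using that len by (force simp: in_set_conv_nth)
    then show ?thesis
      using upper[of "Suc k"] that \<sigma> len span_base by (metis Suc_leI lessThan_iff permute_list_nth)
  qed
  have in_lower: "ws ! i \<in> span (set (take (Suc i) vs))" if "i < d" for i
  proof -
    have "ws ! i \<in> set (take (Suc i) ws)" using that len by (force simp: in_set_conv_nth)
    then show ?thesis using lower[of "Suc i"] that span_base by (metis Suc_leI)
  qed
  have inter: "span (set (take i vs)) \<inter> span (set (drop j vs)) \<subseteq> span (set (take i vs) \<inter> set (drop j vs))" for i j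
    using ind by (intro span_Int_independent) (auto dest: in_set_takeD in_set_dropD)
  have nz: "ws ! i \<noteq> 0" if "i < d" for i using ordered_basis_nonzero[OF ws, of "ws ! i"] that len by simp
  \<comment> \<open>\<open>ws ! \<sigma> k\<close> lies in the span of the last \<open>Suc k\<close>
    vectors of \<open>vs\<close> and in that of the first \<open>Suc (\<sigma> k)\<close>. For
    smaller \<sigma> k these are disjoint parts of a basis, whose spans meet in 0 only.\<close>
  have ge: "d - Suc k \<le> \<sigma> k" if k: "k < d" for k
  proof (rule ccontr)
    assume less: "\<not> d - Suc k \<le> \<sigma> k"
    have "\<sigma> k < d" using permutes_in_image[OF \<sigma>, of k] k len by simp
    have "span (set (take (Suc (\<sigma> k)) vs)) \<subseteq> span (set (take (d - Suc k) vs))"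
      using less by (intro span_mono set_take_subset_set_take) simp
    then have "ws ! \<sigma> k \<in> span (set (take (d - Suc k) vs) \<inter> set (drop (d - Suc k) vs))"
      using inter in_upper[OF k] in_lower[OF \<open>\<sigma> k < d\<close>] by blast
    then show False
      using nz[OF \<open>\<sigma> k < d\<close>] ind by (simp add: set_take_disj_set_drop_if_distinct)
  qed
  \<comment> \<open>The bound says that this permutation never decreases a number, which leaves only
    the identity.\<close>
  have "\<sigma> \<circ> reversal d permutes {..<d}"
    using \<sigma> len reversal_permutes by (simp add: permutes_compose)
  moreover have "i \<le> (\<sigma> \<circ> reversal d) i" if "i \<in> {..<d}" for i
    using ge[of "d - 1 - i"] that by (simp add: reversal_def)
  ultimately have id: "\<sigma> \<circ> reversal d = id" using permutes_natset_ge by blast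
  have "reversal d \<circ> reversal d = id" by (auto simp: reversal_def fun_eq_iff)
  then have \<sigma>_eq: "\<sigma> = reversal d" using id by (metis comp_id id_comp o_assoc)
  \<comment> \<open>With \<sigma> known, \<open>ws ! j\<close> lies in the span of the first
    \<open>Suc j\<close> vectors of \<open>vs\<close> and in that of the vectors from
    \<open>j\<close> on; the two meet in the line of \<open>vs ! j\<close>.\<close>
  have "span {ws ! j} = span {vs ! j}" if j: "j < d" for j
  proof -
    have "\<sigma> (d - Suc j) = j" "d - Suc (d - Suc j) = j" using j by (auto simp: \<sigma>_eq reversal_def)
    then have "ws ! j \<in> span (set (drop j vs))" using in_upper[of "d - Suc j"] j by simp
    then have "ws ! j \<in> span (set (take (Suc j) vs) \<inter> set (drop j vs))"
      using inter in_lower[OF j] by blast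
    moreover have "set (take (Suc j) vs) \<inter> set (drop j vs) \<subseteq> {vs ! j}"
    proof -
      have "set (take (Suc j) vs) = insert (vs ! j) (set (take j vs))"
        using j len by (simp add: take_Suc_conv_app_nth)
      then show ?thesis
        using set_take_disj_set_drop_if_distinct[OF ind(2), of j j] by auto
    qed
    ultimately have "ws ! j \<in> span {vs ! j}" using span_mono by blast
    then obtain k where k: "ws ! j = scale k (vs ! j)" by (auto simp: span_singleton)
    then have "k \<noteq> 0" using nz[OF j] by auto
    then have "vs ! j = scale (inverse k) (ws ! j)" using k by simp
    then have "vs ! j \<in> span {ws ! j}" by (metis insertI1 span_base span_scale)
    with \<open>ws ! j \<in> span {vs ! j}\<close> show ?thesis by (intro subset_antisym span_minimal) auto
  qed
  then have "bar_key ws = bar_key vs" using len by (auto simp: bar_key_def list_eq_iff_nth_eq)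
  then show ?thesis using \<sigma>_eq d_def by simp
qed

text \<open>Up to the sign of the longest permutation, an explicit left inverse of
  \<open>beta\<close>: the coefficient of a bar symbol is found at the pair of its flag and the
  opposite one.\<close>

lemma coeff_beta:
  assumes vs: "ordered_basis V vs" and x: "x \<in> bar (dim V) V"
  shows "coeff (beta V x) (flag_of vs, flag_of (rev vs)) =
    of_int (sign (reversal (length vs))) * coeff x (bar_key vs)"
  using x unfolding bar_top_eq_span[OF vs]
proof (induction rule: rat_space.span_induct_alt)
  case base
  then show ?case by (simp add: qlin_simps[OF qlinear_beta])
next
  case (step q y x)
  then obtain ws where ws: "y = bar_basis ws" "ordered_basis V ws" by blast
  have len: "length ws = length vs" using ws(2) vs by (simp add: ordered_basis_length)
  have "coeff (beta V (bar_basis ws)) (flag_of vs, flag_of (rev vs)) =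
      of_int (sign (reversal (length vs))) * coeff (bar_basis ws) (bar_key vs)"
  proof (cases "bar_key ws = bar_key vs")
    case True
    then have lines: "map (\<lambda>v. span {v}) ws = map (\<lambda>v. span {v}) vs" by (simp add: bar_key_eq_iff)
    then have flag: "flag_of ws = flag_of vs" and ap: "apartment ws = apartment vs"
      using flag_of_lines apartment_lines by blast+
    have "coeff (apartment vs) (flag_of (rev vs)) = (\<Sum>\<sigma> | \<sigma> permutes {..<length vs}.
        if \<sigma> = reversal (length vs) then of_int (sign (reversal (length vs))) else 0)"
      unfolding apartment_alt coeff_sum lookup_qscale coeff_bvec
    proof (intro sum.cong refl)
      fix \<sigma> assume \<sigma>: "\<sigma> \<in> {\<sigma>. \<sigma> permutes {..<length vs}}"
      have "flag_of (permute_list \<sigma> vs) = flag_of (rev vs) \<longleftrightarrow> \<sigma> = reversal (length vs)"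
      proof
        assume "flag_of (permute_list \<sigma> vs) = flag_of (rev vs)"
        then show "\<sigma> = reversal (length vs)"
          using opposite_flag_unique[OF vs vs refl, of \<sigma>] \<sigma> by simp
      next
        assume "\<sigma> = reversal (length vs)"
        then show "flag_of (permute_list \<sigma> vs) = flag_of (rev vs)" by (simp add: permute_list_reversal)
      qed
      then show "of_int (sign \<sigma>) * (if flag_of (permute_list \<sigma> vs) = flag_of (rev vs) then 1 else 0) =
          (if \<sigma> = reversal (length vs) then rat_of_int (sign (reversal (length vs))) else 0)"
        by simp
    qed
    then show ?thesis
      using True flag ap reversal_permutes
      unfolding beta_basis[OF ws(2)] unfolding bar_basis_eq_bvec coeff_tensor
      by (simp add: coeff_bvec finite_permutations)
  next
    case False
    have "coeff (apartment ws) (flag_of (rev vs)) = 0" if flag: "flag_of ws = flag_of vs"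
      unfolding apartment_alt coeff_sum lookup_qscale coeff_bvec
      using opposite_flag_unique[OF vs ws(2) flag] False by (intro sum.neutral) auto
    then show ?thesis
      using False unfolding beta_basis[OF ws(2)] unfolding bar_basis_eq_bvec coeff_tensor
      by (simp add: coeff_bvec)
  qed
  then show ?case
    using step ws by (simp add: qlin_simps[OF qlinear_beta] lookup_add lookup_qscale algebra_simps)
qed

lemma beta_inj:
  assumes V: "ordered_basis V es" and x: "x \<in> bar (dim V) V" "y \<in> bar (dim V) V" and eq: "beta V x = beta V y"
  shows "x = y"
proof -
  have keys: "supp z \<subseteq> {bar_key vs | vs. ordered_basis V vs}" if "z \<in> bar (dim V) V" for z
  proof -
    have "bar (dim V) V \<subseteq> {c. supp c \<subseteq> {bar_key vs | vs. ordered_basis V vs}}"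
      unfolding bar_top_eq_span[OF V]
      by (intro rat_space.span_minimal subspace_supp) (auto simp: bar_basis_eq_bvec)
    then show ?thesis using that by blast
  qed
  show ?thesis
  proof (rule poly_mapping_eqI)
    fix k show "coeff x k = coeff y k"
    proof (cases "k \<in> {bar_key vs | vs. ordered_basis V vs}")
      case True
      then obtain vs where vs: "k = bar_key vs" "ordered_basis V vs" by blast
      then show ?thesis using coeff_beta[OF vs(2) x(1)] coeff_beta[OF vs(2) x(2)] eq by simp
    next
      case False
      then have "k \<notin> supp x" "k \<notin> supp y" using keys x by blast+
      then show ?thesis by (simp add: in_keys_iff)
    qed
  qed
qed

section \<open>The shuffle product of bar symbols\<close>

lemma bar_shuffle_spec:
  "qlinear (bar_shuffle V1 V2) \<and> (\<forall>vs ws. ordered_basis V1 vs \<and> ordered_basis V2 ws \<longrightarrow>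
     bar_shuffle V1 V2 (bar_basis vs \<otimes>\<^sub>Q bar_basis ws) =
       (\<Sum>\<sigma>\<in>shuffle_perms (length vs) (length ws). bar_basis (permute_list \<sigma> (vs @ ws))))"
proof -
  let ?k = "\<lambda>(vs, ws). (bar_key vs, bar_key ws)"
  let ?f = "\<lambda>(vs, ws). \<Sum>\<sigma>\<in>shuffle_perms (length vs) (length ws). bar_basis (permute_list \<sigma> (vs @ ws))"
  have f: "?f (vs, ws) = (\<Sum>\<sigma>\<in>shuffle_perms (length (bar_key vs)) (length (bar_key ws)).
      bvec (permute_list \<sigma> (bar_key vs @ bar_key ws)))" for vs ws
  proof -
    have "bar_key (permute_list \<sigma> (vs @ ws)) = permute_list \<sigma> (bar_key vs @ bar_key ws)"
      if "\<sigma> \<in> shuffle_perms (length vs) (length ws)" for \<sigma>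
    proof -
      have "\<sigma> permutes {..<length (vs @ ws)}" using that by (simp add: shuffle_perms_def)
      then show ?thesis unfolding bar_key_def map_append[symmetric] by (rule permute_list_map[symmetric])
    qed
    then show ?thesis unfolding prod.case bar_basis_eq_bvec length_bar_key by (intro sum.cong refl) simp
  qed
  have "?f i = ?f j" if "?k i = ?k j" for i j
    using that by (cases i, cases j) (simp only: f prod.case prod.inject)
  then have "\<exists>\<mu>. qlinear \<mu> \<and> (\<forall>i\<in>UNIV. \<mu> (bvec (?k i)) = ?f i)"
    by (intro ex_qlinear_on_bvec)
  then have "\<exists>\<mu>. qlinear \<mu> \<and> (\<forall>vs ws. ordered_basis V1 vs \<and> ordered_basis V2 ws \<longrightarrow>
     \<mu> (bar_basis vs \<otimes>\<^sub>Q bar_basis ws) =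
       (\<Sum>\<sigma>\<in>shuffle_perms (length vs) (length ws). bar_basis (permute_list \<sigma> (vs @ ws))))"
    by (auto simp: bar_basis_eq_bvec tensor_single)
  then show ?thesis unfolding bar_shuffle_def by (rule someI_ex)
qed

lemmas qlinear_bar_shuffle = bar_shuffle_spec[THEN conjunct1]

lemma bar_shuffle_basis:
  "ordered_basis V1 vs \<Longrightarrow> ordered_basis V2 ws \<Longrightarrow> bar_shuffle V1 V2 (bar_basis vs \<otimes>\<^sub>Q bar_basis ws) =
    (\<Sum>\<sigma>\<in>shuffle_perms (length vs) (length ws). bar_basis (permute_list \<sigma> (vs @ ws)))"
  using bar_shuffle_spec by blast


section \<open>Cycles of the bar complex\<close>

lemma span_apartments:
  assumes V: "ordered_basis V es" and F: "F \<in> complete_flags V" and b: "b \<in> St V"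
  shows "b \<in> rat_space.span {apartment vs | vs. ordered_basis V vs \<and> flag_of vs = F}"
proof -
  obtain vs where "ordered_basis V vs" "flag_of vs = F" using complete_flag_basis[OF V F] .
  then show ?thesis using solomon_tits[of V vs b] b by simp
qed

lemma subspace_bar: "rat_space.subspace (bar m V)"
  unfolding bar_def by (rule rat_space.subspace_span)

lemma bar_basis_in_bar: "ordered_basis V vs \<Longrightarrow> bar_basis vs \<in> bar (dim V) V"
  using bar_top_eq_span[of V vs] by (auto intro: rat_space.span_base)

text \<open>Apartments through \<open>F\<close> suffice to span \<open>St V\<close>, and for such an
  apartment the tensor with \<open>F\<close> is the value of \<open>beta\<close> at a single bar
  symbol.\<close>

lemma ex_beta_lift:
  assumes V: "ordered_basis V es" and F: "F \<in> complete_flags V" and b: "b \<in> St V"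
  shows "\<exists>x\<in>bar (dim V) V. beta V x = bvec F \<otimes>\<^sub>Q b"
  using span_apartments[OF V F b]
proof (induction rule: rat_space.span_induct_alt)
  case base
  show ?case
    by (intro bexI[of _ 0] rat_space.subspace_0 subspace_bar)
      (simp add: qlinear_zero[OF qlinear_beta] qlinear_zero[OF qlinear_tensor_right])
next
  case (step c b b')
  then obtain vs x where vs: "b = apartment vs" "ordered_basis V vs" "flag_of vs = F"
    and x: "x \<in> bar (dim V) V" "beta V x = bvec F \<otimes>\<^sub>Q b'" by blast
  show ?case
  proof (intro bexI[of _ "qscale c (bar_basis vs) + x"])
    show "beta V (qscale c (bar_basis vs) + x) = bvec F \<otimes>\<^sub>Q (qscale c b + b')"
      using vs x by (simp add: qlin_simps[OF qlinear_beta] beta_basis tensor_add_right tensor_scale_right)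
    show "qscale c (bar_basis vs) + x \<in> bar (dim V) V"
      using vs x by (intro rat_space.subspace_add rat_space.subspace_scale subspace_bar bar_basis_in_bar)
  qed
qed

text \<open>Unlike \<open>s\<close>, this inverts \<open>beta\<close> on the whole top group: a
  single F \<otimes> b need not come from a cycle.\<close>

definition beta_lift :: "'v set \<Rightarrow> 'v flag \<Rightarrow> 'v chain \<Rightarrow> 'v bar_chain" where
  "beta_lift V F b = inv_into (bar (dim V) V) (beta V) (bvec F \<otimes>\<^sub>Q b)"

lemma beta_lift:
  assumes "ordered_basis V es" "F \<in> complete_flags V" "b \<in> St V"
  shows "beta_lift V F b \<in> bar (dim V) V" "beta V (beta_lift V F b) = bvec F \<otimes>\<^sub>Q b"
proof -
  have "bvec F \<otimes>\<^sub>Q b \<in> beta V ` bar (dim V) V" using ex_beta_lift[OF assms] by (metis imageI)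
  then show "beta_lift V F b \<in> bar (dim V) V" "beta V (beta_lift V F b) = bvec F \<otimes>\<^sub>Q b"
    unfolding beta_lift_def by (rule inv_into_into, rule f_inv_into_f)
qed

section \<open>Changing a flag within a panel\<close>

lemma span_Un_cong: "span A = span B \<Longrightarrow> span (A \<union> C) = span (B \<union> C)"
  by (simp add: span_Un)

lemma span_pair_eqI:
  assumes "x \<in> span {v, w}" "y \<in> span {v, w}" "v \<in> span {x, y}" "w \<in> span {x, y}"
  shows "span {x, y} = span {v, w}"
  using assms by (intro subset_antisym span_minimal) auto

lemma span_insert_scale:
  assumes "c \<noteq> 0"
  shows "span (insert (scale c v) S) = span (insert v S)"
proof (intro subset_antisym span_minimal subspace_span)
  show "insert (scale c v) S \<subseteq> span (insert v S)"
    by (auto intro: span_base span_scale)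
  have "scale (inverse c) (scale c v) \<in> span (insert (scale c v) S)"
    by (intro span_scale span_base) simp
  then show "insert v S \<subseteq> span (insert (scale c v) S)"
    using assms by (auto intro: span_base)
qed

lemma combination_in_span_pair: "scale \<alpha> v + scale \<gamma> w \<in> span {v, w}"
  by (intro span_add span_scale span_base) auto

text \<open>Changing a flag in one position changes the lift of \<open>[v\<^sub>1, \<dots>, v\<^sub>d]\<close> by the relation
  \<open>[v, w] = [z, w] - [z, v]\<close> in a plane, which the face map contracting that plane does not see.\<close>

lemma face_lift_apartment:
  assumes vs: "ordered_basis V vs" and F': "F' \<in> complete_flags V"
    and omit: "omit (Suc j) F' = omit (Suc j) (flag_of vs)" and j: "Suc j < length vs"
    and \<phi>: "qlinear \<phi>" "\<And>vs. ordered_basis V vs \<Longrightarrow> \<phi> (bar_basis vs) = bar_face j vs"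
  shows "\<exists>x\<in>bar (dim V) V. beta V x = bvec F' \<otimes>\<^sub>Q apartment vs \<and> \<phi> x = bar_face j vs"
proof -
  define us ts v w where "us = take j vs" and "ts = drop (Suc (Suc j)) vs" and "v = vs ! j" and "w = vs ! Suc j"
  have vs_eq: "vs = us @ [v, w] @ ts"
    using j unfolding us_def ts_def v_def w_def by (simp add: Cons_nth_drop_Suc)
  have lus: "length us = j" using j by (simp add: us_def)
  obtain vs' where vs': "ordered_basis V vs'" "flag_of vs' = F'" using complete_flag_basis[OF vs F'] .
  have len: "length vs' = length vs" using vs vs' by (simp add: ordered_basis_length)
  have F'_nth: "F' ! i = flag_of vs ! i" if "i \<le> length vs" "i \<noteq> Suc j" for i
    using omit_eq_nthD[OF omit] that j vs' len by auto
  have pair: "ordered_basis V (us @ [y, z] @ ts)"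
    "span (insert y (set us)) = F' ! Suc j \<Longrightarrow> flag_of (us @ [y, z] @ ts) = F'"
    if yz: "span {y, z} = span {v, w}" for y z
  proof -
    have eq: "span (set (take i (us @ [y, z] @ ts))) = flag_of vs ! i" if i: "i \<le> length vs" "i \<noteq> Suc j" for i
    proof (cases "i \<le> j")
      case True
      then show ?thesis using i lus by (simp add: flag_of_nth vs_eq)
    next
      case False
      then have "i - j \<ge> 2" using i by simp
      then obtain k where "i - j = Suc (Suc k)" by (metis add_2_eq_Suc le_Suc_ex)
      then have "span ({y, z} \<union> (set us \<union> set (take k ts))) = span (set (take i (us @ [y, z] @ ts)))"
        "span ({v, w} \<union> (set us \<union> set (take k ts))) = span (set (take i vs))"
        using lus False by (auto intro!: arg_cong[of _ _ span] simp: vs_eq)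
      then show ?thesis using span_Un_cong[OF yz] i by (simp add: flag_of_nth)
    qed
    have "span (set (us @ [y, z] @ ts)) = V"
      using eq[of "length vs"] j ordered_basis_span[OF vs] by (simp add: vs_eq flag_of_nth)
    then show "ordered_basis V (us @ [y, z] @ ts)"
      by (intro ordered_basis_of_spanning[OF vs]) (simp_all add: vs_eq)
    assume y: "span (insert y (set us)) = F' ! Suc j"
    show "flag_of (us @ [y, z] @ ts) = F'"
    proof (rule nth_equalityI)
      show "length (flag_of (us @ [y, z] @ ts)) = length F'" using len vs' by (auto simp: vs_eq)
      fix i assume "i < length (flag_of (us @ [y, z] @ ts))"
      then have i: "i \<le> length vs" by (simp add: vs_eq)
      show "flag_of (us @ [y, z] @ ts) ! i = F' ! i"
      proof (cases "i = Suc j")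
        case True
        then show ?thesis using y lus by (simp add: flag_of_nth insert_commute)
      next
        case False
        then show ?thesis using eq[of i] F'_nth[of i] i by (simp add: flag_of_nth vs_eq)
      qed
    qed
  qed
  \<comment> \<open>The apartment and the face are both linear in the class \<open>c\<close> of the
    plane, so one relation in the plane serves for both.\<close>
  define AL where "AL c = shuffle_mult (apartment us \<otimes>\<^sub>Q shuffle_mult (c \<otimes>\<^sub>Q apartment ts))" for c
  define TL where "TL c = tensor_list (map (\<lambda>v. apartment [v]) us @ c # map (\<lambda>v. apartment [v]) ts)" for c
  have AL: "qlinear AL" unfolding AL_def
    by (rule qlinear_compose[OF qlinear_shuffle_mult qlinear_compose[OF qlinear_tensor_right
          qlinear_compose[OF qlinear_shuffle_mult qlinear_tensor_left]]])
  have TL: "qlinear TL" unfolding TL_def by (rule qlinear_tensor_list)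
  have ap: "apartment (us @ [y, z] @ ts) = AL (apartment [y, z])" for y z
    unfolding AL_def by (rule apartment_append)
  have face: "bar_face j (us @ [y, z] @ ts) = TL (apartment [y, z])" for y z
    using lus by (simp add: bar_face_def TL_def nth_append)
  have vs_simps: "apartment vs = AL (apartment [v, w])" "bar_face j vs = TL (apartment [v, w])"
    using ap[of v w] face[of v w] vs_eq by auto
  have pair': "bar_basis (us @ [y, z] @ ts) \<in> bar (dim V) V"
    "beta V (bar_basis (us @ [y, z] @ ts)) = bvec F' \<otimes>\<^sub>Q AL (apartment [y, z])"
    "\<phi> (bar_basis (us @ [y, z] @ ts)) = TL (apartment [y, z])"
    if "span {y, z} = span {v, w}" "span (insert y (set us)) = F' ! Suc j" for y z
    using pair[OF that(1)] that(2) by (simp_all only: bar_basis_in_bar beta_basis \<phi>(2) ap face)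

  have us_span: "span (set us) = F' ! j"
    using F'_nth[of j] j by (simp add: flag_of_nth us_def)
  have us_span': "span (set (take j vs')) = span (set us)"
    using us_span j len unfolding vs'(2)[symmetric] by (simp add: flag_of_nth)
  \<comment> \<open>\<open>F' ! Suc j\<close> is \<open>span (set us)\<close> plus a line. The line
    can be chosen inside the plane of \<open>v\<close> and \<open>w\<close>: its generator is
    \<open>z\<close>, what remains of \<open>vs' ! j\<close> after splitting off a vector of
    \<open>span (set us)\<close>.\<close>
  have "vs' ! j \<in> span (set (take (Suc (Suc j)) vs'))"
    using j len by (intro span_base) (auto simp: in_set_conv_nth intro!: exI[of _ j])
  also have "\<dots> = F' ! Suc (Suc j)" using vs' j len by (auto simp: flag_of_nth)
  also have "\<dots> = span (set (take (Suc (Suc j)) vs))" using F'_nth[of "Suc (Suc j)"] j by (simp add: flag_of_nth)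
  also have "\<dots> = span (set us \<union> {v, w})" using lus by (simp add: vs_eq insert_commute)
  finally obtain a z where z: "vs' ! j = a + z" "a \<in> span (set us)" "z \<in> span {v, w}"
    unfolding span_Un by blast
  obtain \<alpha> \<gamma> where zc: "z = scale \<alpha> v + scale \<gamma> w"
  proof -
    obtain \<alpha> where "z - scale \<alpha> v \<in> span {w}" using z(3) by (auto simp: span_breakdown_eq[of z v])
    then obtain \<gamma> where "z - scale \<alpha> v = scale \<gamma> w" by (auto simp: span_singleton)
    then show ?thesis using that by (metis add.commute diff_add_cancel)
  qed
  have z_span: "span (insert z (set us)) = F' ! Suc j"
  proof -
    have "span (insert z (set us)) = span (insert (vs' ! j) (set us))"
    proof (intro subset_antisym span_minimal subspace_span)
      have a: "a \<in> span (insert y (set us))" for y using z(2) span_mono[of "set us" "insert y (set us)"] by auto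
      have "vs' ! j - a \<in> span (insert (vs' ! j) (set us))" by (intro span_diff a span_base) simp
      then show "insert z (set us) \<subseteq> span (insert (vs' ! j) (set us))" using z(1) by (auto intro: span_base)
      have "a + z \<in> span (insert z (set us))" by (intro span_add a span_base) simp
      then show "insert (vs' ! j) (set us) \<subseteq> span (insert z (set us))" using z(1) by (auto intro: span_base)
    qed
    also have "\<dots> = span (set (take (Suc j) vs'))"
      using us_span' j len by (simp add: take_Suc_conv_app_nth span_insert)
    also have "\<dots> = F' ! Suc j" using vs' j len by (auto simp: flag_of_nth)
    finally show ?thesis .
  qed
  have "z \<notin> span (set us)"
  proof
    assume "z \<in> span (set us)"
    then have "vs' ! j \<in> span (set (take j vs'))" using z span_add us_span' by metis
    then show False
      using vs'(1) j len independent_iff_notin_span_take[of vs'] by (auto simp: ordered_basis_def)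
  qed
  then have z0: "z \<noteq> 0" using span_zero by metis
  show ?thesis
  \<comment> \<open>The relation with \<open>z\<close> needs \<open>z\<close> to be independent of
    both \<open>v\<close> and \<open>w\<close>. If \<open>z\<close> is on the line of
    \<open>v\<close>, the symbol of \<open>vs\<close> itself is the lift; if it is on the line of
    \<open>w\<close>, the relation degenerates to [v, w] = - [w, v].\<close>
  proof (cases "\<gamma> = 0")
    case True
    then have "\<alpha> \<noteq> 0" "z = scale \<alpha> v" using z0 zc by auto
    then have "span (insert v (set us)) = span (insert z (set us))"
      by (simp add: span_insert_scale)
    then show ?thesis using pair'[of v w] z_span vs_simps by auto
  next
    case \<gamma>: False
    show ?thesis
    proof (cases "\<alpha> = 0")
      case True
      then have "z = scale \<gamma> w" using zc by simp
      then have "span (insert w (set us)) = span (insert z (set us))"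
        using \<gamma> by (simp add: span_insert_scale)
      then have wv: "span {w, v} = span {v, w}" "span (insert w (set us)) = F' ! Suc j"
        using z_span by (simp_all add: insert_commute)
      have "apartment [v, w] = - apartment [w, v]"
        by (simp add: apartment_pair insert_commute)
      then show ?thesis
        using pair'[OF wv]
        by (intro bexI[of _ "- bar_basis (us @ [w, v] @ ts)"])
          (simp_all add: vs_simps qlinear_neg[OF qlinear_beta] qlinear_neg[OF \<phi>(1)] qlinear_neg[OF AL]
            qlinear_neg[OF TL] qlinear_neg[OF qlinear_tensor_right] rat_space.subspace_neg[OF subspace_bar])
    next
      case \<alpha>: False
      have zw: "span {z, w} = span {v, w}"
      proof (rule span_pair_eqI)
        have "v = scale (inverse \<alpha>) z + scale (- (inverse \<alpha> * \<gamma>)) w"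
          using \<alpha> by (simp add: zc scale_right_distrib)
        then show "v \<in> span {z, w}" by (metis combination_in_span_pair)
      qed (use z in \<open>auto intro: span_base\<close>)
      have zv: "span {z, v} = span {v, w}"
      proof (rule span_pair_eqI)
        have "w = scale (inverse \<gamma>) z + scale (- (inverse \<gamma> * \<alpha>)) v"
          using \<gamma> by (simp add: zc scale_right_distrib)
        then show "w \<in> span {z, v}" by (metis combination_in_span_pair)
      qed (use z in \<open>auto intro: span_base\<close>)
      have "apartment [v, w] = apartment [z, w] - apartment [z, v]"
        unfolding apartment_pair zw zv by simp
      then show ?thesis
        using pair'[OF zw z_span] pair'[OF zv z_span]
        by (intro bexI[of _ "bar_basis (us @ [z, w] @ ts) - bar_basis (us @ [z, v] @ ts)"])
          (simp_all add: vs_simps qlinear_diff[OF qlinear_beta] qlinear_diff[OF \<phi>(1)] qlinear_diff[OF AL]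
            qlinear_diff[OF TL] qlinear_diff[OF qlinear_tensor_right] rat_space.subspace_diff[OF subspace_bar])
    qed
  qed
qed

text \<open>\<open>beta_lift\<close> is an \<open>inv_into\<close> and cannot be computed directly.
  Lifts with equal faces are built along a combination of apartments through \<open>F\<close>, and
  injectivity of \<open>beta\<close> identifies them with the \<open>beta_lift\<close> ones. Face
  \<open>j\<close> merges the vectors at \<open>j\<close> and \<open>Suc j\<close>, which erases the
  flag member at position \<open>Suc j\<close>, as flags count {0} as position 0.\<close>

lemma face_lift_eq:
  assumes V: "ordered_basis V es" and F: "F \<in> complete_flags V" and F': "F' \<in> complete_flags V"
    and omit: "omit (Suc j) F' = omit (Suc j) F" and j: "Suc j < dim V" and b: "b \<in> St V"
    and \<phi>: "qlinear \<phi>" "\<And>vs. ordered_basis V vs \<Longrightarrow> \<phi> (bar_basis vs) = bar_face j vs"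
  shows "\<phi> (beta_lift V F' b) = \<phi> (beta_lift V F b)"
proof -
  have "\<exists>x\<in>bar (dim V) V. \<exists>x'\<in>bar (dim V) V.
      beta V x = bvec F \<otimes>\<^sub>Q b \<and> beta V x' = bvec F' \<otimes>\<^sub>Q b \<and> \<phi> x' = \<phi> x"
    using span_apartments[OF V F b]
  proof (induction rule: rat_space.span_induct_alt)
    case base
    show ?case
      by (intro bexI[of _ 0] rat_space.subspace_0 subspace_bar)
        (simp add: qlinear_zero[OF qlinear_beta] qlinear_zero[OF qlinear_tensor_right])
  next
    case (step c b b')
    obtain x x' where x: "x \<in> bar (dim V) V" "x' \<in> bar (dim V) V" "beta V x = bvec F \<otimes>\<^sub>Q b'"
      "beta V x' = bvec F' \<otimes>\<^sub>Q b'" "\<phi> x' = \<phi> x" using step by blast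
    obtain vs where vs: "b = apartment vs" "ordered_basis V vs" "flag_of vs = F" using step by blast
    obtain y where y: "y \<in> bar (dim V) V" "beta V y = bvec F' \<otimes>\<^sub>Q b" "\<phi> y = bar_face j vs"
      using face_lift_apartment[OF vs(2) F' _ _ \<phi>] vs omit j ordered_basis_length[OF vs(2)] by auto
    show ?case
    proof (rule bexI[of _ "qscale c (bar_basis vs) + x"], rule bexI[of _ "qscale c y + x'"], intro conjI)
      show "beta V (qscale c (bar_basis vs) + x) = bvec F \<otimes>\<^sub>Q (qscale c b + b')"
        "beta V (qscale c y + x') = bvec F' \<otimes>\<^sub>Q (qscale c b + b')"
        using vs x y by (simp_all add: qlin_simps[OF qlinear_beta] beta_basis tensor_add_right tensor_scale_right)
      show "\<phi> (qscale c y + x') = \<phi> (qscale c (bar_basis vs) + x)"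
        using vs x y by (simp add: qlin_simps[OF \<phi>(1)] \<phi>(2))
      show "qscale c (bar_basis vs) + x \<in> bar (dim V) V" "qscale c y + x' \<in> bar (dim V) V"
        using vs x y by (auto intro!: rat_space.subspace_add rat_space.subspace_scale subspace_bar bar_basis_in_bar)
    qed
  qed
  then show ?thesis
    using beta_inj[OF V] beta_lift[OF V F b] beta_lift[OF V F' b] by metis
qed

lemma beta_lift_tensor_cycle:
  assumes V: "ordered_basis V es" and a: "a \<in> St V" and b: "b \<in> St V"
  shows "a \<otimes>\<^sub>Q b \<in> beta V ` bar_cycles V"
proof -
  define x where "x = (\<Sum>F\<in>supp a. qscale (coeff a F) (beta_lift V F b))"
  have F: "F \<in> complete_flags V" if "F \<in> supp a" for F
    using that a by (auto simp: St_def top_chains_def)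
  note lift = beta_lift[OF V F b]
  have x_bar: "x \<in> bar (dim V) V"
    unfolding x_def using lift by (intro rat_space.subspace_sum rat_space.subspace_scale subspace_bar) auto
  have "beta V x = (\<Sum>F\<in>supp a. qscale (coeff a F) (bvec F)) \<otimes>\<^sub>Q b"
    unfolding x_def using lift by (simp add: qlin_simps[OF qlinear_beta] qlin_simps[OF qlinear_tensor_left])
  then have beta_x: "beta V x = a \<otimes>\<^sub>Q b"
    using sum_coeff_bvec[of "supp a" a] by simp
  obtain \<phi> where \<phi>: "\<And>j. qlinear (\<phi> j)"
    "\<And>j vs. ordered_basis V vs \<Longrightarrow> Suc j < length vs \<Longrightarrow> \<phi> j (bar_basis vs) = bar_face j vs"
    using ex_bar_face_map[of V] by metis
  have face: "\<phi> j (bar_basis vs) = bar_face j vs" if "ordered_basis V vs" "j < dim V - 1" for j vs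
    using \<phi>(2)[OF that(1)] that ordered_basis_length[OF that(1)] by simp
  have "bar_boundary (dim V) V y = (\<Sum>j<dim V - 1. qscale ((-1) ^ j) (\<phi> j y))" if "y \<in> bar (dim V) V" for y
  proof (rule qlinear_eq_on_span[where g = "\<lambda>y. \<Sum>j<dim V - 1. qscale ((-1) ^ j) (\<phi> j y)"])
    show "qlinear (bar_boundary (dim V) V)" using bar_boundary_spec[OF V] by blast
    show "qlinear (\<lambda>y. \<Sum>j<dim V - 1. qscale ((-1) ^ j) (\<phi> j y))"
      by (intro qlinear_sumI qlinear_smult \<phi>(1))
    show "y \<in> rat_space.span {bar_basis vs | vs. ordered_basis V vs}" using that bar_top_eq_span[OF V] by simp
  qed (auto simp: bar_boundary_basis face)
  then have "bar_boundary (dim V) V x = (\<Sum>j<dim V - 1. qscale ((-1) ^ j) (\<phi> j x))" using x_bar by blast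
  also have "\<dots> = 0"
  \<comment> \<open>Every face vanishes by itself, without cancellation between different
    \<open>j\<close>.\<close>
  proof (intro sum.neutral ballI)
    fix j assume "j \<in> {..<dim V - 1}"
    then have j: "j < dim V - 1" "Suc j < dim V" by auto
    let ?g = "\<lambda>F. qscale (coeff a F) (\<phi> j (beta_lift V F b))"
    have "\<phi> j x = (\<Sum>F\<in>supp a. ?g F)" unfolding x_def by (simp add: qlin_simps[OF \<phi>(1)])
    also have "\<dots> = (\<Sum>P\<in>omit (Suc j) ` supp a. \<Sum>F | F \<in> supp a \<and> omit (Suc j) F = P. ?g F)"
      by (rule sum.image_gen) simp
    also have "\<dots> = 0"
    proof (rule sum.neutral, rule ballI)
      fix P assume "P \<in> omit (Suc j) ` supp a"
      then obtain F0 where F0: "F0 \<in> supp a" "P = omit (Suc j) F0" by blast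
      have "(\<Sum>F | F \<in> supp a \<and> omit (Suc j) F = P. ?g F) =
          (\<Sum>F | F \<in> supp a \<and> omit (Suc j) F = P. qscale (coeff a F) (\<phi> j (beta_lift V F0 b)))"
      proof (intro sum.cong refl)
        fix G assume "G \<in> {F. F \<in> supp a \<and> omit (Suc j) F = P}"
        then have "G \<in> supp a" "omit (Suc j) G = omit (Suc j) F0" using F0 by auto
        then have "\<phi> j (beta_lift V G b) = \<phi> j (beta_lift V F0 b)"
          using face_lift_eq[OF V F[OF F0(1)] F _ j(2) b \<phi>(1) face[OF _ j(1)]] by blast
        then show "?g G = qscale (coeff a G) (\<phi> j (beta_lift V F0 b))" by simp
      qed
      also have "\<dots> = qscale (\<Sum>F | F \<in> supp a \<and> omit (Suc j) F = P. coeff a F) (\<phi> j (beta_lift V F0 b))"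
        by (simp add: rat_space.scale_sum_left)
      also have "\<dots> = 0"
        using St_panel_sum[OF V a F[OF F0(1)], of "Suc j"] j F0 by simp
      finally show "(\<Sum>F | F \<in> supp a \<and> omit (Suc j) F = P. ?g F) = 0" .
    qed
    finally show "qscale ((-1) ^ j) (\<phi> j x) = 0" by simp
  qed
  finally have "x \<in> bar_cycles V" using x_bar by (simp add: bar_cycles_def)
  then show ?thesis using beta_x by (metis imageI)
qed

lemma St2_subset_beta_cycles:
  assumes V: "ordered_basis V es"
  shows "St2 V \<subseteq> beta V ` bar_cycles V"
  unfolding St2_def
proof (rule rat_space.span_minimal)
  show "{a \<otimes>\<^sub>Q b | a b. a \<in> St V \<and> b \<in> St V} \<subseteq> beta V ` bar_cycles V"
    using beta_lift_tensor_cycle[OF V] by blast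
  have lin: "qlinear (bar_boundary (dim V) V)" using bar_boundary_spec[OF V] by blast
  have cycles: "rat_space.subspace (bar_cycles V)"
    by (rule rat_space.subspaceI)
      (auto simp: bar_cycles_def qlin_simps[OF lin] rat_space.subspace_0[OF subspace_bar]
        rat_space.subspace_add[OF subspace_bar] rat_space.subspace_scale[OF subspace_bar])
  show "rat_space.subspace (beta V ` bar_cycles V)"
  proof (rule rat_space.subspaceI)
    show "0 \<in> beta V ` bar_cycles V"
      using rat_space.subspace_0[OF cycles] qlinear_zero[OF qlinear_beta] by (metis imageI)
    fix x y assume "x \<in> beta V ` bar_cycles V" "y \<in> beta V ` bar_cycles V"
    then obtain x' y' where "x = beta V x'" "x' \<in> bar_cycles V" "y = beta V y'" "y' \<in> bar_cycles V" by blast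
    then show "x + y \<in> beta V ` bar_cycles V"
      using rat_space.subspace_add[OF cycles] by (intro image_eqI[of _ _ "x' + y'"]) (simp_all add: qlinear_add[OF qlinear_beta])
  next
    fix c x assume "x \<in> beta V ` bar_cycles V"
    then obtain x' where "x = beta V x'" "x' \<in> bar_cycles V" by blast
    then show "qscale c x \<in> beta V ` bar_cycles V"
      using rat_space.subspace_scale[OF cycles] by (intro image_eqI[of _ _ "qscale c x'"]) (simp_all add: qlinear_scale[OF qlinear_beta])
  qed
qed

section \<open>The product on the Steinberg square\<close>

text \<open>\<open>inv_into\<close> is an inverse only on the image, so \<open>s\<close> acquires
  its meaning from \<open>St2_subset_beta_cycles\<close>.\<close>

lemma s_St2:
  assumes "ordered_basis V es" "z \<in> St2 V"
  shows "s V z \<in> bar (dim V) V" "beta V (s V z) = z"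
proof -
  have z: "z \<in> beta V ` bar_cycles V" using assms St2_subset_beta_cycles by blast
  then have "s V z \<in> bar_cycles V" unfolding s_def by (rule inv_into_into)
  then show "s V z \<in> bar (dim V) V" by (simp add: bar_cycles_def)
  show "beta V (s V z) = z" unfolding s_def using z by (rule f_inv_into_f)
qed

lemma inj_on_s:
  assumes "ordered_basis V es"
  shows "inj_on (s V) (St2 V)"
  by (rule inj_on_inverseI[of _ "beta V"]) (rule s_St2[OF assms])

lemma tensor_in_St2: "a \<in> St V \<Longrightarrow> b \<in> St V \<Longrightarrow> a \<otimes>\<^sub>Q b \<in> St2 V"
  unfolding St2_def by (intro rat_space.span_base) blast

lemma St_eq_span_apartments:
  assumes "ordered_basis V es"
  shows "St V = rat_space.span {apartment vs | vs. ordered_basis V vs}"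
proof
  show "St V \<subseteq> rat_space.span {apartment vs | vs. ordered_basis V vs}"
  proof
    fix c assume "c \<in> St V"
    moreover have "{apartment vs | vs. ordered_basis V vs \<and> flag_of vs = flag_of es} \<subseteq>
        {apartment vs | vs. ordered_basis V vs}" by blast
    ultimately show "c \<in> rat_space.span {apartment vs | vs. ordered_basis V vs}"
      using solomon_tits[OF assms] rat_space.span_mono by blast
  qed
  show "rat_space.span {apartment vs | vs. ordered_basis V vs} \<subseteq> St V"
    by (intro rat_space.span_minimal subspace_St) (auto intro: apartment_in_St)
qed

lemma span_tensor_eqI:
  assumes f: "qlinear f" and g: "qlinear g"
    and eq: "\<And>x y. x \<in> A \<Longrightarrow> y \<in> B \<Longrightarrow> f (x \<otimes>\<^sub>Q y) = g (x \<otimes>\<^sub>Q y)"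
    and x: "x \<in> rat_space.span A" and y: "y \<in> rat_space.span B"
  shows "f (x \<otimes>\<^sub>Q y) = g (x \<otimes>\<^sub>Q y)"
proof (rule qlinear_eq_on_span[OF qlinear_compose[OF f qlinear_tensor_left] qlinear_compose[OF g qlinear_tensor_left] _ x])
  fix x assume "x \<in> A"
  then show "f (x \<otimes>\<^sub>Q y) = g (x \<otimes>\<^sub>Q y)"
    using qlinear_eq_on_span[OF qlinear_compose[OF f qlinear_tensor_right]
        qlinear_compose[OF g qlinear_tensor_right], of B x x y] eq y by blast
qed

text \<open>Both maps are linear and agree on tensors of apartments, which span; this replaces the
  chosen map by an explicit one on the Steinberg modules.\<close>

lemma St_mult_eq_shuffle_mult:
  assumes "ordered_basis V1 es" "ordered_basis V2 fs" "a1 \<in> St V1" "a2 \<in> St V2"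
  shows "St_mult V1 V2 (a1 \<otimes>\<^sub>Q a2) = shuffle_mult (a1 \<otimes>\<^sub>Q a2)"
  using assms(3,4) unfolding St_eq_span_apartments[OF assms(1)] St_eq_span_apartments[OF assms(2)]
  by (rule span_tensor_eqI[OF qlinear_St_mult qlinear_shuffle_mult, rotated])
    (auto simp: St_mult_apartment shuffle_mult_apartment)

lemma shuffle_mult_St:
  assumes sum: "direct_sum V [V1, V2]" and V1: "ordered_basis V1 es" and V2: "ordered_basis V2 fs"
    and a: "a1 \<in> St V1" "a2 \<in> St V2"
  shows "shuffle_mult (a1 \<otimes>\<^sub>Q a2) \<in> St V"
proof -
  have "shuffle_mult (a1 \<otimes>\<^sub>Q a2) \<in> St V" if "a1 = apartment vs" "ordered_basis V1 vs" for vs a1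
    using a(2) unfolding St_eq_span_apartments[OF V2]
  proof (induction rule: rat_space.span_induct_alt)
    case base
    then show ?case
      by (simp add: qlinear_zero[OF qlinear_tensor_right] qlinear_zero[OF qlinear_shuffle_mult]
          rat_space.subspace_0[OF subspace_St])
  next
    case (step c x y)
    then have "shuffle_mult (a1 \<otimes>\<^sub>Q x) \<in> St V"
      using that by (auto simp: shuffle_mult_apartment intro!: apartment_in_St ordered_basis_append[OF sum])
    then show ?case
      using step by (simp add: tensor_add_right tensor_scale_right qlin_simps[OF qlinear_shuffle_mult]
          rat_space.subspace_add[OF subspace_St] rat_space.subspace_scale[OF subspace_St])
  qed
  note left = this
  show ?thesis
    using a(1) unfolding St_eq_span_apartments[OF V1]
  proof (induction rule: rat_space.span_induct_alt)
    case base
    then show ?case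
      by (simp add: qlinear_zero[OF qlinear_tensor_left] qlinear_zero[OF qlinear_shuffle_mult]
          rat_space.subspace_0[OF subspace_St])
  next
    case (step c x y)
    then have "shuffle_mult (x \<otimes>\<^sub>Q a2) \<in> St V" using left by blast
    then show ?case
      using step by (simp add: tensor_add_left tensor_scale_left qlin_simps[OF qlinear_shuffle_mult]
          rat_space.subspace_add[OF subspace_St] rat_space.subspace_scale[OF subspace_St])
  qed
qed

text \<open>The map \<mu> \<otimes> \<mu> of the overview, preceded by the exchange of the two
  middle tensor factors.\<close>

definition shuffle_mult2 :: "(('v flag \<times> 'v flag) \<times> ('v flag \<times> 'v flag) \<Rightarrow>\<^sub>0 rat) \<Rightarrow> 'v chain2" where
  "shuffle_mult2 = lin_ext (\<lambda>((F, A), (G, B)).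
     shuffle_mult (bvec (F, G)) \<otimes>\<^sub>Q shuffle_mult (bvec (A, B)))"

lemma qlinear_shuffle_mult2: "qlinear shuffle_mult2"
  unfolding shuffle_mult2_def by (rule qlinear_lin_ext)

lemma shuffle_mult2_tensor:
  "shuffle_mult2 ((a1 \<otimes>\<^sub>Q b1) \<otimes>\<^sub>Q (a2 \<otimes>\<^sub>Q b2)) = shuffle_mult (a1 \<otimes>\<^sub>Q a2) \<otimes>\<^sub>Q shuffle_mult (b1 \<otimes>\<^sub>Q b2)"
proof -
  note sm = qlinear_compose[OF qlinear_shuffle_mult] and sm2 = qlinear_compose[OF qlinear_shuffle_mult2]
    and tl = qlinear_tensor_left and tr = qlinear_tensor_right
    and tl' = qlinear_compose[OF qlinear_tensor_left] and tr' = qlinear_compose[OF qlinear_tensor_right]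
  have 0: "shuffle_mult2 ((bvec F \<otimes>\<^sub>Q bvec A) \<otimes>\<^sub>Q (bvec G \<otimes>\<^sub>Q bvec B)) =
      shuffle_mult (bvec F \<otimes>\<^sub>Q bvec G) \<otimes>\<^sub>Q shuffle_mult (bvec A \<otimes>\<^sub>Q bvec B)" for F A G B
    by (simp add: tensor_single shuffle_mult2_def)
  \<comment> \<open>The four basis vectors are released to arbitrary chains one factor at a
    time.\<close>
  have 1: "shuffle_mult2 ((bvec F \<otimes>\<^sub>Q bvec A) \<otimes>\<^sub>Q (bvec G \<otimes>\<^sub>Q b2)) =
      shuffle_mult (bvec F \<otimes>\<^sub>Q bvec G) \<otimes>\<^sub>Q shuffle_mult (bvec A \<otimes>\<^sub>Q b2)" for F A G
    by (rule qlinear_eqI[OF sm2[OF tr'[OF tr]] tr'[OF sm[OF tr]] 0])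
  have 2: "shuffle_mult2 ((bvec F \<otimes>\<^sub>Q bvec A) \<otimes>\<^sub>Q (a2 \<otimes>\<^sub>Q b2)) =
      shuffle_mult (bvec F \<otimes>\<^sub>Q a2) \<otimes>\<^sub>Q shuffle_mult (bvec A \<otimes>\<^sub>Q b2)" for F A
    by (rule qlinear_eqI[OF sm2[OF tr'[OF tl]] tl'[OF sm[OF tr]] 1])
  have 3: "shuffle_mult2 ((bvec F \<otimes>\<^sub>Q b1) \<otimes>\<^sub>Q (a2 \<otimes>\<^sub>Q b2)) =
      shuffle_mult (bvec F \<otimes>\<^sub>Q a2) \<otimes>\<^sub>Q shuffle_mult (b1 \<otimes>\<^sub>Q b2)" for F
    by (rule qlinear_eqI[OF sm2[OF tl'[OF tr]] tr'[OF sm[OF tl]] 2])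
  show ?thesis
    by (rule qlinear_eqI[OF sm2[OF tl'[OF tl]] tl'[OF sm[OF tl]] 3])
qed

text \<open>Every shuffle of the two bases has the same apartment up to sign. With these signs moved
  to the left, the flags add up to \<open>shuffle_mult\<close> of the two flags, and the right
  factor is constant.\<close>

lemma beta_bar_shuffle_basis:
  assumes sum: "direct_sum V [V1, V2]" and vs: "ordered_basis V1 vs" and ws: "ordered_basis V2 ws"
  shows "bar_shuffle V1 V2 (bar_basis vs \<otimes>\<^sub>Q bar_basis ws) \<in> bar (dim V) V"
    "beta V (bar_shuffle V1 V2 (bar_basis vs \<otimes>\<^sub>Q bar_basis ws)) =
      shuffle_mult2 (beta V1 (bar_basis vs) \<otimes>\<^sub>Q beta V2 (bar_basis ws))"
proof -
  let ?Sh = "shuffle_perms (length vs) (length ws)"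
  have perm: "\<sigma> permutes {..<length (vs @ ws)}" if "\<sigma> \<in> ?Sh" for \<sigma>
    using that by (simp add: shuffle_perms_def)
  have basis: "ordered_basis V (permute_list \<sigma> (vs @ ws))" if "\<sigma> \<in> ?Sh" for \<sigma>
    using ordered_basis_permute[OF ordered_basis_append[OF sum vs ws] perm[OF that]] .
  show "bar_shuffle V1 V2 (bar_basis vs \<otimes>\<^sub>Q bar_basis ws) \<in> bar (dim V) V"
    unfolding bar_shuffle_basis[OF vs ws]
    by (intro rat_space.subspace_sum subspace_bar bar_basis_in_bar basis)
  have "beta V (bar_shuffle V1 V2 (bar_basis vs \<otimes>\<^sub>Q bar_basis ws)) =
      (\<Sum>\<sigma>\<in>?Sh. bvec (flag_of (permute_list \<sigma> (vs @ ws))) \<otimes>\<^sub>Q apartment (permute_list \<sigma> (vs @ ws)))"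
    unfolding bar_shuffle_basis[OF vs ws] qlin_simps[OF qlinear_beta]
    by (intro sum.cong refl beta_basis basis)
  also have "\<dots> = (\<Sum>\<sigma>\<in>?Sh. qscale (of_int (sign \<sigma>)) (bvec (flag_of (permute_list \<sigma> (vs @ ws)))) \<otimes>\<^sub>Q apartment (vs @ ws))"
  proof (intro sum.cong refl)
    fix \<sigma> assume "\<sigma> \<in> ?Sh"
    show "bvec (flag_of (permute_list \<sigma> (vs @ ws))) \<otimes>\<^sub>Q apartment (permute_list \<sigma> (vs @ ws)) =
        qscale (of_int (sign \<sigma>)) (bvec (flag_of (permute_list \<sigma> (vs @ ws)))) \<otimes>\<^sub>Q apartment (vs @ ws)"
      unfolding apartment_permute[OF perm[OF \<open>\<sigma> \<in> ?Sh\<close>]] tensor_scale_left tensor_scale_right by (rule refl)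
  qed
  also have "\<dots> = shuffle_mult (bvec (flag_of vs) \<otimes>\<^sub>Q bvec (flag_of ws)) \<otimes>\<^sub>Q
      shuffle_mult (apartment vs \<otimes>\<^sub>Q apartment ws)"
    by (simp only: shuffle_mult_flags shuffle_mult_apartment qlinear_sum[OF qlinear_tensor_left])
  finally show "beta V (bar_shuffle V1 V2 (bar_basis vs \<otimes>\<^sub>Q bar_basis ws)) =
      shuffle_mult2 (beta V1 (bar_basis vs) \<otimes>\<^sub>Q beta V2 (bar_basis ws))"
    by (simp only: beta_basis[OF vs] beta_basis[OF ws] shuffle_mult2_tensor)
qed

lemma beta_bar_shuffle:
  assumes sum: "direct_sum V [V1, V2]" and V1: "ordered_basis V1 es" and V2: "ordered_basis V2 fs"
    and x: "x \<in> bar (dim V1) V1" and y: "y \<in> bar (dim V2) V2"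
  shows "bar_shuffle V1 V2 (x \<otimes>\<^sub>Q y) \<in> bar (dim V) V \<and>
    beta V (bar_shuffle V1 V2 (x \<otimes>\<^sub>Q y)) = shuffle_mult2 (beta V1 x \<otimes>\<^sub>Q beta V2 y)" (is "?P x y")
proof -
  note simps = tensor_add_left tensor_add_right tensor_scale_left tensor_scale_right
    qlin_simps[OF qlinear_beta] qlin_simps[OF qlinear_bar_shuffle] qlin_simps[OF qlinear_shuffle_mult2]
    qlinear_zero[OF qlinear_tensor_left] qlinear_zero[OF qlinear_tensor_right]
    rat_space.subspace_0[OF subspace_bar] rat_space.subspace_add[OF subspace_bar]
    rat_space.subspace_scale[OF subspace_bar]
  have left: "?P (bar_basis vs) y" if vs: "ordered_basis V1 vs" for vs
    using y unfolding bar_top_eq_span[OF V2]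
  proof (induction rule: rat_space.span_induct_alt)
    case base
    show ?case by (simp add: simps)
  next
    case (step c z y)
    then have "?P (bar_basis vs) z" using beta_bar_shuffle_basis[OF sum vs] by blast
    then show ?case using step by (simp add: simps)
  qed
  show ?thesis
    using x unfolding bar_top_eq_span[OF V1]
  proof (induction rule: rat_space.span_induct_alt)
    case base
    show ?case by (simp add: simps)
  next
    case (step c z x)
    then have "?P z y" using left by blast
    then show ?case using step by (simp add: simps)
  qed
qed

lemma St2_mult_tensor:
  assumes fin: "fin_dim V" and sum: "direct_sum V [V1, V2]"
    and a1: "a1 \<in> St V1" and b1: "b1 \<in> St V1" and a2: "a2 \<in> St V2" and b2: "b2 \<in> St V2"
  shows "St2_mult V V1 V2 (a1 \<otimes>\<^sub>Q b1) (a2 \<otimes>\<^sub>Q b2) =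
           St_mult V1 V2 (a1 \<otimes>\<^sub>Q a2) \<otimes>\<^sub>Q St_mult V1 V2 (b1 \<otimes>\<^sub>Q b2) \<and>
         St_mult V1 V2 (a1 \<otimes>\<^sub>Q a2) \<otimes>\<^sub>Q St_mult V1 V2 (b1 \<otimes>\<^sub>Q b2) \<in> St2 V"
proof -
  have sub: "subspace V1" "subspace V2" and img: "sum_list ` listset [V1, V2] = V"
    using sum by (auto simp: direct_sum_def bij_betw_def)
  have mem: "x + y \<in> V" if "x \<in> V1" "y \<in> V2" for x y
  proof -
    have "[x, y] \<in> listset [V1, V2]" using that by (simp add: set_Cons_def)
    then have "sum_list [x, y] \<in> V" using img by blast
    then show ?thesis by simp
  qed
  have "V1 \<subseteq> V" "V2 \<subseteq> V"
    using mem[OF _ subspace_0[OF sub(2)]] mem[OF subspace_0[OF sub(1)]] by auto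
  then obtain es fs where V1: "ordered_basis V1 es" and V2: "ordered_basis V2 fs"
    using fin_dim_subspace_basis[OF fin sub(1)] fin_dim_subspace_basis[OF fin sub(2)] by metis
  have V: "ordered_basis V (es @ fs)" using ordered_basis_append[OF sum V1 V2] .
  define z where "z = shuffle_mult (a1 \<otimes>\<^sub>Q a2) \<otimes>\<^sub>Q shuffle_mult (b1 \<otimes>\<^sub>Q b2)"
  have z: "z \<in> St2 V"
    unfolding z_def using a1 a2 b1 b2 by (intro tensor_in_St2 shuffle_mult_St[OF sum V1 V2])
  let ?w = "bar_shuffle V1 V2 (s V1 (a1 \<otimes>\<^sub>Q b1) \<otimes>\<^sub>Q s V2 (a2 \<otimes>\<^sub>Q b2))"
  note s1 = s_St2[OF V1 tensor_in_St2[OF a1 b1]] and s2 = s_St2[OF V2 tensor_in_St2[OF a2 b2]]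
  have "?w \<in> bar (dim V) V" "beta V ?w = z"
    using beta_bar_shuffle[OF sum V1 V2 s1(1) s2(1)] s1(2) s2(2)
    by (simp_all add: shuffle_mult2_tensor z_def)
  \<comment> \<open>Injectivity of \<open>beta\<close> on \<open>bar (dim V) V\<close> also shows
    that the shuffle of the two cycles is a cycle, so that undoing \<open>s V\<close> is
    legitimate.\<close>
  then have "?w = s V z" using beta_inj[OF V] s_St2[OF V z] by metis
  then have "St2_mult V V1 V2 (a1 \<otimes>\<^sub>Q b1) (a2 \<otimes>\<^sub>Q b2) = z"
    using inv_into_f_f[OF inj_on_s[OF V] z] by (simp add: St2_mult_def)
  moreover have "St_mult V1 V2 (a1 \<otimes>\<^sub>Q a2) \<otimes>\<^sub>Q St_mult V1 V2 (b1 \<otimes>\<^sub>Q b2) = z"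
    using St_mult_eq_shuffle_mult[OF V1 V2] a1 a2 b1 b2 by (simp add: z_def)
  ultimately show ?thesis using z by simp
qed

end

theorem proposition20:
  fixes scale :: "'f::field \<Rightarrow> 'v::ab_group_add \<Rightarrow> 'v"
    and V V1 V2 :: "'v set"
    and a1 b1 a2 b2 :: "'v chain"
  assumes "vector_space scale"
    and "steinberg.fin_dim scale V"
    and "steinberg.direct_sum scale V [V1, V2]"
    and "a1 \<in> steinberg.St scale V1" and "b1 \<in> steinberg.St scale V1"
    and "a2 \<in> steinberg.St scale V2" and "b2 \<in> steinberg.St scale V2"
  shows "steinberg.St2_mult scale V V1 V2 (a1 \<otimes>\<^sub>Q b1) (a2 \<otimes>\<^sub>Q b2) =
           steinberg.St_mult scale V1 V2 (a1 \<otimes>\<^sub>Q a2) \<otimes>\<^sub>Q steinberg.St_mult scale V1 V2 (b1 \<otimes>\<^sub>Q b2) \<and>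
         steinberg.St_mult scale V1 V2 (a1 \<otimes>\<^sub>Q a2) \<otimes>\<^sub>Q steinberg.St_mult scale V1 V2 (b1 \<otimes>\<^sub>Q b2)
           \<in> steinberg.St2 scale V"
proof -
  interpret steinberg scale using assms(1) by (rule steinberg.intro)
  show ?thesis using assms(2-) by (rule St2_mult_tensor)
qed

end
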